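(* Let $H_n$ be the ensemble of random matrices of the long-range percolation model described in the context. If $\hat\mu_3=\sup_{i,j}\mathbf{E}\{|a(i,j)|^3\}<\infty$, then in the limit $n\to\infty$, $b_n\to\infty$, $b_n/n\to 0$, the normalized eigenvalue counting function of $H_n$ converges in probability to the nonrandom semicircle distribution function: $$\operatorname*{p\text{-}lim}_{n\to\infty}\ \sigma_n(\lambda,H_n)=\sigma_{sc}(\lambda),\qquad \lambda\in\mathbb{R}.$$
   Context: Setting. Let $v>0$ and let $\{a(i,j): i\le j,\ i,j\in\mathbb{Z}\}$ be independent real random variables with $\mathbf{E}\{a(i,j)\}=0$ and $\mathbf{E}\{a(i,j)^2\}=v^2$. Let $\psi:\mathbb{R}\to[0,1]$ be a continuous even function, non-increasing on $[0,\infty)$ and vanishing at infinity, with $\int_{\mathbb{R}}\psi(t)\,dt=1$. Let $N=2n+1$ and let $b_n$ be a sequence of integers with $0<b_n\le N$, $b_n\to\infty$ and $b_n/n\to0$ as $n\to\infty$. For each $n$ let $\{d(i,j): -n\le i\le j\le n\}$ be independent Bernoulli random variables, independent of the family $\{a(i,j)\}$ and defined on the same probability space, with $d(i,j)=1$ with probability $\psi((i-j)/b_n)$ and $d(i,j)=0$ with probability $1-\psi((i-j)/b_n)$. Define the real symmetric $N\times N$ random matrix $H_n$, with rows and columns indexed by $\{-n,\dots,n\}$, by $H_n(i,j)=H_n(j,i)=b_n^{-1/2}a(i,j)d(i,j)$ for $i\le j$. Let $\lambda^{(n)}_{-n}\le\dots\le\lambda^{(n)}_n$ be the eigenvalues of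 $H_n$ and $\sigma_n(\lambda,H_n)=N^{-1}\#\{j:\lambda_j^{(n)}\le\lambda\}$. The semicircle distribution function $\sigma_{sc}$ is the distribution function of the probability measure with density $\rho_{sc}(\lambda)=\frac{1}{2\pi v^2}\sqrt{4v^2-\lambda^2}$ for $|\lambda|\le 2v$ and $\rho_{sc}(\lambda)=0$ otherwise. *)

theory Defs
  imports "HOL-Probability.Probability" "Jordan_Normal_Form.Char_Poly"
begin

(* Rows and columns of the N x N matrix, N = 2n+1, are labelled by -n, ..., n in the model;
   position r < N of the matrix carries the label r - n.  Only a(i,j) and d(i,j) with
   i \<le> j are used, which is what min and max achieve. *)
definition percolation_matrix ::
  "(int \<Rightarrow> int \<Rightarrow> 'w \<Rightarrow> real) \<Rightarrow> (nat \<Rightarrow> int \<Rightarrow> int \<Rightarrow> 'w \<Rightarrow> real) \<Rightarrow> (nat \<Rightarrow> int) \<Rightarrow> nat \<Rightarrow> 'w \<Rightarrow> real mat"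
  where
  "percolation_matrix a d b n \<omega> =
     mat (2 * n + 1) (2 * n + 1)
       (\<lambda>(r, c).
          let i = int (min r c) - int n; j = int (max r c) - int n
          in a i j \<omega> * d n i j \<omega> / sqrt (real_of_int (b n)))"

(* The roots of the characteristic polynomial, with multiplicity, in non-decreasing order.
   For a real symmetric N x N matrix the list has length N. *)
definition sorted_eigenvalues :: "real mat \<Rightarrow> real list" where
  "sorted_eigenvalues A = sorted_list_of_multiset (proots (char_poly A))"

definition eigenvalue_counting :: "real mat \<Rightarrow> real \<Rightarrow> real" where
  "eigenvalue_counting A t =
     real (card {k. k < length (sorted_eigenvalues A) \<and> sorted_eigenvalues A ! k \<le> t})
       / real (dim_row A)"

definition semicircle_density :: "real \<Rightarrow> real \<Rightarrow> real" where
  "semicircle_density v x =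
     (if \<bar>x\<bar> \<le> 2 * v then sqrt (4 * v\<^sup>2 - x\<^sup>2) / (2 * pi * v\<^sup>2) else 0)"

definition semicircle_cdf :: "real \<Rightarrow> real \<Rightarrow> real" where
  "semicircle_cdf v = cdf (density lborel (\<lambda>x. ennreal (semicircle_density v x)))"

(* Measurability is part of the notion: measure assigns 0 to non-measurable sets, so without
   it the limit alone could hold for the wrong reason. *)
definition tendsto_in_probability ::
  "'w measure \<Rightarrow> (nat \<Rightarrow> 'w \<Rightarrow> real) \<Rightarrow> real \<Rightarrow> bool" where
  "tendsto_in_probability M X c \<longleftrightarrow>
     (\<forall>n. X n \<in> borel_measurable M) \<and>
     (\<forall>\<epsilon>>0. (\<lambda>n. measure M {\<omega> \<in> space M. \<bar>X n \<omega> - c\<bar> > \<epsilon>}) \<longlonglongrightarrow> 0)"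

end

theory Submission
  imports Defs "Jordan_Normal_Form.Schur_Decomposition"
begin

text \<open>The proof studies the resolvent \<open>G = (H - z)\<^sup>-\<^sup>1\<close> at points \<open>z = i \<eta>\<close> with \<open>\<eta>\<close> at least \<open>1\<close> and
\<open>2 v\<close>. Put \<open>S(k,l) = \<psi>((k - l)/b) / b\<close>, so that \<open>H(k,l)\<close> has variance \<open>v\<^sup>2 S(k,l)\<close>, and
\<open>T(k) = \<Sum>l. S(k,l) G(l,l)\<close>. Let \<open>s\<close> be the Stieltjes transform of the semicircle law at \<open>z\<close>; it
satisfies \<open>v\<^sup>2 s\<^sup>2 + z s + 1 = 0\<close> and \<open>\<bar>s\<bar> \<le> 1/\<eta>\<close>.

The equation \<open>(H - z) G = 1\<close> reads \<open>1 + z G(i,i) = \<Sum>j. H(i,j) G(j,i)\<close> on the diagonal. For a smooth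
function \<open>F\<close> of the independent centred entries, \<open>E[H(i,j) F] = v\<^sup>2 S(i,j) E[\<partial>F/\<partial>H(i,j)]\<close> up to the third
absolute moment of \<open>H(i,j)\<close> (\<open>first_order_expansion\<close>), and that moment is of order
\<open>S(i,j) / sqrt b\<close>. With \<open>Q = cnj (T(k) - s)\<close> and \<open>F = Q G(j,i)\<close>, the derivative is
\<open>- Q G(j,j) G(i,i)\<close> plus terms that are small after summation over \<open>j\<close>, because
\<open>\<Sum>j. \<bar>G(i,j)\<bar>\<^sup>2 \<le> 1/\<eta>\<^sup>2\<close> and \<open>S \<le> 1/b\<close>. Hence
\<open>E Q + z E[Q G(i,i)] + v\<^sup>2 E[Q T(i) G(i,i)]\<close> tends to zero (\<open>approximate_fixed_point\<close>). Comparison with the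
equation for \<open>s\<close> bounds \<open>E[Q (G(i,i) - s)]\<close> by \<open>E[\<bar>T(k) - s\<bar> \<bar>T(i) - s\<bar>] / 4\<close> plus an error
(\<open>covariance_bound\<close>). Summing over \<open>i\<close> with the weights \<open>S(k,i)\<close> rebuilds \<open>T(k) - s\<close>, so the average over
\<open>k\<close> of \<open>E \<bar>T(k) - s\<bar>\<^sup>2\<close> is at most half of itself plus errors (\<open>mean_square_bound\<close>). As \<open>Q\<close> is the
quantity being estimated, its mean and its fluctuations are controlled in one step. Averaging over
\<open>k\<close>, instead of taking a supremum, makes the rows near the corners of the matrix harmless: their row
sums of \<open>S\<close> stay away from \<open>1\<close>, but they are only a fraction \<open>b/N\<close> of all rows (\<open>average_row_defect\<close>).
Thus the normalized trace of \<open>G\<close> converges to \<open>s\<close> in mean.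

The trace of \<open>G\<close> is the sum of \<open>1/(\<lambda> - z)\<close> over the eigenvalues \<open>\<lambda>\<close>. By partial fractions the closed span
of the functions \<open>1/(x - z)\<close> is closed under products, and the Stone--Weierstrass theorem, on the circle
traced by \<open>1/(x - i c)\<close>, shows that it contains all continuous functions of compact support
(\<open>resolvent_closure_compact_support\<close>). Eigenvalue averages of such functions therefore converge as
well. Ramps below the indicators of \<open>{x. x < t}\<close> and \<open>{x. t < x}\<close> bound the counting function from below
and from above, and nothing is lost at infinity since the semicircle law has total mass one. The same
approximation shows that the counting function is measurable.\<close>

section \<open>Resolvents of real symmetric matrices\<close>

text \<open>An entry of a symmetric matrix is addressed by the ordered pair of its row and column, so that a symmetric
matrix is the same as a family of independent parameters \<open>x (i, j)\<close> with \<open>i \<le> j\<close>.\<close>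

definition sym_index :: "nat \<Rightarrow> nat \<Rightarrow> nat \<times> nat" where
  "sym_index i j = (min i j, max i j)"

definition shifted_matrix :: "nat \<Rightarrow> complex \<Rightarrow> (nat \<times> nat \<Rightarrow> real) \<Rightarrow> complex mat" where
  "shifted_matrix N z x =
     mat N N (\<lambda>(i, j). of_real (x (sym_index i j)) - (if i = j then z else 0))"

text \<open>The inverse of \<open>H - z\<close>, given by Cramer's rule. This form makes the entries rational, hence measurable,
functions of the parameters.\<close>

definition resolvent :: "nat \<Rightarrow> complex \<Rightarrow> (nat \<times> nat \<Rightarrow> real) \<Rightarrow> nat \<Rightarrow> nat \<Rightarrow> complex" where
  "resolvent N z x i j =
     adj_mat (shifted_matrix N z x) $$ (i, j) / Determinant.det (shifted_matrix N z x)"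

lemma sym_index_commute: "sym_index i j = sym_index j i"
  by (simp add: sym_index_def min.commute max.commute)

lemma shifted_carrier [simp]: "shifted_matrix N z x \<in> carrier_mat N N"
  by (simp add: shifted_matrix_def)

text \<open>Conjugation exchanges the two summation indices, and the matrix is symmetric.\<close>

lemma quadratic_form_real:
  fixes u :: "nat \<Rightarrow> complex" and x :: "nat \<times> nat \<Rightarrow> real"
  shows "(\<Sum>i<N. \<Sum>j<N. cnj (u i) * of_real (x (sym_index i j)) * u j) \<in> \<real>"
proof -
  let ?q = "\<Sum>i<N. \<Sum>j<N. cnj (u i) * of_real (x (sym_index i j)) * u j"
  have "cnj ?q = (\<Sum>i<N. \<Sum>j<N. cnj (u j) * of_real (x (sym_index j i)) * u i)"
    by (simp add: sym_index_commute mult_ac)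
  also have "\<dots> = ?q" by (rule sum.swap)
  finally show ?thesis by (simp only: Reals_cnj_iff)
qed

lemma sum_shifted_row:
  fixes f g :: "nat \<Rightarrow> complex"
  assumes "i < N"
  shows "(\<Sum>j<N. (f j - (if i = j then z else 0)) * g j) = (\<Sum>j<N. f j * g j) - z * g i"
proof -
  have "(\<Sum>j<N. (if i = j then z else 0) * g j) = (\<Sum>j<N. if i = j then z * g j else 0)"
    by (intro sum.cong) auto
  then show ?thesis using assms by (simp add: left_diff_distrib sum_subtractf)
qed

lemma sum_times_delta:
  fixes f g :: "nat \<Rightarrow> complex"
  assumes "k < N"
  shows "(\<Sum>j<N. g j * (f j + (if j = k then 1 else 0))) = (\<Sum>j<N. g j * f j) + g k"
proof -
  have "(\<Sum>j<N. g j * (if j = k then 1 else 0)) = (\<Sum>j<N. if j = k then g j else 0)"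
    by (intro sum.cong) auto
  then show ?thesis using assms by (simp add: distrib_left sum.distrib)
qed

lemma eigenvalue_real:
  assumes ev: "\<And>i. i < N \<Longrightarrow> (\<Sum>j<N. of_real (x (sym_index i j)) * u j) = z * u i"
    and nz: "k < N" "u k \<noteq> 0"
  shows "Im z = 0"
proof -
  have "(\<Sum>i<N. \<Sum>j<N. cnj (u i) * of_real (x (sym_index i j)) * u j) = (\<Sum>i<N. cnj (u i) * (z * u i))"
    by (intro sum.cong) (auto simp: ev[symmetric] sum_distrib_left mult_ac)
  also have "\<dots> = z * of_real (\<Sum>i<N. (cmod (u i))\<^sup>2)"
    unfolding of_real_sum sum_distrib_left
    by (intro sum.cong) (simp_all only: complex_norm_square mult_ac)
  finally have "z * of_real (\<Sum>i<N. (cmod (u i))\<^sup>2) \<in> \<real>"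
    using quadratic_form_real[where u=u and x=x and N=N] by simp
  moreover have "(\<Sum>i<N. (cmod (u i))\<^sup>2) > 0"
    using nz by (intro sum_pos2[where i=k]) auto
  ultimately show ?thesis by (auto simp: complex_is_Real_iff)
qed

lemma det_shifted_nonzero:
  assumes "Im z \<noteq> 0"
  shows "Determinant.det (shifted_matrix N z x) \<noteq> 0"
proof
  assume "Determinant.det (shifted_matrix N z x) = 0"
  then obtain w where w: "w \<in> carrier_vec N" "w \<noteq> 0\<^sub>v N" "shifted_matrix N z x *\<^sub>v w = 0\<^sub>v N"
    by (auto simp: det_0_iff_vec_prod_zero[OF shifted_carrier])
  have "(\<Sum>j<N. of_real (x (sym_index i j)) * vec_index w j) = z * vec_index w i" if i: "i < N" for i
  proof -
    have "0 = vec_index (shifted_matrix N z x *\<^sub>v w) i" using w(3) i by (metis index_zero_vec(1))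
    also have "\<dots> = (\<Sum>j<N. (of_real (x (sym_index i j)) - (if i = j then z else 0)) * vec_index w j)"
      using w(1) i by (auto simp: shifted_matrix_def scalar_prod_def atLeast0LessThan intro!: sum.cong)
    also have "\<dots> = (\<Sum>j<N. of_real (x (sym_index i j)) * vec_index w j) - z * vec_index w i"
      using i by (simp add: sum_shifted_row)
    finally show ?thesis by simp
  qed
  moreover obtain k where "k < N" "vec_index w k \<noteq> 0"
    using w by (metis eq_vecI carrier_vecD index_zero_vec)
  ultimately show False using eigenvalue_real[of N x "vec_index w" z k] assms by blast
qed

lemma resolvent_equation:
  assumes "Im z \<noteq> 0" "i < N" "k < N"
  shows "(\<Sum>j<N. of_real (x (sym_index i j)) * resolvent N z x j k)
           = z * resolvent N z x i k + (if i = k then 1 else 0)"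
proof -
  let ?A = "shifted_matrix N z x" and ?d = "Determinant.det (shifted_matrix N z x)"
  have car: "adj_mat ?A \<in> carrier_mat N N" by (rule adj_mat(1)[OF shifted_carrier])
  have "(if i = k then ?d else 0) = (?A * adj_mat ?A) $$ (i, k)"
    using assms by (subst adj_mat(2)[OF shifted_carrier]) auto
  also have "\<dots> = (\<Sum>j<N. (of_real (x (sym_index i j)) - (if i = j then z else 0)) * adj_mat ?A $$ (j, k))"
    using assms car by (auto simp: scalar_prod_def shifted_matrix_def atLeast0LessThan intro!: sum.cong)
  also have "\<dots> = (\<Sum>j<N. of_real (x (sym_index i j)) * adj_mat ?A $$ (j, k)) - z * adj_mat ?A $$ (i, k)"
    using assms by (simp add: sum_shifted_row)
  finally have "(\<Sum>j<N. of_real (x (sym_index i j)) * adj_mat ?A $$ (j, k))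
      = z * adj_mat ?A $$ (i, k) + (if i = k then ?d else 0)" by simp
  then have "(\<Sum>j<N. of_real (x (sym_index i j)) * adj_mat ?A $$ (j, k)) / ?d
      = (z * adj_mat ?A $$ (i, k) + (if i = k then ?d else 0)) / ?d" by simp
  then show ?thesis
    using det_shifted_nonzero[OF assms(1), of N x]
    by (simp add: resolvent_def sum_divide_distrib add_divide_distrib)
qed

text \<open>The double sum \<open>\<Sum>l m. G(l,i) H(l,m) G(m,k)\<close> is evaluated with the resolvent equation in either variable.\<close>

lemma resolvent_sym:
  assumes "Im z \<noteq> 0" "i < N" "k < N"
  shows "resolvent N z x i k = resolvent N z x k i"
proof -
  let ?G = "resolvent N z x" and ?H = "\<lambda>i j. complex_of_real (x (sym_index i j))"
  have "(\<Sum>l<N. ?G l i * (\<Sum>m<N. ?H l m * ?G m k)) = (\<Sum>l<N. ?G l i * (z * ?G l k)) + ?G k i"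
    using assms by (simp add: resolvent_equation sum_times_delta)
  moreover have "(\<Sum>l<N. ?G l i * (\<Sum>m<N. ?H l m * ?G m k)) = (\<Sum>m<N. ?G m k * (\<Sum>l<N. ?H m l * ?G l i))"
    unfolding sum_distrib_left by (subst sum.swap) (simp add: sym_index_commute mult_ac)
  moreover have "\<dots> = (\<Sum>m<N. ?G m k * (z * ?G m i)) + ?G i k"
    using assms by (simp add: resolvent_equation sum_times_delta)
  ultimately show ?thesis by (simp add: mult_ac)
qed

text \<open>\<open>G' - G = G' (H - H') G\<close>: the sums with \<open>H\<close> and with \<open>H'\<close> are evaluated separately, and the common term
\<open>z G' G\<close> cancels.\<close>

lemma resolvent_identity:
  assumes "Im z \<noteq> 0" "i < N" "k < N"
  shows "resolvent N z y i k - resolvent N z x i k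
    = (\<Sum>l<N. \<Sum>m<N. resolvent N z y i l * of_real (x (sym_index l m) - y (sym_index l m)) * resolvent N z x m k)"
proof -
  let ?G = "resolvent N z x" and ?H = "\<lambda>i j. complex_of_real (x (sym_index i j))"
  let ?G' = "resolvent N z y" and ?H' = "\<lambda>i j. complex_of_real (y (sym_index i j))"
  have "(\<Sum>l<N. \<Sum>m<N. ?G' i l * ?H l m * ?G m k) = (\<Sum>l<N. ?G' i l * (\<Sum>m<N. ?H l m * ?G m k))"
    by (simp add: sum_distrib_left mult_ac)
  also have "\<dots> = (\<Sum>l<N. ?G' i l * (z * ?G l k)) + ?G' i k"
    using assms by (simp add: resolvent_equation sum_times_delta)
  finally have 1: "(\<Sum>l<N. \<Sum>m<N. ?G' i l * ?H l m * ?G m k) = (\<Sum>l<N. ?G' i l * (z * ?G l k)) + ?G' i k" .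
  have "(\<Sum>l<N. \<Sum>m<N. ?G' i l * ?H' l m * ?G m k) = (\<Sum>m<N. ?G m k * (\<Sum>l<N. ?H' m l * ?G' l i))"
    unfolding sum_distrib_left using assms
    by (subst sum.swap, intro sum.cong refl) (simp add: sym_index_commute resolvent_sym[of z i] mult_ac)
  also have "\<dots> = (\<Sum>m<N. ?G m k * (z * ?G' m i)) + ?G i k"
    using assms by (simp add: resolvent_equation sum_times_delta)
  also have "(\<Sum>m<N. ?G m k * (z * ?G' m i)) = (\<Sum>l<N. ?G' i l * (z * ?G l k))"
    using assms by (intro sum.cong) (simp_all add: resolvent_sym[of z i])
  finally have "(\<Sum>l<N. \<Sum>m<N. ?G' i l * ?H' l m * ?G m k) = (\<Sum>l<N. ?G' i l * (z * ?G l k)) + ?G i k" .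
  with 1 show ?thesis
    by (simp add: right_diff_distrib left_diff_distrib sum_subtractf)
qed

lemma resolvent_cnj_equation:
  assumes "Im z \<noteq> 0" "i < N" "k < N"
  shows "(\<Sum>j<N. of_real (x (sym_index i j)) * cnj (resolvent N z x j k))
           = cnj z * cnj (resolvent N z x i k) + (if i = k then 1 else 0)"
  using arg_cong[OF resolvent_equation[OF assms], of cnj] by (simp split: if_splits)

text \<open>The sum \<open>\<Sum>l m. G(l,i) H(l,m) cnj (G(m,i))\<close> is real by symmetry, and the conjugated resolvent equation turns it
into \<open>cnj z \<Sum>j. \<bar>G(i,j)\<bar>\<^sup>2 + G(i,i)\<close>.\<close>

lemma ward_identity:
  assumes "Im z \<noteq> 0" "i < N"
  shows "Im (resolvent N z x i i) = Im z * (\<Sum>j<N. (cmod (resolvent N z x i j))\<^sup>2)"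
proof -
  let ?G = "resolvent N z x" and ?H = "\<lambda>i j. complex_of_real (x (sym_index i j))"
  have "(\<Sum>l<N. \<Sum>m<N. ?G l i * ?H l m * cnj (?G m i)) = (\<Sum>l<N. ?G l i * (\<Sum>m<N. ?H l m * cnj (?G m i)))"
    by (simp add: sum_distrib_left mult_ac)
  also have "\<dots> = (\<Sum>l<N. ?G l i * (cnj z * cnj (?G l i))) + ?G i i"
    using assms by (simp add: resolvent_cnj_equation sum_times_delta)
  also have "(\<Sum>l<N. ?G l i * (cnj z * cnj (?G l i))) = cnj z * of_real (\<Sum>j<N. (cmod (?G i j))\<^sup>2)"
    unfolding of_real_sum sum_distrib_left using assms
    by (intro sum.cong) (auto simp: complex_norm_square resolvent_sym[of z i] mult_ac simp del: of_real_power)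
  finally have 1: "(\<Sum>l<N. \<Sum>m<N. ?G l i * ?H l m * cnj (?G m i))
      = cnj z * of_real (\<Sum>j<N. (cmod (?G i j))\<^sup>2) + ?G i i" .
  have "(\<Sum>l<N. \<Sum>m<N. ?G l i * ?H l m * cnj (?G m i)) \<in> \<real>"
    using quadratic_form_real[of "\<lambda>m. cnj (?G m i)" x N] by simp
  then show ?thesis unfolding 1 by (simp add: complex_is_Real_iff algebra_simps)
qed

text \<open>By the Ward identity \<open>\<bar>Im z\<bar> r = \<bar>Im G(i,i)\<bar>\<close> for the row sum \<open>r\<close>, while \<open>\<bar>G(i,i)\<bar>\<^sup>2\<close> is one of the summands
of \<open>r\<close>; thus \<open>(Im z)\<^sup>2 r\<^sup>2 \<le> r\<close>.\<close>

lemma resolvent_row_bound: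
  assumes "Im z \<noteq> 0" "i < N"
  shows "(\<Sum>j<N. (cmod (resolvent N z x i j))\<^sup>2) \<le> 1 / (Im z)\<^sup>2"
proof -
  let ?G = "resolvent N z x" and ?r = "\<Sum>j<N. (cmod (resolvent N z x i j))\<^sup>2"
  have r0: "0 \<le> ?r" by (intro sum_nonneg) auto
  have "(\<bar>Im z\<bar> * ?r)\<^sup>2 = (Im (?G i i))\<^sup>2"
    unfolding ward_identity[OF assms] by (simp add: power_mult_distrib)
  also have "\<dots> \<le> (cmod (?G i i))\<^sup>2" by (simp add: cmod_power2)
  also have "\<dots> \<le> ?r" using assms by (intro member_le_sum) auto
  finally have "?r * ((Im z)\<^sup>2 * ?r) \<le> ?r * 1" by (simp add: power_mult_distrib power2_eq_square mult_ac)
  then have "(Im z)\<^sup>2 * ?r \<le> 1" using r0 by (cases "?r = 0") (auto dest: mult_left_le_imp_le)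
  then show ?thesis using assms by (simp add: field_simps)
qed

lemma resolvent_bound:
  assumes "Im z \<noteq> 0" "i < N" "j < N"
  shows "cmod (resolvent N z x i j) \<le> 1 / \<bar>Im z\<bar>"
proof -
  have "(cmod (resolvent N z x i j))\<^sup>2 \<le> (\<Sum>j<N. (cmod (resolvent N z x i j))\<^sup>2)"
    using assms by (intro member_le_sum) auto
  also have "\<dots> \<le> (1 / \<bar>Im z\<bar>)\<^sup>2" using resolvent_row_bound[OF assms(1,2)] by (simp add: power_divide)
  finally show ?thesis by (rule power2_le_imp_le) simp
qed

lemma measurable_det:
  fixes A :: "'b \<Rightarrow> complex mat"
  assumes car: "\<And>w. A w \<in> carrier_mat n n"
    and meas: "\<And>i j. i < n \<Longrightarrow> j < n \<Longrightarrow> (\<lambda>w. A w $$ (i, j)) \<in> borel_measurable M"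
  shows "(\<lambda>w. Determinant.det (A w)) \<in> borel_measurable M"
  unfolding Determinant.det_def'[OF car]
  by (intro borel_measurable_sum borel_measurable_times borel_measurable_prod measurable_const meas)
     (auto simp: permutes_in_image atLeast0LessThan)

lemma measurable_resolvent:
  assumes x: "\<And>i j. i \<le> j \<Longrightarrow> j < N \<Longrightarrow> (\<lambda>w. x w (i, j)) \<in> borel_measurable M"
    and ij: "i < N" "j < N"
  shows "(\<lambda>w. resolvent N z (x w) i j) \<in> borel_measurable M"
proof -
  have entry: "(\<lambda>w. shifted_matrix N z (x w) $$ (k, l)) \<in> borel_measurable M" if "k < N" "l < N" for k l
    using that x[of "min k l" "max k l"] by (simp add: shifted_matrix_def sym_index_def)
  have "(\<lambda>w. Determinant.det (shifted_matrix N z (x w))) \<in> borel_measurable M"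
    by (rule measurable_det[where n=N]) (auto intro: entry)
  moreover have "(\<lambda>w. Determinant.det (mat_delete (shifted_matrix N z (x w)) j i)) \<in> borel_measurable M"
  proof (rule measurable_det[where n="N - 1"])
    show "mat_delete (shifted_matrix N z (x w)) j i \<in> carrier_mat (N - 1) (N - 1)" for w
      by (rule mat_delete_carrier) simp
    show "(\<lambda>w. mat_delete (shifted_matrix N z (x w)) j i $$ (k, l)) \<in> borel_measurable M"
      if "k < N - 1" "l < N - 1" for k l
    proof -
      have "dim_row (shifted_matrix N z (x w)) = N" "dim_col (shifted_matrix N z (x w)) = N" for w
        by (simp_all add: shifted_matrix_def)
      then have "(\<lambda>w. mat_delete (shifted_matrix N z (x w)) j i $$ (k, l))
        = (\<lambda>w. shifted_matrix N z (x w) $$ (if k < j then k else Suc k, if l < i then l else Suc l))"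
        using that by (simp add: mat_delete_def)
      then show ?thesis using that by (auto intro!: entry)
    qed
  qed
  ultimately show ?thesis
    using ij by (simp add: resolvent_def adj_mat_def cofactor_def shifted_matrix_def)
qed

section \<open>Eigenvalues and the trace of the resolvent\<close>

lemma diagonal_sum_commute:
  fixes X Y :: "complex mat"
  assumes X: "X \<in> carrier_mat N N" and Y: "Y \<in> carrier_mat N N"
  shows "(\<Sum>i<N. (X * Y) $$ (i, i)) = (\<Sum>i<N. (Y * X) $$ (i, i))"
proof -
  have "(\<Sum>i<N. (X * Y) $$ (i, i)) = (\<Sum>i<N. \<Sum>k<N. X $$ (i, k) * Y $$ (k, i))"
    using X Y by (auto simp: scalar_prod_def atLeast0LessThan intro!: sum.cong)
  also have "\<dots> = (\<Sum>k<N. \<Sum>i<N. Y $$ (k, i) * X $$ (i, k))"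
    by (subst sum.swap) (simp add: mult.commute)
  also have "\<dots> = (\<Sum>i<N. (Y * X) $$ (i, i))"
    using X Y by (auto simp: scalar_prod_def atLeast0LessThan intro!: sum.cong)
  finally show ?thesis .
qed

text \<open>A left inverse of an upper triangular matrix is upper triangular, by induction on the column; its diagonal
is then read off from the product.\<close>

lemma upper_triangular_left_inverse:
  fixes C D :: "complex mat"
  assumes C: "C \<in> carrier_mat N N" and D: "D \<in> carrier_mat N N"
    and ut: "upper_triangular D" and nz: "\<And>i. i < N \<Longrightarrow> D $$ (i, i) \<noteq> 0"
    and inv: "C * D = 1\<^sub>m N" and j: "j < N"
  shows "C $$ (j, j) = 1 / D $$ (j, j)"
proof -
  have entry: "(\<Sum>k\<le>j. C $$ (i, k) * D $$ (k, j)) = (if i = j then 1 else 0)" if "i < N" "j < N" for i j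
  proof -
    have "(if i = j then 1 else 0) = (C * D) $$ (i, j)" using that inv by simp
    also have "\<dots> = (\<Sum>k<N. C $$ (i, k) * D $$ (k, j))"
      using C D that by (auto simp: scalar_prod_def atLeast0LessThan intro!: sum.cong)
    also have "\<dots> = (\<Sum>k\<le>j. C $$ (i, k) * D $$ (k, j))"
      using that D ut[unfolded upper_triangular_def] by (intro sum.mono_neutral_right) auto
    finally show ?thesis by simp
  qed
  have lower: "j < N \<Longrightarrow> \<forall>i. j < i \<longrightarrow> i < N \<longrightarrow> C $$ (i, j) = 0" for j
  proof (induction j rule: less_induct)
    case (less j)
    show ?case
    proof (intro allI impI)
      fix i assume i: "j < i" "i < N"
      have "0 = (\<Sum>k\<le>j. C $$ (i, k) * D $$ (k, j))" using entry[of i j] i by simp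
      also have "\<dots> = (\<Sum>k\<in>{j}. C $$ (i, k) * D $$ (k, j))"
        using less i by (intro sum.mono_neutral_right) auto
      finally show "C $$ (i, j) = 0" using nz[of j] i by simp
    qed
  qed
  have "1 = (\<Sum>k\<le>j. C $$ (j, k) * D $$ (k, j))" using entry[of j j] j by simp
  also have "\<dots> = (\<Sum>k\<in>{j}. C $$ (j, k) * D $$ (k, j))"
    using lower j by (intro sum.mono_neutral_right) auto
  finally show ?thesis using nz[OF j] by (simp add: field_simps)
qed

definition symmetric_matrix :: "nat \<Rightarrow> (nat \<times> nat \<Rightarrow> real) \<Rightarrow> real mat" where
  "symmetric_matrix N x = mat N N (\<lambda>(i, j). x (sym_index i j))"

lemma proots_linear_factors: "proots (\<Prod>r\<leftarrow>rs. [:- r, 1:]) = mset (rs :: real list)"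
proof (induction rs)
  case (Cons r rs)
  have nz: "(\<Prod>r\<leftarrow>rs. [:- r, 1:]) \<noteq> 0" by (auto simp: prod_list_zero_iff)
  have "proots (\<Prod>r\<leftarrow>r # rs. [:- r, 1:]) = proots ([:- r, 1:] * (\<Prod>r\<leftarrow>rs. [:- r, 1:]))"
    by (simp only: list.map prod_list.Cons)
  also have "\<dots> = proots [:- r, 1:] + proots (\<Prod>r\<leftarrow>rs. [:- r, 1:])"
    by (rule proots_mult) (use nz in auto)
  also have "\<dots> = mset (r # rs)" unfolding Cons.IH proots_linear_factor by simp
  finally show ?case .
qed simp

text \<open>The characteristic polynomial splits over the complex numbers, and a root with nonzero imaginary part would
make \<open>H - z\<close> singular.\<close>

lemma char_poly_symmetric_splits:
  obtains rs where "length rs = N"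
    "char_poly (map_mat complex_of_real (symmetric_matrix N x)) = (\<Prod>r\<leftarrow>map of_real rs. [:- r, 1:])"
    "proots (char_poly (symmetric_matrix N x)) = mset rs"
proof -
  let ?A = "symmetric_matrix N x" and ?C = "map_mat complex_of_real (symmetric_matrix N x)"
  have A: "?A \<in> carrier_mat N N" by (simp add: symmetric_matrix_def)
  then have C: "?C \<in> carrier_mat N N" by simp
  from char_poly_factorized[OF C] obtain es
    where es: "char_poly ?C = (\<Prod>a\<leftarrow>es. [:- a, 1:])" and len: "length es = N" by blast
  have real: "Im e = 0" if "e \<in> set es" for e
  proof (rule ccontr)
    assume e: "Im e \<noteq> 0"
    have "poly (char_poly ?C) e = 0" unfolding es using that
      by (induction es) auto
    then have "Determinant.det (char_matrix ?C e) = 0"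
      using eigenvalue_root_char_poly[OF C] eigenvalue_det[OF C] by blast
    moreover have "char_matrix ?C e = shifted_matrix N e x"
      by (rule eq_matI) (auto simp: char_matrix_def shifted_matrix_def symmetric_matrix_def)
    ultimately show False using det_shifted_nonzero[OF e] by simp
  qed
  define rs where "rs = map Re es"
  have es_rs: "es = map of_real rs"
    unfolding rs_def using real by (auto simp: complex_eq_iff map_idI[symmetric] intro!: map_idI[symmetric])
  interpret poly_hom: map_poly_comm_ring_hom complex_of_real ..
  have "map_poly complex_of_real (char_poly ?A) = char_poly ?C"
    by (rule of_real_hom.char_poly_hom[OF A, symmetric])
  also have "\<dots> = map_poly complex_of_real (\<Prod>r\<leftarrow>rs. [:- r, 1:])"
    unfolding es es_rs by (simp add: poly_hom.hom_prod_list o_def)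
  finally have "char_poly ?A = (\<Prod>r\<leftarrow>rs. [:- r, 1:])"
    by (simp add: poly_eq_iff coeff_map_poly)
  then have "proots (char_poly ?A) = mset rs"
    by (simp add: proots_linear_factors)
  moreover have "length rs = N" using len by (simp add: rs_def)
  ultimately show ?thesis using that[of rs] es unfolding es_rs by blast
qed

text \<open>A Schur decomposition makes \<open>H\<close> upper triangular with the roots on the diagonal. The conjugated resolvent is
a left inverse of the triangular matrix shifted by \<open>z\<close>, and conjugation keeps the trace.\<close>

lemma resolvent_trace:
  assumes z: "Im z \<noteq> 0"
    and roots: "length rs = N"
    "char_poly (map_mat complex_of_real (symmetric_matrix N x)) = (\<Prod>r\<leftarrow>map of_real rs. [:- r, 1:])"
  shows "(\<Sum>i<N. resolvent N z x i i) = (\<Sum>r\<leftarrow>rs. 1 / (of_real r - z))"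
proof -
  let ?C = "map_mat complex_of_real (symmetric_matrix N x)"
  have car: "?C \<in> carrier_mat N N" by (simp add: symmetric_matrix_def)
  obtain B P Q where "schur_decomposition ?C (map of_real rs) = (B, P, Q)" by (metis prod_cases3)
  with schur_decomposition[OF car roots(2)] have sim: "similar_mat_wit ?C B P Q"
    and ut: "upper_triangular B" and diag: "diag_mat B = map of_real rs" by auto
  note w = similar_mat_witD2[OF car sim]
  define G where "G = mat N N (\<lambda>(i, j). resolvent N z x i j)"
  let ?S = "shifted_matrix N z x"
  have G: "G \<in> carrier_mat N N" by (simp add: G_def)
  have S: "?S = ?C - z \<cdot>\<^sub>m 1\<^sub>m N"
    by (rule eq_matI) (auto simp: shifted_matrix_def symmetric_matrix_def)
  have "G = (1 / Determinant.det ?S) \<cdot>\<^sub>m adj_mat ?S"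
    using adj_mat(1)[OF shifted_carrier, of N z x] by (intro eq_matI) (auto simp: G_def resolvent_def)
  then have "G * ?S = (1 / Determinant.det ?S) \<cdot>\<^sub>m (adj_mat ?S * ?S)"
    by (simp only: mult_smult_assoc_mat[OF adj_mat(1)[OF shifted_carrier] shifted_carrier])
  also have "\<dots> = 1\<^sub>m N"
    unfolding adj_mat(3)[OF shifted_carrier] using det_shifted_nonzero[OF z, of N x]
    by (intro eq_matI) auto
  finally have GS: "G * ?S = 1\<^sub>m N" .
  define D where "D = B - z \<cdot>\<^sub>m 1\<^sub>m N"
  have D: "D \<in> carrier_mat N N" unfolding D_def by (rule carrier_matI) simp_all
  have QSP: "Q * ?S * P = D"
  proof -
    have "Q * ?C * P = B"
      by (rule similar_mat_witD2(3)[OF w(5) similar_mat_wit_sym[OF sim], symmetric])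
    moreover have "Q * ?S = Q * ?C - z \<cdot>\<^sub>m Q"
    proof -
      have "Q * ?S = Q * ?C - Q * (z \<cdot>\<^sub>m 1\<^sub>m N)"
        unfolding S by (rule mult_minus_distrib_mat[OF w(7) car]) simp
      also have "Q * (z \<cdot>\<^sub>m 1\<^sub>m N) = z \<cdot>\<^sub>m (Q * 1\<^sub>m N)"
        by (rule mult_smult_distrib[OF w(7) one_carrier_mat])
      finally show ?thesis using w(7) by simp
    qed
    moreover have "(Q * ?C - z \<cdot>\<^sub>m Q) * P = Q * ?C * P - (z \<cdot>\<^sub>m Q) * P"
      by (rule minus_mult_distrib_mat[OF mult_carrier_mat[OF w(7) car] smult_carrier_mat[OF w(7)] w(6)])
    moreover have "(z \<cdot>\<^sub>m Q) * P = z \<cdot>\<^sub>m (Q * P)"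
      by (rule mult_smult_assoc_mat[OF w(7,6)])
    ultimately show ?thesis by (simp only: D_def w(2))
  qed
  define C where "C = Q * G * P"
  have Cc: "C \<in> carrier_mat N N" using w(5-7) G by (simp add: C_def)
  have "C * D = Q * (G * ((P * Q) * (?S * P)))"
    unfolding C_def QSP[symmetric] using w(5-7) G by (simp add: assoc_mult_mat[of _ N N _ N _ N] mult_carrier_mat[of _ N N _ N])
  also have "\<dots> = Q * ((G * ?S) * P)"
    unfolding w(1) using w(5-7) G by (simp add: left_mult_one_mat[of _ N N] assoc_mult_mat[of _ N N _ N _ N] mult_carrier_mat[of _ N N _ N])
  also have "\<dots> = 1\<^sub>m N" unfolding GS using w(2,5-7) by simp
  finally have CD: "C * D = 1\<^sub>m N" .
  have diagB: "B $$ (i, i) = of_real (rs ! i)" if "i < N" for i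
    using arg_cong[OF diag, of "\<lambda>l. l ! i"] that w(5) roots(1) by (simp add: diag_mat_def)
  have D_diag: "D $$ (i, i) = of_real (rs ! i) - z" if "i < N" for i
    using that w(5) diagB by (simp add: D_def)
  have nz: "of_real r - z \<noteq> 0" for r using z by (auto simp: complex_eq_iff)
  have utD: "upper_triangular D"
    using ut w(5) by (auto simp: D_def upper_triangular_def)
  have "P * (Q * G) = G"
    unfolding assoc_mult_mat[OF w(6,7) G, symmetric] w(1) using G by simp
  then have "(\<Sum>i<N. resolvent N z x i i) = (\<Sum>i<N. (P * (Q * G)) $$ (i, i))"
    by (simp add: G_def)
  also have "(\<Sum>i<N. (P * (Q * G)) $$ (i, i)) = (\<Sum>i<N. C $$ (i, i))"
    unfolding C_def using w(5-7) G by (intro diagonal_sum_commute) auto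
  also have "\<dots> = (\<Sum>i<N. 1 / (of_real (rs ! i) - z))"
    using upper_triangular_left_inverse[OF Cc D utD _ CD] nz by (intro sum.cong) (auto simp: D_diag)
  also have "\<dots> = (\<Sum>r\<leftarrow>rs. 1 / (of_real r - z))"
    using roots(1) by (simp add: sum_list_sum_nth atLeast0LessThan)
  finally show ?thesis .
qed

section \<open>Dependence of the resolvent on one entry\<close>

text \<open>The product \<open>A E B\<close>, where \<open>E\<close> is the derivative of a symmetric matrix with respect to its parameter at the
position \<open>e\<close>: ones at \<open>(i, j)\<close> and \<open>(j, i)\<close>.\<close>

definition entry_product ::
  "nat \<times> nat \<Rightarrow> (nat \<Rightarrow> nat \<Rightarrow> complex) \<Rightarrow> (nat \<Rightarrow> nat \<Rightarrow> complex) \<Rightarrow> nat \<Rightarrow> nat \<Rightarrow> complex" where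
  "entry_product e A B a b = (case e of (i, j) \<Rightarrow>
     if i = j then A a i * B i b else A a i * B j b + A a j * B i b)"

lemma sum_pick2:
  fixes f :: "nat \<Rightarrow> nat \<Rightarrow> complex"
  assumes "i \<le> j" "j < N"
  shows "(\<Sum>l<N. \<Sum>m<N. if sym_index l m = (i, j) then f l m else 0)
    = (if i = j then f i j else f i j + f j i)"
proof -
  have "(\<Sum>l<N. \<Sum>m<N. if sym_index l m = (i, j) then f l m else 0)
      = (\<Sum>(l, m)\<in>{..<N} \<times> {..<N}. if sym_index l m = (i, j) then f l m else 0)"
    by (simp add: sum.cartesian_product)
  also have "\<dots> = (\<Sum>(l, m)\<in>{(i, j), (j, i)}. f l m)"
    using assms by (intro sum.mono_neutral_cong_right) (auto simp: sym_index_def min_def max_def split: if_splits)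
  finally show ?thesis by auto
qed

text \<open>The resolvent identity for two matrices that differ in one parameter. The resolvent with this parameter set
to zero is a function of the other parameters only, which is what makes independence applicable.\<close>

lemma resolvent_zero_entry:
  assumes z: "Im z \<noteq> 0" and e: "i \<le> j" "j < N" and ab: "a < N" "b < N"
  shows "resolvent N z x a b = resolvent N z (x((i, j) := 0)) a b
    - of_real (x (i, j)) * entry_product (i, j) (resolvent N z (x((i, j) := 0))) (resolvent N z x) a b"
proof -
  let ?G = "resolvent N z x" and ?G' = "resolvent N z (x((i, j) := 0))"
  have "?G' a b - ?G a b = (\<Sum>l<N. \<Sum>m<N. if sym_index l m = (i, j)
      then ?G' a l * of_real (x (i, j)) * ?G m b else 0)"
    unfolding resolvent_identity[OF z ab] by (intro sum.cong) auto
  also have "\<dots> = of_real (x (i, j)) * entry_product (i, j) ?G' ?G a b"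
    unfolding sum_pick2[OF e] by (simp add: entry_product_def algebra_simps)
  finally show ?thesis by (simp add: algebra_simps)
qed

lemma entry_product_diff_right:
  "entry_product e A (\<lambda>a b. B a b - C a b) a b = entry_product e A B a b - entry_product e A C a b"
  by (cases e) (simp add: entry_product_def algebra_simps)

lemma entry_product_diff_left:
  "entry_product e (\<lambda>a b. A a b - C a b) B a b = entry_product e A B a b - entry_product e C B a b"
  by (cases e) (simp add: entry_product_def algebra_simps)

lemma norm_entry_product_le:
  assumes A: "\<And>a b. a < N \<Longrightarrow> b < N \<Longrightarrow> cmod (A a b) \<le> \<alpha>"
    and B: "\<And>a b. a < N \<Longrightarrow> b < N \<Longrightarrow> cmod (B a b) \<le> \<beta>"
    and e: "i \<le> j" "j < N" and ab: "a < N" "b < N"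
  shows "cmod (entry_product (i, j) A B a b) \<le> 2 * \<alpha> * \<beta>"
proof -
  have i: "i < N" using e by simp
  have a0: "0 \<le> \<alpha>" using A[OF i i] norm_ge_zero order_trans by blast
  have b0: "0 \<le> \<beta>" using B[OF i i] norm_ge_zero order_trans by blast
  have *: "cmod (A a k * B l b) \<le> \<alpha> * \<beta>" if "k < N" "l < N" for k l
    unfolding norm_mult using A B ab that a0 by (intro mult_mono) auto
  show ?thesis
    using norm_triangle_le[OF add_mono[OF *[OF i e(2)] *[OF e(2) i]]] *[OF i i] mult_nonneg_nonneg[OF a0 b0]
    by (auto simp: entry_product_def)
qed

lemma norm_weighted_sum_le:
  fixes f :: "nat \<Rightarrow> complex"
  assumes w: "\<And>l. l < N \<Longrightarrow> 0 \<le> w l" "(\<Sum>l<N. w l) \<le> 2"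
    and f: "\<And>l. l < N \<Longrightarrow> cmod (f l) \<le> c" and c: "0 \<le> c"
  shows "cmod (\<Sum>l<N. of_real (w l) * f l) \<le> 2 * c"
proof -
  have "cmod (\<Sum>l<N. of_real (w l) * f l) \<le> (\<Sum>l<N. w l * c)"
    using w f by (intro sum_norm_le) (auto simp: norm_mult intro!: mult_left_mono)
  also have "\<dots> \<le> 2 * c" using w(2) c by (simp flip: sum_distrib_right add: mult_right_mono)
  finally show ?thesis .
qed

text \<open>The weights will be a row of the variance profile.\<close>

definition weighted_trace :: "nat \<Rightarrow> (nat \<Rightarrow> real) \<Rightarrow> (nat \<Rightarrow> nat \<Rightarrow> complex) \<Rightarrow> complex" where
  "weighted_trace N w G = (\<Sum>l<N. of_real (w l) * G l l)"

text \<open>The function of the entries to which the expansion in the entry at \<open>(a, b)\<close> is applied.\<close>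

definition test_product :: "nat \<Rightarrow> (nat \<Rightarrow> real) \<Rightarrow> complex \<Rightarrow> nat \<Rightarrow> nat \<Rightarrow> (nat \<Rightarrow> nat \<Rightarrow> complex) \<Rightarrow> complex" where
  "test_product N w s a b G = cnj (weighted_trace N w G - s) * G a b"

text \<open>The derivative of \<open>test_product\<close> with respect to the parameter at \<open>e\<close>, by the product rule and
\<open>\<partial>G = - G E G\<close>.\<close>

definition test_derivative :: "nat \<Rightarrow> (nat \<Rightarrow> real) \<Rightarrow> complex \<Rightarrow> nat \<times> nat \<Rightarrow> nat \<Rightarrow> nat \<Rightarrow> (nat \<Rightarrow> nat \<Rightarrow> complex) \<Rightarrow> complex" where
  "test_derivative N w s e a b G =
     - cnj (weighted_trace N w (entry_product e G G)) * G a b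
     - cnj (weighted_trace N w G - s) * entry_product e G G a b"

lemma weighted_trace_diff:
  "weighted_trace N w (\<lambda>a b. A a b - B a b) = weighted_trace N w A - weighted_trace N w B"
  by (simp add: weighted_trace_def right_diff_distrib sum_subtractf)

lemma weighted_trace_add:
  "weighted_trace N w (\<lambda>a b. A a b + B a b) = weighted_trace N w A + weighted_trace N w B"
  by (simp add: weighted_trace_def distrib_left sum.distrib)

lemma weighted_trace_scale:
  "weighted_trace N w (\<lambda>a b. c * A a b) = c * weighted_trace N w A"
  by (simp add: weighted_trace_def sum_distrib_left mult_ac)

text \<open>Deterministic estimates for \<open>G\<close> and the resolvent \<open>G'\<close> with the parameter \<open>h\<close> at \<open>(i, j)\<close> set to zero. All
entries are bounded by one, as they are when the imaginary part of \<open>z\<close> is at least one, and the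
constants in the bounds do not depend on \<open>h\<close>.\<close>

locale rank_two_update =
  fixes N :: nat and i j :: nat and h :: real and G G' :: "nat \<Rightarrow> nat \<Rightarrow> complex"
    and w :: "nat \<Rightarrow> real" and s :: complex
  assumes e: "i \<le> j" "j < N"
    and G: "\<And>a b. a < N \<Longrightarrow> b < N \<Longrightarrow> cmod (G a b) \<le> 1"
    and G': "\<And>a b. a < N \<Longrightarrow> b < N \<Longrightarrow> cmod (G' a b) \<le> 1"
    and update: "\<And>a b. a < N \<Longrightarrow> b < N \<Longrightarrow> G a b = G' a b - of_real h * entry_product (i, j) G' G a b"
    and w: "\<And>l. l < N \<Longrightarrow> 0 \<le> w l" "(\<Sum>l<N. w l) \<le> 2"
    and s: "cmod s \<le> 1"
begin

abbreviation "E \<equiv> (i, j)"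

lemma diff1:
  assumes "a < N" "b < N"
  shows "cmod (G a b - G' a b) \<le> 2 * \<bar>h\<bar>"
proof -
  have "cmod (G a b - G' a b) = \<bar>h\<bar> * cmod (entry_product E G' G a b)"
    using update[OF assms] by (simp add: norm_mult)
  also have "\<dots> \<le> \<bar>h\<bar> * (2 * 1 * 1)"
    by (intro mult_left_mono norm_entry_product_le[OF G' G e assms]) auto
  finally show ?thesis by simp
qed

text \<open>The update formula \<open>G = G' - h G' E G\<close> inserted into itself.\<close>

lemma diff2:
  assumes "a < N" "b < N"
  shows "cmod (G a b - G' a b + of_real h * entry_product E G' G' a b) \<le> 4 * h\<^sup>2"
proof -
  have "G a b - G' a b + of_real h * entry_product E G' G' a b
      = - of_real h * entry_product E G' (\<lambda>a b. G a b - G' a b) a b"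
    using update[OF assms] by (simp add: entry_product_diff_right algebra_simps)
  also have "cmod \<dots> = \<bar>h\<bar> * cmod (entry_product E G' (\<lambda>a b. G a b - G' a b) a b)"
    by (simp add: norm_mult)
  also have "\<dots> \<le> \<bar>h\<bar> * (2 * 1 * (2 * \<bar>h\<bar>))"
    by (intro mult_left_mono norm_entry_product_le[OF G' diff1 e assms]) auto
  finally show ?thesis by (simp add: power2_eq_square mult_ac abs_mult_self_eq)
qed

lemma diff_product:
  assumes "a < N" "b < N"
  shows "cmod (entry_product E G G a b - entry_product E G' G' a b) \<le> 8 * \<bar>h\<bar>"
proof -
  have "entry_product E G G a b - entry_product E G' G' a b
      = entry_product E (\<lambda>a b. G a b - G' a b) G a b + entry_product E G' (\<lambda>a b. G a b - G' a b) a b"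
    by (simp add: entry_product_diff_left entry_product_diff_right)
  also have "cmod \<dots> \<le> 2 * (2 * \<bar>h\<bar>) * 1 + 2 * 1 * (2 * \<bar>h\<bar>)"
    by (intro norm_triangle_le add_mono norm_entry_product_le[OF diff1 G e assms]
        norm_entry_product_le[OF G' diff1 e assms])
  finally show ?thesis by simp
qed

lemma trace_le: "cmod (weighted_trace N w A) \<le> 2 * c"
  if "\<And>l. l < N \<Longrightarrow> cmod (A l l) \<le> c" "0 \<le> c" for A c
  unfolding weighted_trace_def using that by (intro norm_weighted_sum_le w) auto

lemma bounds:
  shows "cmod (weighted_trace N w G - s) \<le> 3" "cmod (weighted_trace N w G' - s) \<le> 3"
  using norm_triangle_le_diff[OF add_mono[OF trace_le[of G 1] s]]
    norm_triangle_le_diff[OF add_mono[OF trace_le[of G' 1] s]] G G' by auto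

lemma trace_diff1: "cmod (weighted_trace N w G - weighted_trace N w G') \<le> 4 * \<bar>h\<bar>"
  using trace_le[of "\<lambda>a b. G a b - G' a b" "2 * \<bar>h\<bar>"] diff1
  by (simp add: weighted_trace_diff)

lemma trace_diff2:
  "cmod (weighted_trace N w G - weighted_trace N w G' + of_real h * weighted_trace N w (entry_product E G' G'))
     \<le> 8 * h\<^sup>2"
  using trace_le[of "\<lambda>a b. G a b - G' a b + of_real h * entry_product E G' G' a b" "4 * h\<^sup>2"] diff2
  by (simp add: weighted_trace_diff weighted_trace_scale weighted_trace_add)

lemma trace_product_diff:
  "cmod (weighted_trace N w (entry_product E G G) - weighted_trace N w (entry_product E G' G')) \<le> 16 * \<bar>h\<bar>"
  using trace_le[of "\<lambda>a b. entry_product E G G a b - entry_product E G' G' a b" "8 * \<bar>h\<bar>"] diff_product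
  by (simp add: weighted_trace_diff)

lemma entry_product_le:
  assumes "a < N" "b < N"
  shows "cmod (entry_product E G G a b) \<le> 2" "cmod (entry_product E G' G' a b) \<le> 2"
  using norm_entry_product_le[OF G G e assms] norm_entry_product_le[OF G' G' e assms] by auto

lemma trace_product_le:
  "cmod (weighted_trace N w (entry_product E G G)) \<le> 4" "cmod (weighted_trace N w (entry_product E G' G')) \<le> 4"
  using trace_le[of "entry_product E G G" 2] trace_le[of "entry_product E G' G'" 2] entry_product_le by auto

lemma product_le:
  "cmod p \<le> \<alpha> \<Longrightarrow> cmod q \<le> \<beta> \<Longrightarrow> cmod (p * q) \<le> \<alpha> * \<beta>"
  by (metis norm_ge_zero norm_mult mult_mono' )

text \<open>With \<open>T\<close> and \<open>Y\<close> the two factors, the remainder of \<open>T Y\<close> splits into the remainder of \<open>T\<close> times \<open>Y'\<close>, \<open>T'\<close>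
times the remainder of \<open>Y\<close>, and the product of the increments; these contribute 8, 12 and 8.\<close>

lemma test_product_taylor:
  assumes ab: "a < N" "b < N"
  shows "cmod (test_product N w s a b G - test_product N w s a b G'
           - of_real h * test_derivative N w s E a b G') \<le> 28 * h\<^sup>2"
proof -
  define T T' Y Y' T1 Y1 where "T = weighted_trace N w G" and "T' = weighted_trace N w G'"
    and "Y = G a b" and "Y' = G' a b" and "T1 = weighted_trace N w (entry_product E G' G')"
    and "Y1 = entry_product E G' G' a b"
  note d = T_def T'_def Y_def Y'_def T1_def Y1_def
  have "test_product N w s a b G - test_product N w s a b G' - of_real h * test_derivative N w s E a b G'
      = cnj (T - T' + of_real h * T1) * Y' + cnj (T' - s) * (Y - Y' + of_real h * Y1)
        + cnj (T - T') * (Y - Y')"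
    by (simp add: test_product_def test_derivative_def d algebra_simps)
  also have "cmod \<dots> \<le> (8 * h\<^sup>2) * 1 + 3 * (4 * h\<^sup>2) + (4 * \<bar>h\<bar>) * (2 * \<bar>h\<bar>)"
    unfolding d
    by (rule norm_triangle_le[OF add_mono[OF norm_triangle_le[OF add_mono[OF product_le product_le]] product_le]],
        unfold complex_mod_cnj)
      (intro trace_diff2 G' bounds diff2 trace_diff1 diff1 ab)+
  finally show ?thesis by (simp add: power2_eq_square abs_mult_self_eq)
qed

text \<open>Two products, each split by changing one factor at a time; the four terms contribute 16, 8, 8 and 24.\<close>

lemma test_derivative_lipschitz:
  assumes ab: "a < N" "b < N"
  shows "cmod (test_derivative N w s E a b G - test_derivative N w s E a b G') \<le> 56 * \<bar>h\<bar>"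
proof -
  define T T' Y Y' where "T = weighted_trace N w G" and "T' = weighted_trace N w G'"
    and "Y = G a b" and "Y' = G' a b" 
  define T1 T1' Y1 Y1' where "T1 = weighted_trace N w (entry_product E G G)"
    and "T1' = weighted_trace N w (entry_product E G' G')"
    and "Y1 = entry_product E G G a b" and "Y1' = entry_product E G' G' a b"
  note d = T_def T'_def Y_def Y'_def T1_def Y1_def T1'_def Y1'_def
  have "test_derivative N w s E a b G - test_derivative N w s E a b G'
      = - (cnj (T1 - T1') * Y + cnj T1' * (Y - Y') + cnj (T - T') * Y1 + cnj (T' - s) * (Y1 - Y1'))"
    by (simp add: test_derivative_def d algebra_simps)
  also have "cmod \<dots> \<le> (16 * \<bar>h\<bar>) * 1 + 4 * (2 * \<bar>h\<bar>) + (4 * \<bar>h\<bar>) * 2 + 3 * (8 * \<bar>h\<bar>)"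
    unfolding d norm_minus_cancel
    by (intro norm_triangle_le add_mono product_le, unfold complex_mod_cnj)
      (intro trace_product_diff G bounds trace_product_le diff1 trace_diff1 entry_product_le diff_product ab)+
  finally show ?thesis by simp
qed

lemma test_derivative_le:
  assumes ab: "a < N" "b < N"
  shows "cmod (test_derivative N w s E a b G) \<le> 10" "cmod (test_derivative N w s E a b G') \<le> 10"
proof -
  have "cmod (test_derivative N w s E a b G) \<le> 4 * 1 + 3 * 2"
    unfolding test_derivative_def
    by (intro norm_triangle_le_diff add_mono product_le, unfold complex_mod_cnj norm_minus_cancel)
      (intro G bounds trace_product_le entry_product_le ab)+
  then show "cmod (test_derivative N w s E a b G) \<le> 10" by simp
  have "cmod (test_derivative N w s E a b G') \<le> 4 * 1 + 3 * 2"
    unfolding test_derivative_def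
    by (intro norm_triangle_le_diff add_mono product_le, unfold complex_mod_cnj norm_minus_cancel)
      (intro G' bounds trace_product_le entry_product_le ab)+
  then show "cmod (test_derivative N w s E a b G') \<le> 10" by simp
qed

end

section \<open>First-order expansion in an independent entry\<close>

lemma norm_integral_le:
  fixes f :: "'a \<Rightarrow> complex" and g :: "'a \<Rightarrow> real"
  assumes "integrable M f" "integrable M g" "\<And>x. cmod (f x) \<le> g x"
  shows "cmod (integral\<^sup>L M f) \<le> integral\<^sup>L M g"
proof -
  have "cmod (integral\<^sup>L M f) \<le> (\<integral>x. cmod (f x) \<partial>M)" by (rule integral_norm_bound)
  also have "\<dots> \<le> integral\<^sup>L M g"
    by (rule integral_mono[OF integrable_norm[OF assms(1)] assms(2,3)])
  finally show ?thesis .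
qed

text \<open>Expectation of \<open>(\<bar>h\<bar> - c)\<^sup>2 (\<bar>h\<bar> + c) \<ge> 0\<close> with \<open>c = E \<bar>h\<bar>\<close>.\<close>

lemma (in prob_space) second_times_first_le_third_moment:
  fixes h :: "'a \<Rightarrow> real"
  assumes h: "integrable M h" "integrable M (\<lambda>\<omega>. (h \<omega>)\<^sup>2)" "integrable M (\<lambda>\<omega>. \<bar>h \<omega>\<bar> ^ 3)"
  shows "expectation (\<lambda>\<omega>. (h \<omega>)\<^sup>2) * expectation (\<lambda>\<omega>. \<bar>h \<omega>\<bar>) \<le> expectation (\<lambda>\<omega>. \<bar>h \<omega>\<bar> ^ 3)"
proof -
  define c where "c = expectation (\<lambda>\<omega>. \<bar>h \<omega>\<bar>)"
  have "0 \<le> expectation (\<lambda>\<omega>. \<bar>h \<omega>\<bar> ^ 3 - c * (h \<omega>)\<^sup>2 - c\<^sup>2 * \<bar>h \<omega>\<bar> + c ^ 3)"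
  proof (intro integral_nonneg_AE AE_I2)
    fix \<omega>
    have c0: "0 \<le> c" unfolding c_def by (intro integral_nonneg_AE) auto
    have "0 \<le> (\<bar>h \<omega>\<bar> - c)\<^sup>2 * (\<bar>h \<omega>\<bar> + c)" using c0 by simp
    also have "\<dots> = \<bar>h \<omega>\<bar> ^ 3 - c * \<bar>h \<omega>\<bar>\<^sup>2 - c\<^sup>2 * \<bar>h \<omega>\<bar> + c ^ 3"
      by (simp add: power2_eq_square power3_eq_cube algebra_simps)
    finally show "0 \<le> \<bar>h \<omega>\<bar> ^ 3 - c * (h \<omega>)\<^sup>2 - c\<^sup>2 * \<bar>h \<omega>\<bar> + c ^ 3" by simp
  qed
  also have "\<dots> = expectation (\<lambda>\<omega>. \<bar>h \<omega>\<bar> ^ 3) - c * expectation (\<lambda>\<omega>. (h \<omega>)\<^sup>2) - c\<^sup>2 * c + c ^ 3"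
    using h integrable_abs[OF h(1)] by (simp add: c_def[symmetric] prob_space)
  finally show ?thesis by (simp add: c_def power2_eq_square power3_eq_cube mult.commute)
qed

text \<open>An integration by parts for a centred variable \<open>h\<close> that need not be Gaussian. Here \<open>F'\<close> and \<open>D'\<close> are the
values of a function \<open>F\<close> and of its derivative at \<open>h = 0\<close>; they are independent of \<open>h\<close>. In \<open>E[h F]\<close> the
zeroth order vanishes since \<open>E h = 0\<close>, the first order gives \<open>E h\<^sup>2 E D'\<close>, and replacing \<open>D'\<close> by the
derivative \<open>D\<close> at the actual value of \<open>h\<close> costs \<open>b E h\<^sup>2 E \<bar>h\<bar>\<close>.\<close>

lemma (in prob_space) first_order_expansion:
  fixes h :: "'a \<Rightarrow> real" and F F' D D' :: "'a \<Rightarrow> complex"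
  assumes h: "integrable M h" "expectation h = 0" "integrable M (\<lambda>\<omega>. (h \<omega>)\<^sup>2)"
      "integrable M (\<lambda>\<omega>. \<bar>h \<omega>\<bar> ^ 3)"
    and meas: "F \<in> borel_measurable M"
      "D \<in> borel_measurable M"
    and bound: "\<And>\<omega>. cmod (F \<omega>) \<le> c" "\<And>\<omega>. cmod (F' \<omega>) \<le> c" "\<And>\<omega>. cmod (D \<omega>) \<le> c" "\<And>\<omega>. cmod (D' \<omega>) \<le> c"
    and indep: "indep_var borel (\<lambda>\<omega>. complex_of_real (h \<omega>)) borel F'"
      "indep_var borel (\<lambda>\<omega>. complex_of_real (h \<omega>)) borel D'"
    and taylor: "\<And>\<omega>. cmod (F \<omega> - F' \<omega> - of_real (h \<omega>) * D' \<omega>) \<le> a * (h \<omega>)\<^sup>2"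
    and lipschitz: "\<And>\<omega>. cmod (D \<omega> - D' \<omega>) \<le> b * \<bar>h \<omega>\<bar>"
  shows "cmod (expectation (\<lambda>\<omega>. of_real (h \<omega>) * F \<omega>)
            - of_real (expectation (\<lambda>\<omega>. (h \<omega>)\<^sup>2)) * expectation D)
          \<le> (a + b) * expectation (\<lambda>\<omega>. \<bar>h \<omega>\<bar> ^ 3)"
proof -
  have meas': "F' \<in> borel_measurable M" "D' \<in> borel_measurable M"
    using indep by (auto dest: indep_var_rv2)
  have c0: "0 \<le> c" using bound(1) norm_ge_zero order_trans by blast
  have hm: "h \<in> borel_measurable M" using h by auto
  have intF: "integrable M F'" "integrable M D" "integrable M D'"
    using meas meas' bound by (auto intro!: integrable_const_bound[where B=c])
  have inth: "integrable M (\<lambda>\<omega>. complex_of_real (h \<omega>))" "integrable M (\<lambda>\<omega>. complex_of_real ((h \<omega>)\<^sup>2))"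
    using h by (auto simp del: of_real_power)
  have sq: "(\<lambda>x::complex. x\<^sup>2) \<in> borel \<rightarrow>\<^sub>M borel" by simp
  have ind2: "indep_var borel (\<lambda>\<omega>. complex_of_real ((h \<omega>)\<^sup>2)) borel D'"
    using indep_var_compose[OF indep(2) sq measurable_ident_sets[OF refl]] by (simp add: o_def)
  note p1 = indep_var_lebesgue_integral[OF indep(1) inth(1) intF(1)] indep_var_integrable[OF indep(1) inth(1) intF(1)]
  note p2 = indep_var_lebesgue_integral[OF ind2 inth(2) intF(3)] indep_var_integrable[OF ind2 inth(2) intF(3)]
  have e1: "expectation (\<lambda>\<omega>. of_real (h \<omega>) * F' \<omega>) = 0"
    using p1(1) h(2) by simp
  have e2: "expectation (\<lambda>\<omega>. of_real ((h \<omega>)\<^sup>2) * D' \<omega>) = of_real (expectation (\<lambda>\<omega>. (h \<omega>)\<^sup>2)) * expectation D'"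
    using p2(1) by (simp del: of_real_power)
  have intHF: "integrable M (\<lambda>\<omega>. of_real (h \<omega>) * F \<omega>)"
  proof (rule Bochner_Integration.integrable_bound[where f="\<lambda>\<omega>. c * h \<omega>"])
    have "cmod (of_real (h \<omega>) * F \<omega>) \<le> norm (c * h \<omega>)" for \<omega>
      using mult_right_mono[OF bound(1)[of \<omega>], of "\<bar>h \<omega>\<bar>"] c0
      by (simp add: norm_mult abs_mult mult.commute)
    then show "AE \<omega> in M. cmod (of_real (h \<omega>) * F \<omega>) \<le> norm (c * h \<omega>)" by simp
  qed (use h hm meas in auto)
  define R where "R \<omega> = of_real (h \<omega>) * F \<omega> - of_real (h \<omega>) * F' \<omega> - of_real ((h \<omega>)\<^sup>2) * D' \<omega>" for \<omega>
  have R: "expectation R = expectation (\<lambda>\<omega>. of_real (h \<omega>) * F \<omega>)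
      - of_real (expectation (\<lambda>\<omega>. (h \<omega>)\<^sup>2)) * expectation D'"
    unfolding R_def using intHF p1(2) p2(2) e1 e2
    by (simp add: Bochner_Integration.integral_diff del: of_real_power)
  have R_le: "cmod (R \<omega>) \<le> a * \<bar>h \<omega>\<bar> ^ 3" for \<omega>
  proof -
    have "R \<omega> = of_real (h \<omega>) * (F \<omega> - F' \<omega> - of_real (h \<omega>) * D' \<omega>)"
      by (simp add: R_def algebra_simps power2_eq_square)
    then have "cmod (R \<omega>) \<le> \<bar>h \<omega>\<bar> * (a * (h \<omega>)\<^sup>2)"
      using mult_left_mono[OF taylor[of \<omega>], of "\<bar>h \<omega>\<bar>"] by (simp add: norm_mult)
    then show ?thesis by (simp add: power2_eq_square power3_eq_cube abs_mult_self_eq mult_ac)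
  qed
  have R_int: "integrable M R"
    unfolding R_def by (rule Bochner_Integration.integrable_diff[OF Bochner_Integration.integrable_diff[OF intHF p1(2)] p2(2)])
  have "cmod (expectation R) \<le> expectation (\<lambda>\<omega>. a * \<bar>h \<omega>\<bar> ^ 3)"
    by (rule norm_integral_le[OF R_int integrable_mult_right[OF h(4)] R_le])
  then have 1: "cmod (expectation R) \<le> a * expectation (\<lambda>\<omega>. \<bar>h \<omega>\<bar> ^ 3)" by simp
  have "cmod (expectation D' - expectation D) \<le> expectation (\<lambda>\<omega>. b * \<bar>h \<omega>\<bar>)"
    unfolding Bochner_Integration.integral_diff[OF intF(3,2), symmetric]
  proof (rule norm_integral_le)
    show "integrable M (\<lambda>\<omega>. D' \<omega> - D \<omega>)" by (rule Bochner_Integration.integrable_diff[OF intF(3,2)])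
    show "integrable M (\<lambda>\<omega>. b * \<bar>h \<omega>\<bar>)" by (intro integrable_mult_right integrable_abs h(1))
    show "cmod (D' \<omega> - D \<omega>) \<le> b * \<bar>h \<omega>\<bar>" for \<omega>
      using lipschitz[of \<omega>] norm_minus_commute[of "D' \<omega>" "D \<omega>"] by linarith
  qed
  then have 2: "cmod (expectation D' - expectation D) \<le> b * expectation (\<lambda>\<omega>. \<bar>h \<omega>\<bar>)" by simp
  have v0: "0 \<le> expectation (\<lambda>\<omega>. (h \<omega>)\<^sup>2)" by (intro integral_nonneg_AE) auto
  have "cmod (of_real (expectation (\<lambda>\<omega>. (h \<omega>)\<^sup>2)) * (expectation D' - expectation D))
      \<le> expectation (\<lambda>\<omega>. (h \<omega>)\<^sup>2) * (b * expectation (\<lambda>\<omega>. \<bar>h \<omega>\<bar>))"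
    unfolding norm_mult using v0 2 by (intro mult_mono) auto
  also have "\<dots> = b * (expectation (\<lambda>\<omega>. (h \<omega>)\<^sup>2) * expectation (\<lambda>\<omega>. \<bar>h \<omega>\<bar>))" by simp
  also have "\<dots> \<le> b * expectation (\<lambda>\<omega>. \<bar>h \<omega>\<bar> ^ 3)"
  proof (cases "0 \<le> b")
    case True
    then show ?thesis by (intro mult_left_mono second_times_first_le_third_moment h)
  next
    case False
    have "h \<omega> = 0" for \<omega>
      using order_trans[OF norm_ge_zero lipschitz[of \<omega>]] False by (simp add: zero_le_mult_iff)
    then show ?thesis by simp
  qed
  finally have 3: "cmod (of_real (expectation (\<lambda>\<omega>. (h \<omega>)\<^sup>2)) * (expectation D' - expectation D))
      \<le> b * expectation (\<lambda>\<omega>. \<bar>h \<omega>\<bar> ^ 3)" .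
  have "expectation (\<lambda>\<omega>. of_real (h \<omega>) * F \<omega>) - of_real (expectation (\<lambda>\<omega>. (h \<omega>)\<^sup>2)) * expectation D
      = expectation R + of_real (expectation (\<lambda>\<omega>. (h \<omega>)\<^sup>2)) * (expectation D' - expectation D)"
    unfolding R by (simp add: algebra_simps)
  also have "cmod \<dots> \<le> a * expectation (\<lambda>\<omega>. \<bar>h \<omega>\<bar> ^ 3) + b * expectation (\<lambda>\<omega>. \<bar>h \<omega>\<bar> ^ 3)"
    by (intro norm_triangle_le add_mono 1 3)
  finally show ?thesis by (simp add: distrib_right)
qed

lemma resolvent_cong:
  assumes "\<And>i j. i \<le> j \<Longrightarrow> j < N \<Longrightarrow> x (i, j) = y (i, j)"
  shows "resolvent N z x = resolvent N z y"
proof -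
  have "shifted_matrix N z x = shifted_matrix N z y"
    by (rule eq_matI) (auto simp: shifted_matrix_def sym_index_def assms)
  then show ?thesis by (simp add: resolvent_def fun_eq_iff)
qed

lemma borel_measurable_weighted_trace:
  assumes "\<And>l. l < N \<Longrightarrow> (\<lambda>\<omega>. G \<omega> l l) \<in> borel_measurable M"
  shows "(\<lambda>\<omega>. weighted_trace N w (G \<omega>)) \<in> borel_measurable M"
  unfolding weighted_trace_def using assms by (intro borel_measurable_sum borel_measurable_times) auto

lemma borel_measurable_entry_product:
  assumes "\<And>k l. k < N \<Longrightarrow> l < N \<Longrightarrow> (\<lambda>\<omega>. G \<omega> k l) \<in> borel_measurable M"
    and "i < N" "j < N" "a < N" "b < N"
  shows "(\<lambda>\<omega>. entry_product (i, j) (G \<omega>) (G \<omega>) a b) \<in> borel_measurable M"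
  unfolding entry_product_def using assms by simp

lemma borel_measurable_cnj: "f \<in> borel_measurable M \<Longrightarrow> (\<lambda>\<omega>. cnj (f \<omega>)) \<in> borel_measurable M"
  by (rule borel_measurable_continuous_on) (auto intro: continuous_intros)

lemma borel_measurable_test_product:
  assumes G: "\<And>k l. k < N \<Longrightarrow> l < N \<Longrightarrow> (\<lambda>\<omega>. G \<omega> k l) \<in> borel_measurable M"
    and ij: "i < N" "j < N" "a < N" "b < N"
  shows "(\<lambda>\<omega>. test_product N w s a b (G \<omega>)) \<in> borel_measurable M"
    "(\<lambda>\<omega>. test_derivative N w s (i, j) a b (G \<omega>)) \<in> borel_measurable M"
proof -
  have trace: "(\<lambda>\<omega>. cnj (weighted_trace N w (A \<omega>) - c)) \<in> borel_measurable M"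
    if "\<And>l. l < N \<Longrightarrow> (\<lambda>\<omega>. A \<omega> l l) \<in> borel_measurable M" for A c
    by (intro borel_measurable_cnj borel_measurable_diff borel_measurable_weighted_trace that borel_measurable_const)
  have product: "(\<lambda>\<omega>. entry_product (i, j) (G \<omega>) (G \<omega>) k l) \<in> borel_measurable M"
    if "k < N" "l < N" for k l
    by (rule borel_measurable_entry_product[OF G ij(1,2) that])
  show "(\<lambda>\<omega>. test_product N w s a b (G \<omega>)) \<in> borel_measurable M"
    unfolding test_product_def by (intro borel_measurable_times trace G ij)
  have "(\<lambda>\<omega>. - cnj (weighted_trace N w (entry_product (i, j) (G \<omega>) (G \<omega>)))) \<in> borel_measurable M"
    using trace[of "\<lambda>\<omega>. entry_product (i, j) (G \<omega>) (G \<omega>)" 0] product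
    by (intro borel_measurable_uminus) simp
  then show "(\<lambda>\<omega>. test_derivative N w s (i, j) a b (G \<omega>)) \<in> borel_measurable M"
    unfolding test_derivative_def
    by (intro borel_measurable_times borel_measurable_diff trace product G ij)
qed

text \<open>A random symmetric matrix with independent centred entries, whose variances are proportional to a profile
\<open>S\<close> that is spread out (\<open>S \<le> \<beta>\<close>, row sums at most 2) and whose third moments are small compared with
the variances (\<open>\<kappa>\<close>). The spectral parameter is \<open>z = i \<eta>\<close>; the bound \<open>4 v\<^sup>2 \<le> \<eta>\<^sup>2\<close> yields the contraction
factor in the fixed point argument.\<close>

locale band_ensemble = prob_space M for M :: "'w measure" +
  fixes N :: nat and X :: "nat \<times> nat \<Rightarrow> 'w \<Rightarrow> real" and S :: "nat \<Rightarrow> nat \<Rightarrow> real"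
    and v \<eta> \<kappa> \<beta> :: real
  assumes N_pos: "0 < N"
    and indep: "indep_vars (\<lambda>_. borel) X {(i, j). i \<le> j \<and> j < N}"
    and mean: "\<And>i j. i \<le> j \<Longrightarrow> j < N \<Longrightarrow> has_bochner_integral M (X (i, j)) 0"
    and variance: "\<And>i j. i \<le> j \<Longrightarrow> j < N \<Longrightarrow> has_bochner_integral M (\<lambda>\<omega>. (X (i, j) \<omega>)\<^sup>2) (v\<^sup>2 * S i j)"
    and third: "\<And>i j. i \<le> j \<Longrightarrow> j < N \<Longrightarrow> integrable M (\<lambda>\<omega>. \<bar>X (i, j) \<omega>\<bar> ^ 3)"
      "\<And>i j. i \<le> j \<Longrightarrow> j < N \<Longrightarrow> expectation (\<lambda>\<omega>. \<bar>X (i, j) \<omega>\<bar> ^ 3) \<le> \<kappa> * S i j"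
    and S_sym: "\<And>i j. i < N \<Longrightarrow> j < N \<Longrightarrow> S i j = S j i"
    and S_nonneg: "\<And>i j. i < N \<Longrightarrow> j < N \<Longrightarrow> 0 \<le> S i j"
    and S_le: "\<And>i j. i < N \<Longrightarrow> j < N \<Longrightarrow> S i j \<le> \<beta>"
    and S_row: "\<And>i. i < N \<Longrightarrow> (\<Sum>j<N. S i j) \<le> 2"
    and v_pos: "0 < v" and eta: "1 \<le> \<eta>" "4 * v\<^sup>2 \<le> \<eta>\<^sup>2" and kappa: "0 \<le> \<kappa>"
begin

definition G :: "'w \<Rightarrow> nat \<Rightarrow> nat \<Rightarrow> complex" where
  "G \<omega> = resolvent N (\<i> * \<eta>) (\<lambda>p. X p \<omega>)"

lemma Im_z: "Im (\<i> * \<eta>) \<noteq> 0" "\<bar>Im (\<i> * \<eta>)\<bar> = \<eta>"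
  using eta by auto

lemma resolvent_le_one: "a < N \<Longrightarrow> b < N \<Longrightarrow> cmod (resolvent N (\<i> * \<eta>) x a b) \<le> 1"
  using order_trans[OF resolvent_bound[OF Im_z(1), of a N b x], of 1] Im_z(2) eta by simp

lemma X_measurable: "i \<le> j \<Longrightarrow> j < N \<Longrightarrow> X (i, j) \<in> borel_measurable M"
  using indep by (auto simp: indep_vars_def)

lemma G_measurable: "a < N \<Longrightarrow> b < N \<Longrightarrow> (\<lambda>\<omega>. G \<omega> a b) \<in> borel_measurable M"
  unfolding G_def by (intro measurable_resolvent X_measurable)

text \<open>A function of the resolvent with one entry set to zero factors through the family of the remaining entries.\<close>

lemma indep_of_zeroed:
  assumes e: "i \<le> j" "j < N"
    and f: "(\<lambda>x. f (resolvent N (\<i> * \<eta>) (x((i, j) := 0)))) \<in>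
        borel_measurable (PiM ({(i, j). i \<le> j \<and> j < N} - {(i, j)}) (\<lambda>_. borel))"
  shows "indep_var borel (\<lambda>\<omega>. complex_of_real (X (i, j) \<omega>)) borel (\<lambda>\<omega>. f (resolvent N (\<i> * \<eta>) ((\<lambda>p. X p \<omega>)((i, j) := 0))))"
proof -
  let ?P = "{(i, j). i \<le> j \<and> j < N}"
  have ind: "indep_var (PiM {(i, j)} (\<lambda>_. borel)) (\<lambda>\<omega>. restrict (\<lambda>p. X p \<omega>) {(i, j)})
      (PiM (?P - {(i, j)}) (\<lambda>_. borel)) (\<lambda>\<omega>. restrict (\<lambda>p. X p \<omega>) (?P - {(i, j)}))"
    using e by (intro indep_var_restrict[OF indep]) auto
  have coord: "(\<lambda>x. complex_of_real (x (i, j))) \<in> borel_measurable (PiM {(i, j)} (\<lambda>_. borel))"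
  proof (rule measurable_compose[where f="\<lambda>x. x (i, j)" and N=borel])
    show "(\<lambda>x. x (i, j)) \<in> borel_measurable (PiM {(i, j)} (\<lambda>_. borel))"
      by (rule measurable_component_singleton) simp
  qed simp
  have "indep_var borel (\<lambda>\<omega>. complex_of_real (X (i, j) \<omega>)) borel
      (\<lambda>\<omega>. f (resolvent N (\<i> * \<eta>) ((restrict (\<lambda>p. X p \<omega>) (?P - {(i, j)}))((i, j) := 0))))"
    using indep_var_compose[OF ind coord f] by (simp add: o_def)
  moreover have "resolvent N (\<i> * \<eta>) ((restrict (\<lambda>p. X p \<omega>) (?P - {(i, j)}))((i, j) := 0))
      = resolvent N (\<i> * \<eta>) ((\<lambda>p. X p \<omega>)((i, j) := 0))" for \<omega>
    by (rule resolvent_cong) auto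
  ultimately show ?thesis by simp
qed

lemma zeroed_measurable:
  assumes "a < N" "b < N"
  shows "(\<lambda>x. resolvent N (\<i> * \<eta>) (x((i, j) := 0)) a b) \<in>
        borel_measurable (PiM ({(i, j). i \<le> j \<and> j < N} - {(i, j)}) (\<lambda>_. borel))"
proof (rule measurable_resolvent[OF _ assms])
  fix k l assume "k \<le> l" "l < N"
  then show "(\<lambda>x. (x((i, j) := 0)) (k, l)) \<in>
        borel_measurable (PiM ({(i, j). i \<le> j \<and> j < N} - {(i, j)}) (\<lambda>_. borel))"
    by (cases "(k, l) = (i, j)") (auto intro!: measurable_component_singleton)
qed

text \<open>The constant is \<open>84 = 28 + 56\<close> from \<open>test_product_taylor\<close> and \<open>test_derivative_lipschitz\<close>.\<close>

lemma entry_expansion: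
  assumes e: "i \<le> j" "j < N" and ab: "a < N" "b < N"
    and w: "\<And>l. l < N \<Longrightarrow> 0 \<le> w l" "(\<Sum>l<N. w l) \<le> 2" and s: "cmod s \<le> 1"
  shows "cmod (expectation (\<lambda>\<omega>. of_real (X (i, j) \<omega>) * test_product N w s a b (G \<omega>))
            - of_real (v\<^sup>2 * S i j) * expectation (\<lambda>\<omega>. test_derivative N w s (i, j) a b (G \<omega>)))
          \<le> 84 * (\<kappa> * S i j)"
proof -
  let ?G' = "\<lambda>\<omega>. resolvent N (\<i> * \<eta>) ((\<lambda>p. X p \<omega>)((i, j) := 0))"
  have i: "i < N" using e by simp
  have upd: "rank_two_update N i j (X (i, j) \<omega>) (G \<omega>) (?G' \<omega>) w s" for \<omega>
    by unfold_locales
      (unfold G_def, (rule e resolvent_zero_entry[OF Im_z(1) e] resolvent_le_one w s; assumption?)+)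
  interpret U: rank_two_update N i j "X (i, j) \<omega>" "G \<omega>" "?G' \<omega>" w s for \<omega> by (rule upd)
  have var: "expectation (\<lambda>\<omega>. (X (i, j) \<omega>)\<^sup>2) = v\<^sup>2 * S i j"
    "integrable M (\<lambda>\<omega>. (X (i, j) \<omega>)\<^sup>2)"
    using variance[OF e] by (auto simp: has_bochner_integral_iff)
  have mn: "expectation (X (i, j)) = 0" "integrable M (X (i, j))"
    using mean[OF e] by (auto simp: has_bochner_integral_iff)
  have tp: "cmod (test_product N w s a b A) \<le> 10"
    if "cmod (weighted_trace N w A - s) \<le> 3" "cmod (A a b) \<le> 1" for A
  proof -
    have "cmod (test_product N w s a b A) = cmod (weighted_trace N w A - s) * cmod (A a b)"
      unfolding test_product_def norm_mult complex_mod_cnj ..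
    also have "\<dots> \<le> 3 * 1" using that by (intro mult_mono) auto
    finally show ?thesis by simp
  qed
  have "cmod (expectation (\<lambda>\<omega>. of_real (X (i, j) \<omega>) * test_product N w s a b (G \<omega>))
            - of_real (expectation (\<lambda>\<omega>. (X (i, j) \<omega>)\<^sup>2)) * expectation (\<lambda>\<omega>. test_derivative N w s (i, j) a b (G \<omega>)))
      \<le> (28 + 56) * expectation (\<lambda>\<omega>. \<bar>X (i, j) \<omega>\<bar> ^ 3)"
  proof (rule first_order_expansion[where c=10])
    show "indep_var borel (\<lambda>\<omega>. complex_of_real (X (i, j) \<omega>)) borel (\<lambda>\<omega>. test_product N w s a b (?G' \<omega>))"
      by (rule indep_of_zeroed[OF e borel_measurable_test_product(1)[OF zeroed_measurable i e(2) ab]])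
    show "indep_var borel (\<lambda>\<omega>. complex_of_real (X (i, j) \<omega>)) borel (\<lambda>\<omega>. test_derivative N w s (i, j) a b (?G' \<omega>))"
      by (rule indep_of_zeroed[OF e borel_measurable_test_product(2)[OF zeroed_measurable i e(2) ab]])
    show "(\<lambda>\<omega>. test_product N w s a b (G \<omega>)) \<in> borel_measurable M"
      by (rule borel_measurable_test_product(1)[OF G_measurable i e(2) ab])
    show "(\<lambda>\<omega>. test_derivative N w s (i, j) a b (G \<omega>)) \<in> borel_measurable M"
      by (rule borel_measurable_test_product(2)[OF G_measurable i e(2) ab])
    show "cmod (test_product N w s a b (G \<omega>)) \<le> 10" for \<omega>
      by (rule tp[OF U.bounds(1) U.G[OF ab]])
    show "cmod (test_product N w s a b (?G' \<omega>)) \<le> 10" for \<omega>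
      by (rule tp[OF U.bounds(2) U.G'[OF ab]])
    show "cmod (test_derivative N w s (i, j) a b (G \<omega>)) \<le> 10" for \<omega>
      by (rule U.test_derivative_le(1)[OF ab])
    show "cmod (test_derivative N w s (i, j) a b (?G' \<omega>)) \<le> 10" for \<omega>
      by (rule U.test_derivative_le(2)[OF ab])
    show "cmod (test_product N w s a b (G \<omega>) - test_product N w s a b (?G' \<omega>)
           - of_real (X (i, j) \<omega>) * test_derivative N w s (i, j) a b (?G' \<omega>)) \<le> 28 * (X (i, j) \<omega>)\<^sup>2" for \<omega>
      by (rule U.test_product_taylor[OF ab])
    show "cmod (test_derivative N w s (i, j) a b (G \<omega>) - test_derivative N w s (i, j) a b (?G' \<omega>))
        \<le> 56 * \<bar>X (i, j) \<omega>\<bar>" for \<omega>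
      by (rule U.test_derivative_lipschitz[OF ab])
  qed (rule mn var third(1)[OF e])+
  also have "\<dots> \<le> 84 * (\<kappa> * S i j)" using third(2)[OF e] by simp
  finally show ?thesis unfolding var .
qed

end

section \<open>The self-consistent equation in mean square\<close>

text \<open>The diagonal of \<open>A E A\<close> consists of products of two entries from the rows \<open>i\<close> and \<open>j\<close>, which are square summable;
the factor \<open>\<beta>\<close> is gained because no weight exceeds \<open>\<beta>\<close>.\<close>

lemma entry_product_trace_le:
  assumes w: "\<And>l. l < N \<Longrightarrow> 0 \<le> w l" "\<And>l. l < N \<Longrightarrow> w l \<le> \<beta>"
    and sym: "\<And>a b. a < N \<Longrightarrow> b < N \<Longrightarrow> A a b = A b a"
    and row: "\<And>a. a < N \<Longrightarrow> (\<Sum>b<N. (cmod (A a b))\<^sup>2) \<le> 1"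
    and e: "i < N" "j < N"
  shows "cmod (weighted_trace N w (entry_product (i, j) A A)) \<le> 2 * \<beta>"
proof -
  have b0: "0 \<le> \<beta>" using w[OF e(1)] by simp
  have "cmod (of_real (w l) * entry_product (i, j) A A l l)
      \<le> \<beta> * ((cmod (A i l))\<^sup>2 + (cmod (A j l))\<^sup>2)" if l: "l < N" for l
  proof -
    have "cmod (entry_product (i, j) A A l l) \<le> 2 * (cmod (A i l) * cmod (A j l))"
      using sym[OF l e(1)] sym[OF l e(2)]
      by (auto simp: entry_product_def norm_mult mult.commute intro!: norm_triangle_le)
    also have "\<dots> \<le> (cmod (A i l))\<^sup>2 + (cmod (A j l))\<^sup>2"
      using sum_squares_bound[of "cmod (A i l)" "cmod (A j l)"] by simp
    finally show ?thesis unfolding norm_mult using w[OF l] b0 by (intro mult_mono) auto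
  qed
  then have "cmod (weighted_trace N w (entry_product (i, j) A A))
      \<le> (\<Sum>l<N. \<beta> * ((cmod (A i l))\<^sup>2 + (cmod (A j l))\<^sup>2))"
    unfolding weighted_trace_def by (intro sum_norm_le) auto
  also have "\<dots> = \<beta> * ((\<Sum>l<N. (cmod (A i l))\<^sup>2) + (\<Sum>l<N. (cmod (A j l))\<^sup>2))"
    by (simp add: sum_distrib_left sum.distrib distrib_left)
  also have "\<dots> \<le> \<beta> * 2" using row[OF e(1)] row[OF e(2)] b0 by (intro mult_left_mono) auto
  finally show ?thesis by simp
qed

text \<open>The derivative of \<open>G(j,i)\<close> is \<open>- G(j,j) G(i,i) - G(i,j)\<^sup>2\<close> off the diagonal and only one such term on it.
The term \<open>Q G(j,j) G(i,i)\<close> is the one that survives; the rest is small or square summable in \<open>j\<close>.\<close>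

lemma test_derivative_main_term:
  assumes w: "\<And>l. l < N \<Longrightarrow> 0 \<le> w l" "\<And>l. l < N \<Longrightarrow> w l \<le> \<beta>"
    and sym: "\<And>a b. a < N \<Longrightarrow> b < N \<Longrightarrow> A a b = A b a"
    and row: "\<And>a. a < N \<Longrightarrow> (\<Sum>b<N. (cmod (A a b))\<^sup>2) \<le> 1"
    and le1: "\<And>a b. a < N \<Longrightarrow> b < N \<Longrightarrow> cmod (A a b) \<le> 1"
    and t: "cmod (weighted_trace N w A - s) \<le> 3"
    and e: "i < N" "j < N"
  shows "cmod (test_derivative N w s (sym_index i j) j i A
      + cnj (weighted_trace N w A - s) * A j j * A i i) \<le> 2 * \<beta> + 3 * (cmod (A i j))\<^sup>2"
proof -
  have "test_derivative N w s (sym_index i j) j i A + cnj (weighted_trace N w A - s) * A j j * A i i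
      = - cnj (weighted_trace N w (entry_product (sym_index i j) A A)) * A j i
        - (if i = j then 0 else cnj (weighted_trace N w A - s) * (A i j * A i j))"
    using sym[OF e]
    by (auto simp: test_derivative_def entry_product_def sym_index_def min_def max_def algebra_simps)
  also have "cmod \<dots> \<le> (2 * \<beta>) * 1 + 3 * (cmod (A i j))\<^sup>2"
  proof (rule norm_triangle_le_diff, rule add_mono)
    have "cmod (weighted_trace N w (entry_product (sym_index i j) A A)) \<le> 2 * \<beta>"
      using entry_product_trace_le[OF w sym row] e by (simp add: sym_index_def min_def max_def)
    then show "cmod (- cnj (weighted_trace N w (entry_product (sym_index i j) A A)) * A j i) \<le> (2 * \<beta>) * 1"
      unfolding norm_mult norm_minus_cancel complex_mod_cnj using le1[OF e(2,1)] order_trans[OF w[OF e(1)]]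
      by (intro mult_mono) auto
    show "cmod (if i = j then 0 else cnj (weighted_trace N w A - s) * (A i j * A i j)) \<le> 3 * (cmod (A i j))\<^sup>2"
      using t by (auto simp: norm_mult power2_eq_square simp del: complex_cnj_diff intro!: mult_right_mono)
  qed
  finally show ?thesis by simp
qed

text \<open>In the application \<open>s\<close> is the Stieltjes transform of the semicircle law at \<open>i \<eta>\<close>; the argument only uses its
quadratic equation and its size.\<close>

locale band_semicircle = band_ensemble +
  fixes s :: complex
  assumes s_eq: "v\<^sup>2 * s\<^sup>2 + \<i> * \<eta> * s + 1 = 0" and s_le: "cmod s \<le> 1 / \<eta>"
begin

definition T :: "nat \<Rightarrow> 'a \<Rightarrow> complex" where
  "T k \<omega> = weighted_trace N (S k) (G \<omega>)"

abbreviation error_bound :: real where "error_bound \<equiv> 7 * v\<^sup>2 * \<beta> + 168 * \<kappa>"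

lemma s_le_one: "cmod s \<le> 1"
  using order_trans[OF s_le, of 1] eta by simp

lemma G_le: "a < N \<Longrightarrow> b < N \<Longrightarrow> cmod (G \<omega> a b) \<le> 1" "a < N \<Longrightarrow> b < N \<Longrightarrow> cmod (G \<omega> a b) \<le> 1 / \<eta>"
  using resolvent_le_one[of a b] resolvent_bound[OF Im_z(1), of a N b] Im_z(2) by (simp_all add: G_def)

lemma G_sym: "a < N \<Longrightarrow> b < N \<Longrightarrow> G \<omega> a b = G \<omega> b a"
  unfolding G_def by (rule resolvent_sym[OF Im_z(1)])

lemma G_row: "a < N \<Longrightarrow> (\<Sum>b<N. (cmod (G \<omega> a b))\<^sup>2) \<le> 1"
proof -
  assume "a < N"
  then have "(\<Sum>b<N. (cmod (G \<omega> a b))\<^sup>2) \<le> 1 / \<eta>\<^sup>2"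
    unfolding G_def using resolvent_row_bound[OF Im_z(1)] by simp
  also have "\<dots> \<le> 1" using eta one_le_power[OF eta(1), of 2] by simp
  finally show ?thesis .
qed

lemma trace_bound:
  assumes "\<And>l. l < N \<Longrightarrow> 0 \<le> w l" "(\<Sum>l<N. w l) \<le> 2"
  shows "cmod (weighted_trace N w (G \<omega>) - s) \<le> 3"
proof -
  have "cmod (weighted_trace N w (G \<omega>)) \<le> 2 * 1"
    unfolding weighted_trace_def using assms G_le by (intro norm_weighted_sum_le) auto
  then show ?thesis using norm_triangle_ineq4[of "weighted_trace N w (G \<omega>)" s] s_le_one by simp
qed

lemma bounded_integrable:
  fixes f :: "'a \<Rightarrow> 'b::{banach, second_countable_topology}"
  assumes "f \<in> borel_measurable M" "\<And>\<omega>. norm (f \<omega>) \<le> c"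
  shows "integrable M f"
  using assms by (intro integrable_const_bound[where B=c]) auto

lemma trace_measurable: "(\<lambda>\<omega>. weighted_trace N w (G \<omega>)) \<in> borel_measurable M"
  by (intro borel_measurable_weighted_trace G_measurable)

text \<open>The diagonal resolvent equation multiplied by \<open>Q\<close>, with every product \<open>H(i,j) Q G(j,i)\<close> replaced by its
first-order expansion. The expansions cost \<open>84 \<kappa> S(i,j)\<close> each and the secondary terms
\<open>v\<^sup>2 (2 * 2 \<beta> + 3 \<beta>)\<close> in total, since the row sums of \<open>S\<close> are at most 2.\<close>

lemma approximate_fixed_point:
  assumes i: "i < N" and w: "\<And>l. l < N \<Longrightarrow> 0 \<le> w l" "\<And>l. l < N \<Longrightarrow> w l \<le> \<beta>" "(\<Sum>l<N. w l) \<le> 2"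
  defines "Q \<equiv> \<lambda>\<omega>. cnj (weighted_trace N w (G \<omega>) - s)"
  shows "cmod (expectation Q + \<i> * \<eta> * expectation (\<lambda>\<omega>. Q \<omega> * G \<omega> i i)
      + v\<^sup>2 * expectation (\<lambda>\<omega>. Q \<omega> * T i \<omega> * G \<omega> i i)) \<le> error_bound"
proof -
  have Qm: "Q \<in> borel_measurable M"
    unfolding Q_def by (intro borel_measurable_cnj borel_measurable_diff trace_measurable borel_measurable_const)
  have Qle: "cmod (Q \<omega>) \<le> 3" for \<omega> unfolding Q_def complex_mod_cnj by (rule trace_bound[OF w(1,3)])
  have QG: "integrable M (\<lambda>\<omega>. Q \<omega> * G \<omega> a b)" if "a < N" "b < N" for a b
    using Qm G_measurable that mult_mono[OF Qle G_le(1)[OF that]]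
    by (intro bounded_integrable[where c="3 * 1"]) (auto simp: norm_mult)
  have QGG: "integrable M (\<lambda>\<omega>. Q \<omega> * G \<omega> j j * G \<omega> i i)" if "j < N" for j
    using Qm G_measurable that i mult_mono[OF mult_mono[OF Qle G_le(1)[OF that that]] G_le(1)[OF i i]]
    by (intro bounded_integrable[where c="3 * 1 * 1"]) (auto simp: norm_mult)
  let ?H = "\<lambda>j \<omega>. complex_of_real (X (sym_index i j) \<omega>)"
  let ?td = "\<lambda>j \<omega>. test_derivative N w s (sym_index i j) j i (G \<omega>)"
  let ?W = "\<lambda>j \<omega>. ?td j \<omega> + Q \<omega> * G \<omega> j j * G \<omega> i i"
  have td_int: "integrable M (?td j)" if j: "j < N" for j
  proof -
    have Wle: "cmod (?W j \<omega>) \<le> 2 * \<beta> + 3" for \<omega>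
    proof -
      have "cmod (?W j \<omega>) \<le> 2 * \<beta> + 3 * (cmod (G \<omega> i j))\<^sup>2"
        unfolding Q_def by (rule test_derivative_main_term[OF w(1,2) G_sym G_row G_le(1) trace_bound[OF w(1,3)] i j])
      also have "(cmod (G \<omega> i j))\<^sup>2 \<le> 1" using G_le(1)[OF i j] by (simp add: power_le_one)
      finally show ?thesis by simp
    qed
    have m: "?td j \<in> borel_measurable M"
      unfolding sym_index_def using i j by (intro borel_measurable_test_product(2)[OF G_measurable]) auto
    have "integrable M (?W j)"
      by (rule bounded_integrable[OF borel_measurable_add[OF m borel_measurable_integrable[OF QGG[OF j]]] Wle])
    from Bochner_Integration.integrable_diff[OF this QGG[OF j]] show ?thesis by simp
  qed
  have HQG: "integrable M (\<lambda>\<omega>. ?H j \<omega> * (Q \<omega> * G \<omega> j i))" if j: "j < N" for j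
  proof (rule Bochner_Integration.integrable_bound[where f="\<lambda>\<omega>. 3 * X (sym_index i j) \<omega>"])
    have mj: "has_bochner_integral M (X (sym_index i j)) 0"
      using mean[of "min i j" "max i j"] i j by (simp add: sym_index_def)
    then show "integrable M (\<lambda>\<omega>. 3 * X (sym_index i j) \<omega>)" by (simp add: has_bochner_integral_iff)
    show "(\<lambda>\<omega>. ?H j \<omega> * (Q \<omega> * G \<omega> j i)) \<in> borel_measurable M"
      using mj Qm G_measurable[OF j i] by (auto simp: has_bochner_integral_iff)
    have "cmod (?H j \<omega> * (Q \<omega> * G \<omega> j i)) \<le> norm (3 * X (sym_index i j) \<omega>)" for \<omega>
      using mult_left_mono[OF mult_mono[OF Qle[of \<omega>] G_le(1)[OF j i, of \<omega>]], of "\<bar>X (sym_index i j) \<omega>\<bar>"]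
      by (simp add: norm_mult abs_mult mult_ac)
    then show "AE \<omega> in M. cmod (?H j \<omega> * (Q \<omega> * G \<omega> j i)) \<le> norm (3 * X (sym_index i j) \<omega>)" by simp
  qed
  have expand: "cmod (expectation (\<lambda>\<omega>. ?H j \<omega> * (Q \<omega> * G \<omega> j i)) - of_real (v\<^sup>2 * S i j) * expectation (?td j))
      \<le> 84 * \<kappa> * S i j" if j: "j < N" for j
  proof -
    have "S (min i j) (max i j) = S i j" using S_sym[OF i j] by (simp add: min_def max_def)
    then show ?thesis
      using entry_expansion[OF _ _ j i w(1,3) s_le_one, of "min i j" "max i j"] i j
      by (simp add: sym_index_def test_product_def Q_def mult.assoc)
  qed
  \<comment> \<open>the diagonal entry of \<open>(H - z) G = 1\<close>\<close>
  have row: "Q \<omega> + \<i> * \<eta> * (Q \<omega> * G \<omega> i i) = (\<Sum>j<N. ?H j \<omega> * (Q \<omega> * G \<omega> j i))" for \<omega>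
  proof -
    have "(\<Sum>j<N. ?H j \<omega> * (Q \<omega> * G \<omega> j i)) = Q \<omega> * (\<Sum>j<N. ?H j \<omega> * G \<omega> j i)"
      by (simp add: sum_distrib_left mult_ac)
    also have "\<dots> = Q \<omega> * (\<i> * \<eta> * G \<omega> i i + 1)"
      unfolding G_def using resolvent_equation[OF Im_z(1) i i, of "\<lambda>p. X p \<omega>"] by simp
    finally show ?thesis by (simp add: algebra_simps)
  qed
  have "expectation Q + \<i> * \<eta> * expectation (\<lambda>\<omega>. Q \<omega> * G \<omega> i i)
      = expectation (\<lambda>\<omega>. Q \<omega> + \<i> * \<eta> * (Q \<omega> * G \<omega> i i))"
    using bounded_integrable[OF Qm Qle] QG[OF i i] by simp
  also have "\<dots> = (\<Sum>j<N. expectation (\<lambda>\<omega>. ?H j \<omega> * (Q \<omega> * G \<omega> j i)))"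
    unfolding row using HQG by (intro Bochner_Integration.integral_sum) auto
  finally have lhs: "expectation Q + \<i> * \<eta> * expectation (\<lambda>\<omega>. Q \<omega> * G \<omega> i i)
      = (\<Sum>j<N. expectation (\<lambda>\<omega>. ?H j \<omega> * (Q \<omega> * G \<omega> j i)))" .
  have "expectation (\<lambda>\<omega>. Q \<omega> * T i \<omega> * G \<omega> i i)
      = expectation (\<lambda>\<omega>. \<Sum>j<N. of_real (S i j) * (Q \<omega> * G \<omega> j j * G \<omega> i i))"
    by (simp add: T_def weighted_trace_def sum_distrib_left sum_distrib_right mult_ac)
  also have "\<dots> = (\<Sum>j<N. of_real (S i j) * expectation (\<lambda>\<omega>. Q \<omega> * G \<omega> j j * G \<omega> i i))"
    using QGG by (subst Bochner_Integration.integral_sum) auto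
  finally have main: "v\<^sup>2 * expectation (\<lambda>\<omega>. Q \<omega> * T i \<omega> * G \<omega> i i)
      = (\<Sum>j<N. of_real (v\<^sup>2 * S i j) * expectation (\<lambda>\<omega>. Q \<omega> * G \<omega> j j * G \<omega> i i))"
    by (simp add: sum_distrib_left mult_ac)
  have W_int: "integrable M (?W j)" if "j < N" for j
    by (rule Bochner_Integration.integrable_add[OF td_int[OF that] QGG[OF that]])
  have W_exp: "expectation (?W j) = expectation (?td j) + expectation (\<lambda>\<omega>. Q \<omega> * G \<omega> j j * G \<omega> i i)"
    if "j < N" for j
    by (rule Bochner_Integration.integral_add[OF td_int[OF that] QGG[OF that]])
  have split: "expectation Q + \<i> * \<eta> * expectation (\<lambda>\<omega>. Q \<omega> * G \<omega> i i) + v\<^sup>2 * expectation (\<lambda>\<omega>. Q \<omega> * T i \<omega> * G \<omega> i i)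
      = (\<Sum>j<N. expectation (\<lambda>\<omega>. ?H j \<omega> * (Q \<omega> * G \<omega> j i)) - of_real (v\<^sup>2 * S i j) * expectation (?td j))
        + of_real (v\<^sup>2) * (\<Sum>j<N. of_real (S i j) * expectation (?W j))"
    unfolding lhs main sum_distrib_left sum.distrib[symmetric]
    by (intro sum.cong refl) (simp only: lessThan_iff W_exp, simp only: of_real_mult algebra_simps)
  have P: "cmod (\<Sum>j<N. expectation (\<lambda>\<omega>. ?H j \<omega> * (Q \<omega> * G \<omega> j i)) - of_real (v\<^sup>2 * S i j) * expectation (?td j))
      \<le> 168 * \<kappa>"
  proof -
    have "cmod (\<Sum>j<N. expectation (\<lambda>\<omega>. ?H j \<omega> * (Q \<omega> * G \<omega> j i)) - of_real (v\<^sup>2 * S i j) * expectation (?td j))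
        \<le> (\<Sum>j<N. 84 * \<kappa> * S i j)"
      using expand by (intro sum_norm_le) auto
    also have "\<dots> = 84 * \<kappa> * (\<Sum>j<N. S i j)" by (simp add: sum_distrib_left)
    also have "\<dots> \<le> 84 * \<kappa> * 2" using S_row[OF i] kappa by (intro mult_left_mono) auto
    finally show ?thesis by simp
  qed
  have R: "cmod (of_real (v\<^sup>2) * (\<Sum>j<N. of_real (S i j) * expectation (?W j))) \<le> v\<^sup>2 * (7 * \<beta>)"
  proof -
    have b0: "0 \<le> \<beta>" using w(1,2)[OF i] by simp
    have "(\<Sum>j<N. of_real (S i j) * expectation (?W j)) = expectation (\<lambda>\<omega>. \<Sum>j<N. of_real (S i j) * ?W j \<omega>)"
      using W_int by (subst Bochner_Integration.integral_sum) auto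
    also have "cmod \<dots> \<le> expectation (\<lambda>\<omega>. 7 * \<beta>)"
    proof (rule norm_integral_le)
      show "integrable M (\<lambda>\<omega>. \<Sum>j<N. of_real (S i j) * ?W j \<omega>)" using W_int by auto
      show "cmod (\<Sum>j<N. of_real (S i j) * ?W j \<omega>) \<le> 7 * \<beta>" for \<omega>
      proof -
        have "cmod (\<Sum>j<N. of_real (S i j) * ?W j \<omega>) \<le> (\<Sum>j<N. 2 * \<beta> * S i j + 3 * \<beta> * (cmod (G \<omega> i j))\<^sup>2)"
        proof (rule sum_norm_le)
          fix j assume "j \<in> {..<N}"
          then have j: "j < N" by simp
          have "cmod (?W j \<omega>) \<le> 2 * \<beta> + 3 * (cmod (G \<omega> i j))\<^sup>2"
            unfolding Q_def by (rule test_derivative_main_term[OF w(1,2) G_sym G_row G_le(1) trace_bound[OF w(1,3)] i j])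
          then have "cmod (of_real (S i j) * ?W j \<omega>) \<le> S i j * (2 * \<beta> + 3 * (cmod (G \<omega> i j))\<^sup>2)"
            unfolding norm_mult using S_nonneg[OF i j] by (simp add: mult_left_mono)
          also have "\<dots> = 2 * \<beta> * S i j + 3 * S i j * (cmod (G \<omega> i j))\<^sup>2" by (simp add: algebra_simps)
          also have "3 * S i j * (cmod (G \<omega> i j))\<^sup>2 \<le> 3 * \<beta> * (cmod (G \<omega> i j))\<^sup>2"
            using S_le[OF i j] by (intro mult_right_mono) auto
          finally show "cmod (of_real (S i j) * ?W j \<omega>) \<le> 2 * \<beta> * S i j + 3 * \<beta> * (cmod (G \<omega> i j))\<^sup>2" by simp
        qed
        also have "\<dots> = 2 * \<beta> * (\<Sum>j<N. S i j) + 3 * \<beta> * (\<Sum>j<N. (cmod (G \<omega> i j))\<^sup>2)"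
          by (simp add: sum.distrib sum_distrib_left)
        also have "\<dots> \<le> 2 * \<beta> * 2 + 3 * \<beta> * 1"
          using b0 S_row[OF i] G_row[OF i] by (intro add_mono mult_left_mono) auto
        finally show ?thesis by simp
      qed
    qed simp
    finally show ?thesis by (simp add: norm_mult norm_power prob_space mult_left_mono)
  qed
  show ?thesis
    unfolding split by (rule order_trans[OF norm_triangle_mono[OF P R]]) simp
qed

text \<open>Subtracting \<open>z s = - 1 - v\<^sup>2 s\<^sup>2\<close> times \<open>E Q\<close> from the approximate equation gives
\<open>(z + v\<^sup>2 s) E[Q (G(i,i) - s)] = - v\<^sup>2 E[Q (T(i) - s) G(i,i)]\<close> up to the error. Since
\<open>z + v\<^sup>2 s = - 1 / s\<close>, division by it multiplies by \<open>\<bar>s\<bar> \<le> 1 / \<eta>\<close>, and another factor \<open>1 / \<eta>\<close> comes from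
\<open>G(i,i)\<close>; the coefficient is \<open>v\<^sup>2 / \<eta>\<^sup>2 \<le> 1 / 4\<close>.\<close>

lemma covariance_bound:
  assumes i: "i < N" and w: "\<And>l. l < N \<Longrightarrow> 0 \<le> w l" "\<And>l. l < N \<Longrightarrow> w l \<le> \<beta>" "(\<Sum>l<N. w l) \<le> 2"
  defines "Q \<equiv> \<lambda>\<omega>. cnj (weighted_trace N w (G \<omega>) - s)"
  shows "cmod (expectation (\<lambda>\<omega>. Q \<omega> * (G \<omega> i i - s)))
      \<le> expectation (\<lambda>\<omega>. cmod (Q \<omega>) * cmod (T i \<omega> - s)) / 4 + error_bound"
proof -
  let ?z = "\<i> * complex_of_real \<eta>"
  have Qm: "Q \<in> borel_measurable M"
    unfolding Q_def by (intro borel_measurable_cnj borel_measurable_diff trace_measurable borel_measurable_const)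
  have Tm: "T i \<in> borel_measurable M" unfolding T_def[abs_def] by (rule trace_measurable)
  have Gm: "(\<lambda>\<omega>. G \<omega> i i) \<in> borel_measurable M" by (rule G_measurable[OF i i])
  have Qle: "cmod (Q \<omega>) \<le> 3" for \<omega> unfolding Q_def complex_mod_cnj by (rule trace_bound[OF w(1,3)])
  have Tle: "cmod (T i \<omega> - s) \<le> 3" for \<omega>
    unfolding T_def using S_nonneg[OF i] S_row[OF i] by (intro trace_bound) auto
  have Q: "integrable M Q" by (rule bounded_integrable[OF Qm Qle])
  have QG: "integrable M (\<lambda>\<omega>. Q \<omega> * G \<omega> i i)"
    using Qm Gm mult_mono[OF Qle G_le(1)[OF i i]]
    by (intro bounded_integrable[where c="3 * 1"]) (auto simp: norm_mult)
  have QTG: "integrable M (\<lambda>\<omega>. Q \<omega> * (T i \<omega> - s) * G \<omega> i i)"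
    using Qm Gm Tm mult_mono[OF mult_mono[OF Qle Tle] G_le(1)[OF i i]]
    by (intro bounded_integrable[where c="3 * 3 * 1"]) (auto simp: norm_mult)
  have QT: "integrable M (\<lambda>\<omega>. cmod (Q \<omega>) * cmod (T i \<omega> - s))"
    using Qm Tm mult_mono[OF Qle Tle]
    by (intro bounded_integrable[where c="3 * 3"]) (auto simp: norm_mult)
  define e where "e = expectation Q + ?z * expectation (\<lambda>\<omega>. Q \<omega> * G \<omega> i i)
      + v\<^sup>2 * expectation (\<lambda>\<omega>. Q \<omega> * T i \<omega> * G \<omega> i i)"
  define A where "A = expectation (\<lambda>\<omega>. Q \<omega> * (T i \<omega> - s) * G \<omega> i i)"
  define B where "B = expectation (\<lambda>\<omega>. Q \<omega> * (G \<omega> i i - s))"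
  have B: "B = expectation (\<lambda>\<omega>. Q \<omega> * G \<omega> i i) - s * expectation Q"
    unfolding B_def right_diff_distrib using Q QG by (simp add: mult.commute)
  have "expectation (\<lambda>\<omega>. Q \<omega> * T i \<omega> * G \<omega> i i)
      = expectation (\<lambda>\<omega>. Q \<omega> * (T i \<omega> - s) * G \<omega> i i + s * (Q \<omega> * G \<omega> i i))"
    by (intro arg_cong[where f="integral\<^sup>L M"]) (auto simp: fun_eq_iff algebra_simps)
  also have "\<dots> = A + s * expectation (\<lambda>\<omega>. Q \<omega> * G \<omega> i i)"
    unfolding A_def using QTG QG by simp
  finally have QTG_exp: "expectation (\<lambda>\<omega>. Q \<omega> * T i \<omega> * G \<omega> i i) = A + s * expectation (\<lambda>\<omega>. Q \<omega> * G \<omega> i i)" .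
  have s1: "- s * (?z + v\<^sup>2 * s) = 1"
    using s_eq by (simp add: algebra_simps power2_eq_square) (metis add.commute add.left_commute add_eq_0_iff)
  \<comment> \<open>the coefficient of \<open>E Q\<close> on the left is \<open>- s (z + v\<^sup>2 s) = 1\<close>\<close>
  have key: "(?z + v\<^sup>2 * s) * B = e - v\<^sup>2 * A"
  proof -
    have "(?z + v\<^sup>2 * s) * B = (?z + v\<^sup>2 * s) * expectation (\<lambda>\<omega>. Q \<omega> * G \<omega> i i)
        + (- s * (?z + v\<^sup>2 * s)) * expectation Q"
      unfolding B by (simp add: algebra_simps)
    also have "\<dots> = e - v\<^sup>2 * A" unfolding s1 e_def QTG_exp by (simp add: algebra_simps)
    finally show ?thesis .
  qed
  have "B = (- s * (?z + v\<^sup>2 * s)) * B" unfolding s1 by simp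
  also have "\<dots> = - s * (e - v\<^sup>2 * A)" unfolding mult.assoc key ..
  finally have "cmod B = cmod s * cmod (e - v\<^sup>2 * A)" by (simp add: norm_mult)
  also have "\<dots> \<le> cmod s * (cmod e + v\<^sup>2 * cmod A)"
    using norm_triangle_ineq4[of e "v\<^sup>2 * A"] by (intro mult_left_mono) (auto simp: norm_mult norm_power)
  also have "\<dots> \<le> 1 * error_bound + (1 / \<eta>) * (v\<^sup>2 * cmod A)"
  proof -
    have e: "cmod e \<le> error_bound"
      unfolding e_def Q_def by (rule approximate_fixed_point[OF i w])
    have "cmod s * cmod e \<le> 1 * error_bound" using s_le_one e by (intro mult_mono) auto
    moreover have "cmod s * (v\<^sup>2 * cmod A) \<le> (1 / \<eta>) * (v\<^sup>2 * cmod A)"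
      using s_le by (intro mult_right_mono) auto
    ultimately show ?thesis by (simp add: distrib_left)
  qed
  also have "(1 / \<eta>) * (v\<^sup>2 * cmod A) \<le> expectation (\<lambda>\<omega>. cmod (Q \<omega>) * cmod (T i \<omega> - s)) / 4"
  proof -
    have "cmod A \<le> expectation (\<lambda>\<omega>. (1 / \<eta>) * (cmod (Q \<omega>) * cmod (T i \<omega> - s)))"
      unfolding A_def
    proof (rule norm_integral_le[OF QTG])
      show "cmod (Q \<omega> * (T i \<omega> - s) * G \<omega> i i) \<le> (1 / \<eta>) * (cmod (Q \<omega>) * cmod (T i \<omega> - s))" for \<omega>
        using mult_left_mono[OF G_le(2)[OF i i, of \<omega>], of "cmod (Q \<omega>) * cmod (T i \<omega> - s)"]
        by (simp add: norm_mult mult_ac)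
    qed (use QT in auto)
    then have A: "cmod A \<le> (1 / \<eta>) * expectation (\<lambda>\<omega>. cmod (Q \<omega>) * cmod (T i \<omega> - s))" by simp
    have "(1 / \<eta>) * (v\<^sup>2 * cmod A) \<le> (1 / \<eta>) * (v\<^sup>2 * ((1 / \<eta>) * expectation (\<lambda>\<omega>. cmod (Q \<omega>) * cmod (T i \<omega> - s))))"
      using eta by (intro mult_left_mono A) auto
    also have "\<dots> = (v\<^sup>2 / \<eta>\<^sup>2) * expectation (\<lambda>\<omega>. cmod (Q \<omega>) * cmod (T i \<omega> - s))"
      by (simp add: power2_eq_square)
    also have "\<dots> \<le> (1 / 4) * expectation (\<lambda>\<omega>. cmod (Q \<omega>) * cmod (T i \<omega> - s))"
      using eta by (intro mult_right_mono integral_nonneg_AE) (auto simp: field_simps)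
    finally show ?thesis by simp
  qed
  finally show ?thesis by (simp add: B_def)
qed

end

context band_semicircle
begin

definition defect :: real where
  "defect = (\<Sum>k<N. \<bar>1 - (\<Sum>l<N. S k l)\<bar>) / real N"

lemma T_measurable: "T k \<in> borel_measurable M"
  unfolding T_def[abs_def] by (rule trace_measurable)

lemma T_le: "k < N \<Longrightarrow> cmod (T k \<omega> - s) \<le> 3"
  unfolding T_def using S_nonneg S_row by (intro trace_bound) auto

lemma T_integrable:
  assumes "k < N" "i < N"
  shows "integrable M (\<lambda>\<omega>. (cmod (T k \<omega> - s))\<^sup>2)"
    "integrable M (\<lambda>\<omega>. cmod (T k \<omega> - s) * cmod (T i \<omega> - s))"
    "integrable M (\<lambda>\<omega>. cnj (T k \<omega> - s))"
    "integrable M (\<lambda>\<omega>. cnj (T k \<omega> - s) * (G \<omega> i i - s))"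
proof -
  have m: "(\<lambda>\<omega>. cmod (T k \<omega> - s)) \<in> borel_measurable M" for k using T_measurable by auto
  show "integrable M (\<lambda>\<omega>. (cmod (T k \<omega> - s))\<^sup>2)"
    by (rule bounded_integrable[OF borel_measurable_power[OF m], where c="3\<^sup>2"])
      (use power_mono[where n=2, OF T_le[OF assms(1)] norm_ge_zero] in simp)
  show "integrable M (\<lambda>\<omega>. cmod (T k \<omega> - s) * cmod (T i \<omega> - s))"
    by (rule bounded_integrable[OF borel_measurable_times[OF m m], where c="3 * 3"])
      (use mult_mono[OF T_le[OF assms(1)] T_le[OF assms(2)]] in \<open>auto simp: norm_mult\<close>)
  have c: "(\<lambda>\<omega>. cnj (T k \<omega> - s)) \<in> borel_measurable M"
    by (intro borel_measurable_cnj borel_measurable_diff T_measurable borel_measurable_const)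
  show "integrable M (\<lambda>\<omega>. cnj (T k \<omega> - s))"
    by (rule bounded_integrable[OF c, where c=3]) (use T_le[OF assms(1)] in \<open>simp only: complex_mod_cnj\<close>)
  have "cmod (G \<omega> i i - s) \<le> 2" for \<omega>
    using norm_triangle_ineq4[of "G \<omega> i i" s] G_le(1)[OF assms(2,2), of \<omega>] s_le_one by simp
  from mult_mono[OF T_le[OF assms(1)] this]
  show "integrable M (\<lambda>\<omega>. cnj (T k \<omega> - s) * (G \<omega> i i - s))"
    by (intro bounded_integrable[where c="3 * 2"] borel_measurable_times c borel_measurable_diff
        G_measurable borel_measurable_const assms)
      (simp only: norm_mult complex_mod_cnj, simp)
qed

lemma T_minus_s:
  "T k \<omega> - s = (\<Sum>i<N. of_real (S k i) * (G \<omega> i i - s)) - of_real (1 - (\<Sum>l<N. S k l)) * s"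
  by (simp add: T_def weighted_trace_def right_diff_distrib left_diff_distrib sum_subtractf sum_distrib_right)

definition mean_square :: "nat \<Rightarrow> real" where
  "mean_square k = expectation (\<lambda>\<omega>. (cmod (T k \<omega> - s))\<^sup>2)"

text \<open>One factor of \<open>\<bar>T(k) - s\<bar>\<^sup>2\<close> is written as a sum over the diagonal of \<open>G\<close> by \<open>T_minus_s\<close>, and each term is bounded
by \<open>covariance_bound\<close> with the other factor as the test variable.\<close>

lemma second_moment_recursion:
  assumes k: "k < N"
  shows "mean_square k \<le> (\<Sum>i<N. S k i * ((mean_square k + mean_square i) / 8 + error_bound)) + 3 * \<bar>1 - (\<Sum>l<N. S k l)\<bar>"
proof -
  let ?Q = "\<lambda>\<omega>. cnj (T k \<omega> - s)"
  let ?d = "1 - (\<Sum>l<N. S k l)"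
  have w: "0 \<le> S k l" "S k l \<le> \<beta>" if "l < N" for l using S_nonneg S_le k that by auto
  have "complex_of_real (mean_square k) = expectation (\<lambda>\<omega>. complex_of_real ((cmod (T k \<omega> - s))\<^sup>2))"
    unfolding mean_square_def by (rule integral_complex_of_real[symmetric])
  also have "\<dots> = expectation (\<lambda>\<omega>. (\<Sum>i<N. of_real (S k i) * (?Q \<omega> * (G \<omega> i i - s))) - of_real ?d * s * ?Q \<omega>)"
  proof (intro arg_cong[where f="integral\<^sup>L M"] ext)
    fix \<omega>
    have "of_real ((cmod (T k \<omega> - s))\<^sup>2) = ?Q \<omega> * (T k \<omega> - s)"
      by (simp only: complex_norm_square mult.commute)
    also have "\<dots> = ?Q \<omega> * ((\<Sum>i<N. of_real (S k i) * (G \<omega> i i - s)) - of_real ?d * s)"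
      by (subst (2) T_minus_s) (rule refl)
    also have "\<dots> = (\<Sum>i<N. of_real (S k i) * (?Q \<omega> * (G \<omega> i i - s))) - of_real ?d * s * ?Q \<omega>"
      by (simp only: right_diff_distrib[of "?Q \<omega>"] sum_distrib_left mult_ac)
    finally show "of_real ((cmod (T k \<omega> - s))\<^sup>2)
      = (\<Sum>i<N. of_real (S k i) * (?Q \<omega> * (G \<omega> i i - s))) - of_real ?d * s * ?Q \<omega>" .
  qed
  also have "\<dots> = (\<Sum>i<N. of_real (S k i) * expectation (\<lambda>\<omega>. ?Q \<omega> * (G \<omega> i i - s)))
      - of_real ?d * s * expectation ?Q"
  proof (subst Bochner_Integration.integral_diff)
    show "integrable M (\<lambda>\<omega>. \<Sum>i<N. of_real (S k i) * (?Q \<omega> * (G \<omega> i i - s)))"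
      using T_integrable(4)[OF k] by (intro Bochner_Integration.integrable_sum integrable_mult_right) auto
    show "integrable M (\<lambda>\<omega>. of_real ?d * s * ?Q \<omega>)" by (rule integrable_mult_right[OF T_integrable(3)[OF k k]])
    show "expectation (\<lambda>\<omega>. \<Sum>i<N. of_real (S k i) * (?Q \<omega> * (G \<omega> i i - s))) - expectation (\<lambda>\<omega>. of_real ?d * s * ?Q \<omega>)
      = (\<Sum>i<N. of_real (S k i) * expectation (\<lambda>\<omega>. ?Q \<omega> * (G \<omega> i i - s))) - of_real ?d * s * expectation ?Q"
      using T_integrable(4)[OF k] integrable_mult_right
      by (subst Bochner_Integration.integral_sum) (auto simp del: complex_cnj_diff)
  qed
  finally have eq: "of_real (mean_square k) = (\<Sum>i<N. of_real (S k i) * expectation (\<lambda>\<omega>. ?Q \<omega> * (G \<omega> i i - s)))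
      - of_real ?d * s * expectation ?Q" .
  have u_abs: "mean_square k \<le> cmod (of_real (mean_square k))" by simp
  have sum_part: "cmod (\<Sum>i<N. of_real (S k i) * expectation (\<lambda>\<omega>. ?Q \<omega> * (G \<omega> i i - s)))
      \<le> (\<Sum>i<N. S k i * ((mean_square k + mean_square i) / 8 + error_bound))"
  proof (rule sum_norm_le)
    fix i assume "i \<in> {..<N}"
    then have i: "i < N" by simp
    have "cmod (expectation (\<lambda>\<omega>. ?Q \<omega> * (G \<omega> i i - s)))
        \<le> expectation (\<lambda>\<omega>. cmod (?Q \<omega>) * cmod (T i \<omega> - s)) / 4 + error_bound"
      using covariance_bound[OF i, of "S k"] w S_row[OF k] by (simp only: T_def)
    also have "expectation (\<lambda>\<omega>. cmod (?Q \<omega>) * cmod (T i \<omega> - s)) \<le> (mean_square k + mean_square i) / 2"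
    proof -
      have "expectation (\<lambda>\<omega>. cmod (?Q \<omega>) * cmod (T i \<omega> - s))
          \<le> expectation (\<lambda>\<omega>. ((cmod (T k \<omega> - s))\<^sup>2 + (cmod (T i \<omega> - s))\<^sup>2) / 2)"
        unfolding complex_mod_cnj
      proof (rule integral_mono)
        show "cmod (T k \<omega> - s) * cmod (T i \<omega> - s) \<le> ((cmod (T k \<omega> - s))\<^sup>2 + (cmod (T i \<omega> - s))\<^sup>2) / 2" for \<omega>
          using sum_squares_bound[of "cmod (T k \<omega> - s)" "cmod (T i \<omega> - s)"] by simp
      qed (use T_integrable k i in auto)
      also have "\<dots> = (mean_square k + mean_square i) / 2"
        unfolding mean_square_def using T_integrable(1)[OF k k] T_integrable(1)[OF i i] by simp
      finally show ?thesis .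
    qed
    finally have "cmod (expectation (\<lambda>\<omega>. ?Q \<omega> * (G \<omega> i i - s))) \<le> (mean_square k + mean_square i) / 8 + error_bound" by simp
    then show "cmod (of_real (S k i) * expectation (\<lambda>\<omega>. ?Q \<omega> * (G \<omega> i i - s)))
        \<le> S k i * ((mean_square k + mean_square i) / 8 + error_bound)"
      unfolding norm_mult using w(1)[OF i] by (simp only: norm_of_real abs_of_nonneg mult_left_mono)
  qed
  have def_part: "cmod (of_real ?d * s * expectation ?Q) \<le> 3 * \<bar>?d\<bar>"
  proof -
    have "cmod (expectation ?Q) \<le> expectation (\<lambda>\<omega>. 3)"
      by (rule norm_integral_le[OF T_integrable(3)[OF k k]]) (use T_le[OF k] in \<open>simp_all only: complex_mod_cnj, simp_all\<close>)
    then have "cmod (expectation ?Q) \<le> 3" by (simp only: lebesgue_integral_const prob_space scaleR_one)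
    then have "cmod s * cmod (expectation ?Q) \<le> 1 * 3" using s_le_one by (intro mult_mono) simp_all
    then have "\<bar>?d\<bar> * (cmod s * cmod (expectation ?Q)) \<le> \<bar>?d\<bar> * (1 * 3)" by (intro mult_left_mono) simp_all
    then show ?thesis unfolding norm_mult norm_of_real by (simp only: mult_ac mult_1)
  qed
  show ?thesis
    by (rule order_trans[OF u_abs]) (unfold eq, rule norm_triangle_le_diff[OF add_mono[OF sum_part def_part]])
qed

lemma beta_nonneg: "0 \<le> \<beta>"
  using S_nonneg[OF N_pos N_pos] S_le[OF N_pos N_pos] by simp

lemma mean_square_nonneg: "0 \<le> mean_square k"
  unfolding mean_square_def by (intro integral_nonneg_AE) auto

text \<open>The recursion is summed over \<open>k\<close>. As the row and column sums of \<open>S\<close> are at most 2, the mean squares on the right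
carry the total weight \<open>2/8 + 2/8 = 1/2\<close> and can be absorbed on the left.\<close>

lemma mean_square_bound: "(\<Sum>k<N. mean_square k) \<le> real N * (4 * error_bound + 6 * defect)"
proof -
  have e0: "0 \<le> error_bound" using beta_nonneg kappa by simp
  have S_col: "(\<Sum>k<N. S k i) \<le> 2" if "i < N" for i
  proof -
    have "(\<Sum>k<N. S k i) = (\<Sum>k<N. S i k)" using S_sym that by (intro sum.cong) auto
    then show ?thesis using S_row[OF that] by simp
  qed
  have "(\<Sum>k<N. mean_square k) \<le> (\<Sum>k<N. (\<Sum>i<N. S k i * ((mean_square k + mean_square i) / 8 + error_bound)) + 3 * \<bar>1 - (\<Sum>l<N. S k l)\<bar>)"
    by (intro sum_mono second_moment_recursion) auto
  also have "\<dots> = (\<Sum>k<N. mean_square k * (\<Sum>i<N. S k i)) / 8 + (\<Sum>k<N. \<Sum>i<N. mean_square i * S k i) / 8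
      + (\<Sum>k<N. error_bound * (\<Sum>i<N. S k i)) + 3 * (\<Sum>k<N. \<bar>1 - (\<Sum>l<N. S k l)\<bar>)"
  proof -
    have "(\<Sum>i<N. S k i * ((mean_square k + mean_square i) / 8 + c))
        = mean_square k * (\<Sum>i<N. S k i) / 8 + (\<Sum>i<N. mean_square i * S k i) / 8 + c * (\<Sum>i<N. S k i)" for k c
    proof -
      have "(\<Sum>i<N. S k i * ((mean_square k + mean_square i) / 8 + c))
          = (\<Sum>i<N. mean_square k * S k i / 8 + mean_square i * S k i / 8 + c * S k i)"
        by (intro sum.cong) (auto simp: field_simps)
      then show ?thesis by (simp add: sum.distrib sum_distrib_left sum_divide_distrib)
    qed
    then show ?thesis by (simp only: sum.distrib sum_divide_distrib sum_distrib_left[of 3])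
  qed
  also have "(\<Sum>k<N. mean_square k * (\<Sum>i<N. S k i)) \<le> (\<Sum>k<N. mean_square k * 2)"
    by (intro sum_mono mult_left_mono S_row mean_square_nonneg) auto
  also have "(\<Sum>k<N. \<Sum>i<N. mean_square i * S k i) = (\<Sum>i<N. mean_square i * (\<Sum>k<N. S k i))"
    by (subst sum.swap) (simp add: sum_distrib_left)
  also have "\<dots> \<le> (\<Sum>i<N. mean_square i * 2)"
    by (intro sum_mono mult_left_mono S_col mean_square_nonneg) auto
  also have "(\<Sum>k<N. error_bound * (\<Sum>i<N. S k i)) \<le> (\<Sum>k<N. error_bound * 2)"
    by (intro sum_mono mult_left_mono S_row e0) auto
  also have "(\<Sum>k<N. \<bar>1 - (\<Sum>l<N. S k l)\<bar>) = real N * defect"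
    using N_pos by (simp add: defect_def)
  finally have "(\<Sum>k<N. mean_square k) \<le> (\<Sum>k<N. mean_square k) / 2 + real N * (error_bound * 2) + 3 * (real N * defect)"
    by (simp add: sum_distrib_right[symmetric])
  then show ?thesis by (simp add: algebra_simps)
qed

text \<open>The average of \<open>T(k)\<close> is the trace with weights given by the column sums of \<open>S\<close>, so it differs from the
normalized trace by at most the defect. The free parameter \<open>t\<close> trades a first moment for a second one through
\<open>x \<le> t + x\<^sup>2 / t\<close>.\<close>

theorem normalized_trace_close:
  assumes t: "0 < t"
  shows "expectation (\<lambda>\<omega>. cmod ((\<Sum>i<N. G \<omega> i i) / real N - s))
    \<le> t + (4 * error_bound + 6 * defect) / t + defect"
proof -
  let ?r = "\<lambda>j. \<Sum>l<N. S j l"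
  have col: "(\<Sum>k<N. S k j) = ?r j" if "j < N" for j
    using S_sym that by (intro sum.cong) auto
  have pointwise: "cmod ((\<Sum>i<N. G \<omega> i i) / real N - s)
      \<le> (\<Sum>k<N. t + (cmod (T k \<omega> - s))\<^sup>2 / t) / real N + defect" for \<omega>
  proof -
    have "(\<Sum>k<N. T k \<omega>) = (\<Sum>j<N. of_real (?r j) * G \<omega> j j)"
      unfolding T_def weighted_trace_def
    proof (subst sum.swap, rule sum.cong[OF refl])
      fix j assume "j \<in> {..<N}"
      then have "(\<Sum>k<N. complex_of_real (S k j)) = of_real (?r j)"
        using arg_cong[OF col, of j complex_of_real] by simp
      then show "(\<Sum>k<N. of_real (S k j) * G \<omega> j j) = of_real (?r j) * G \<omega> j j"
        by (simp only: sum_distrib_right[symmetric])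
    qed
    then have "(\<Sum>i<N. G \<omega> i i) - real N * s = (\<Sum>k<N. T k \<omega> - s) + (\<Sum>j<N. of_real (1 - ?r j) * G \<omega> j j)"
      by (simp add: sum_subtractf left_diff_distrib)
    moreover have 1: "cmod (\<Sum>k<N. T k \<omega> - s) \<le> (\<Sum>k<N. t + (cmod (T k \<omega> - s))\<^sup>2 / t)"
    proof (rule sum_norm_le)
      fix k
      let ?x = "cmod (T k \<omega> - s)"
      have "0 \<le> (?x - t)\<^sup>2 + ?x * t" using t by simp
      then have "?x * t \<le> t\<^sup>2 + ?x\<^sup>2" by (simp add: power2_eq_square algebra_simps)
      then show "?x \<le> t + ?x\<^sup>2 / t" using t by (simp add: field_simps power2_eq_square)
    qed
    moreover have 2: "cmod (\<Sum>j<N. of_real (1 - ?r j) * G \<omega> j j) \<le> (\<Sum>j<N. \<bar>1 - ?r j\<bar>)"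
    proof (rule sum_norm_le)
      fix j assume "j \<in> {..<N}"
      then have "\<bar>1 - ?r j\<bar> * cmod (G \<omega> j j) \<le> \<bar>1 - ?r j\<bar> * 1"
        using G_le(1) by (intro mult_left_mono) auto
      then show "cmod (of_real (1 - ?r j) * G \<omega> j j) \<le> \<bar>1 - ?r j\<bar>"
        unfolding norm_mult norm_of_real by simp
    qed
    ultimately have "cmod ((\<Sum>i<N. G \<omega> i i) - real N * s)
        \<le> (\<Sum>k<N. t + (cmod (T k \<omega> - s))\<^sup>2 / t) + (\<Sum>j<N. \<bar>1 - ?r j\<bar>)"
      by (simp only: norm_triangle_mono[OF 1 2])
    then have "cmod ((\<Sum>i<N. G \<omega> i i) - real N * s) / real N
        \<le> ((\<Sum>k<N. t + (cmod (T k \<omega> - s))\<^sup>2 / t) + (\<Sum>j<N. \<bar>1 - ?r j\<bar>)) / real N"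
      by (rule divide_right_mono) simp
    moreover have "cmod ((\<Sum>i<N. G \<omega> i i) - real N * s) / real N = cmod ((\<Sum>i<N. G \<omega> i i) / real N - s)"
    proof -
      have "(\<Sum>i<N. G \<omega> i i) / real N - s = ((\<Sum>i<N. G \<omega> i i) - real N * s) / real N"
        using N_pos by (simp add: field_simps)
      then show ?thesis by (simp add: norm_divide)
    qed
    ultimately show ?thesis by (simp add: defect_def add_divide_distrib)
  qed
  have int: "integrable M (\<lambda>\<omega>. (\<Sum>k<N. t + (cmod (T k \<omega> - s))\<^sup>2 / t) / real N + defect)"
    using T_integrable(1) by (intro Bochner_Integration.integrable_add integrable_divide
        Bochner_Integration.integrable_sum) auto
  have "expectation (\<lambda>\<omega>. cmod ((\<Sum>i<N. G \<omega> i i) / real N - s))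
      \<le> expectation (\<lambda>\<omega>. (\<Sum>k<N. t + (cmod (T k \<omega> - s))\<^sup>2 / t) / real N + defect)"
  proof (rule integral_mono_AE')
    show "AE \<omega> in M. cmod ((\<Sum>i<N. G \<omega> i i) / real N - s)
        \<le> (\<Sum>k<N. t + (cmod (T k \<omega> - s))\<^sup>2 / t) / real N + defect"
      using pointwise by simp
    show "AE \<omega> in M. 0 \<le> (\<Sum>k<N. t + (cmod (T k \<omega> - s))\<^sup>2 / t) / real N + defect"
      using order_trans[OF norm_ge_zero pointwise] by simp
  qed (rule int)
  also have "\<dots> = (\<Sum>k<N. t + mean_square k / t) / real N + defect"
  proof -
    have f: "integrable M (\<lambda>\<omega>. t + (cmod (T k \<omega> - s))\<^sup>2 / t)"
      "expectation (\<lambda>\<omega>. t + (cmod (T k \<omega> - s))\<^sup>2 / t) = t + mean_square k / t" if "k < N" for k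
      using T_integrable(1)[OF that that] by (simp_all add: mean_square_def prob_space)
    have "expectation (\<lambda>\<omega>. \<Sum>k<N. t + (cmod (T k \<omega> - s))\<^sup>2 / t)
        = (\<Sum>k<N. expectation (\<lambda>\<omega>. t + (cmod (T k \<omega> - s))\<^sup>2 / t))"
      using f(1) by (intro Bochner_Integration.integral_sum) auto
    also have "\<dots> = (\<Sum>k<N. t + mean_square k / t)" using f(2) by (intro sum.cong) auto
    finally have "expectation (\<lambda>\<omega>. \<Sum>k<N. t + (cmod (T k \<omega> - s))\<^sup>2 / t) = (\<Sum>k<N. t + mean_square k / t)" .
    moreover have "integrable M (\<lambda>\<omega>. (\<Sum>k<N. t + (cmod (T k \<omega> - s))\<^sup>2 / t) / real N)"
      using f(1) by (intro integrable_divide Bochner_Integration.integrable_sum) auto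
    ultimately show ?thesis
      by (subst Bochner_Integration.integral_add)
        (simp_all only: integral_divide_zero lebesgue_integral_const prob_space scaleR_one integrable_const)
  qed
  also have "(\<Sum>k<N. t + mean_square k / t) / real N = t + (\<Sum>k<N. mean_square k) / (real N * t)"
  proof -
    have "(\<Sum>k<N. t + mean_square k / t) = real N * t + (\<Sum>k<N. mean_square k) / t"
      by (simp add: sum.distrib sum_divide_distrib)
    then show ?thesis using N_pos t by (simp add: add_divide_distrib mult.commute)
  qed
  also have "(\<Sum>k<N. mean_square k) / (real N * t) \<le> (real N * (4 * error_bound + 6 * defect)) / (real N * t)"
    using mean_square_bound t N_pos by (intro divide_right_mono) auto
  also have "\<dots> = (4 * error_bound + 6 * defect) / t" using N_pos by simp
  finally show ?thesis by simp
qed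

end

section \<open>Row sums of a band profile\<close>

locale profile =
  fixes \<psi> :: "real \<Rightarrow> real"
  assumes range: "\<And>t. \<psi> t \<in> {0..1}"
    and cont: "continuous_on UNIV \<psi>"
    and even: "\<And>t. \<psi> (- t) = \<psi> t"
    and decreasing: "antimono_on {0..} \<psi>"
    and total: "has_bochner_integral lborel \<psi> 1"
begin

definition partial_mass :: "real \<Rightarrow> real" where "partial_mass y = integral {0..y} \<psi>"

lemma integrable_on_interval: "\<psi> integrable_on {x..y}"
  by (rule integrable_continuous_real[OF continuous_on_subset[OF cont]]) simp

lemma partial_mass_nonneg: "0 \<le> partial_mass y"
  unfolding partial_mass_def using range by (intro integral_nonneg integrable_on_interval) auto

lemma partial_mass_mono: "x \<le> y \<Longrightarrow> partial_mass x \<le> partial_mass y"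
  unfolding partial_mass_def using range by (intro integral_subset_le integrable_on_interval) auto

lemma partial_mass_add:
  assumes "0 \<le> x" "x \<le> y"
  shows "partial_mass y = partial_mass x + integral {x..y} \<psi>"
  unfolding partial_mass_def using Henstock_Kurzweil_Integration.integral_combine[OF assms integrable_on_interval] by simp

lemma symmetric_integral: "integral {-y..y} \<psi> = 2 * partial_mass y" if "0 \<le> y"
proof -
  have "integral {-y..y} \<psi> = integral {-y..0} \<psi> + integral {0..y} \<psi>"
    using Henstock_Kurzweil_Integration.integral_combine[of "-y" 0 y \<psi>] that integrable_on_interval by simp
  also have "integral {-y..0} \<psi> = integral {-y..-0} (\<lambda>x. \<psi> (- x))" by (simp add: even)
  also have "\<dots> = integral {0..y} \<psi>" by (rule Henstock_Kurzweil_Integration.integral_reflect_real)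
  finally show ?thesis by (simp add: partial_mass_def)
qed

lemma symmetric_integral_lborel:
  "integral {-y..y} \<psi> = (\<integral>x. indicator {-y..y} x * \<psi> x \<partial>lborel)"
proof -
  have "set_integrable lborel {-y..y} \<psi>"
    unfolding set_integrable_def using total by (intro integrable_mult_indicator) (auto simp: has_bochner_integral_iff)
  from set_borel_integral_eq_integral(2)[OF this] show ?thesis
    by (simp add: set_lebesgue_integral_def)
qed

lemma partial_mass_le: "partial_mass y \<le> 1 / 2"
proof (cases "0 \<le> y")
  case True
  have "2 * partial_mass y = (\<integral>x. indicator {-y..y} x * \<psi> x \<partial>lborel)"
    using symmetric_integral[OF True] symmetric_integral_lborel by simp
  also have "\<dots> \<le> (\<integral>x. \<psi> x \<partial>lborel)"
  proof (rule integral_mono_AE')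
    show "integrable lborel \<psi>" using total by (simp add: has_bochner_integral_iff)
    show "AE x in lborel. indicator {-y..y} x * \<psi> x \<le> \<psi> x"
      using range by (auto simp: indicator_def)
    show "AE x in lborel. 0 \<le> \<psi> x" using range by auto
  qed
  also have "\<dots> = 1" using total by (simp add: has_bochner_integral_iff)
  finally show ?thesis by simp
qed (simp add: partial_mass_def)

lemma partial_mass_tendsto: "(\<lambda>n. partial_mass (real n)) \<longlonglongrightarrow> 1 / 2"
proof -
  have int: "integrable lborel \<psi>" "(\<integral>x. \<psi> x \<partial>lborel) = 1" using total by (auto simp: has_bochner_integral_iff)
  have "(\<lambda>n::nat. \<integral>x. indicator {-real n..real n} x * \<psi> x \<partial>lborel) \<longlonglongrightarrow> (\<integral>x. \<psi> x \<partial>lborel)"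
  proof (rule integral_dominated_convergence[where w="\<psi>"])
    show "\<psi> \<in> borel_measurable lborel" using int by auto
    then show "(\<lambda>x. indicator {-real n..real n} x * \<psi> x) \<in> borel_measurable lborel" for n by simp
    show "AE x in lborel. (\<lambda>n::nat. indicator {-real n..real n} x * \<psi> x) \<longlonglongrightarrow> \<psi> x"
    proof (rule AE_I2)
      fix x
      have "eventually (\<lambda>n::nat. \<bar>x\<bar> \<le> real n) sequentially"
        by (metis eventually_sequentiallyI nat_ceiling_le_eq)
      then have "eventually (\<lambda>n::nat. indicator {-real n..real n} x * \<psi> x = \<psi> x) sequentially"
        by eventually_elim (auto simp: indicator_def)
      then show "(\<lambda>n::nat. indicator {-real n..real n} x * \<psi> x) \<longlonglongrightarrow> \<psi> x"
        by (rule tendsto_eventually)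
    qed
    show "AE x in lborel. norm (indicator {-real n..real n} x * \<psi> x) \<le> \<psi> x" for n
      using range by (auto simp: indicator_def)
  qed (rule int)
  then have "(\<lambda>n::nat. 2 * partial_mass (real n)) \<longlonglongrightarrow> 1"
    by (simp add: symmetric_integral_lborel[symmetric] symmetric_integral int)
  from tendsto_mult_left[OF this, of "1/2"] show ?thesis by simp
qed

text \<open>On an interval of length \<open>1/b\<close> a decreasing function lies between its values at the end points.\<close>

lemma step_bounds:
  assumes "0 < b"
  shows "\<psi> (real (Suc m) / b) / b \<le> partial_mass (real (Suc m) / b) - partial_mass (real m / b)"
    and "partial_mass (real (Suc m) / b) - partial_mass (real m / b) \<le> \<psi> (real m / b) / b"
proof -
  let ?x = "real m / b" and ?y = "real (Suc m) / b"
  have xy: "0 \<le> ?x" "?x \<le> ?y" and len: "?y - ?x = 1 / b"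
    using assms by (auto simp: divide_right_mono diff_divide_distrib[symmetric])
  have partial_mass: "partial_mass ?y - partial_mass ?x = integral {?x..?y} \<psi>" using partial_mass_add[OF xy] by simp
  have const: "integral {?x..?y} (\<lambda>_. c) = c / b" for c :: real
    using xy len by simp
  have mono: "\<psi> q \<le> \<psi> p" if "0 \<le> p" "p \<le> q" for p q
    using decreasing that by (auto simp: monotone_on_def)
  have "integral {?x..?y} (\<lambda>_. \<psi> ?y) \<le> integral {?x..?y} \<psi>"
    using mono xy by (intro integral_le integrable_on_interval integrable_const_ivl) auto
  then show "\<psi> ?y / b \<le> partial_mass ?y - partial_mass ?x" unfolding partial_mass const .
  have "integral {?x..?y} \<psi> \<le> integral {?x..?y} (\<lambda>_. \<psi> ?x)"
    using mono xy by (intro integral_le integrable_on_interval integrable_const_ivl) auto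
  then show "partial_mass ?y - partial_mass ?x \<le> \<psi> ?x / b" unfolding partial_mass const .
qed

lemma riemann_sum_bounds:
  assumes "0 < b"
  shows "(\<Sum>m<K. \<psi> (real (Suc m) / b) / b) \<le> partial_mass (real K / b)"
    and "partial_mass (real K / b) \<le> (\<Sum>m<K. \<psi> (real m / b) / b)"
proof -
  have "(\<Sum>m<K. partial_mass (real (Suc m) / b) - partial_mass (real m / b)) = partial_mass (real K / b)"
    by (subst sum_lessThan_telescope) (simp add: partial_mass_def)
  moreover have "(\<Sum>m<K. \<psi> (real (Suc m) / b) / b) \<le> (\<Sum>m<K. partial_mass (real (Suc m) / b) - partial_mass (real m / b))"
    by (intro sum_mono step_bounds assms)
  moreover have "(\<Sum>m<K. partial_mass (real (Suc m) / b) - partial_mass (real m / b)) \<le> (\<Sum>m<K. \<psi> (real m / b) / b)"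
    by (intro sum_mono step_bounds assms)
  ultimately show "(\<Sum>m<K. \<psi> (real (Suc m) / b) / b) \<le> partial_mass (real K / b)"
    "partial_mass (real K / b) \<le> (\<Sum>m<K. \<psi> (real m / b) / b)" by simp_all
qed

definition band_profile :: "real \<Rightarrow> nat \<Rightarrow> nat \<Rightarrow> real" where
  "band_profile b k l = \<psi> ((real k - real l) / b) / b"

text \<open>The entries left and right of the diagonal form the same Riemann sum, with \<open>k\<close> and \<open>N - Suc k\<close> terms.\<close>

lemma row_split:
  assumes k: "k < N"
  shows "(\<Sum>l<N. band_profile b k l)
    = (\<Sum>m<k. \<psi> (real (Suc m) / b) / b) + \<psi> 0 / b + (\<Sum>m<N - Suc k. \<psi> (real (Suc m) / b) / b)"
proof -
  have "{..<N} = {..<k} \<union> {k} \<union> {Suc k..<N}" using k by auto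
  then have "(\<Sum>l<N. band_profile b k l)
      = (\<Sum>l<k. band_profile b k l) + band_profile b k k + (\<Sum>l\<in>{Suc k..<N}. band_profile b k l)"
    using sum.union_disjoint[of "{..<k}" "{Suc k..<N}" "band_profile b k"] by fastforce
  also have "(\<Sum>l<k. band_profile b k l) = (\<Sum>m<k. \<psi> (real (Suc m) / b) / b)"
    by (rule sum.reindex_bij_witness[of _ "\<lambda>m. k - Suc m" "\<lambda>l. k - Suc l"])
      (auto simp: band_profile_def of_nat_diff)
  also have "(\<Sum>l\<in>{Suc k..<N}. band_profile b k l) = (\<Sum>m<N - Suc k. \<psi> (real (Suc m) / b) / b)"
  proof (rule sum.reindex_bij_witness[of _ "\<lambda>m. m + Suc k" "\<lambda>l. l - Suc k"])
    fix l assume "l \<in> {Suc k..<N}"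
    then have "(real k - real l) / b = - (real (Suc (l - Suc k)) / b)"
      by (simp add: of_nat_diff minus_divide_left[symmetric] diff_divide_distrib)
    then show "\<psi> (real (Suc (l - Suc k)) / b) / b = band_profile b k l"
      by (simp only: band_profile_def even)
  qed (use k in auto)
  finally show ?thesis by (simp add: band_profile_def)
qed

lemma row_le:
  assumes "0 < b" "k < N"
  shows "(\<Sum>l<N. band_profile b k l) \<le> 1 + 1 / b"
proof -
  have "\<psi> 0 / b \<le> 1 / b" using range[of 0] assms by (simp add: divide_right_mono)
  then show ?thesis
    unfolding row_split[OF assms(2)]
    using order_trans[OF riemann_sum_bounds(1)[OF assms(1)] partial_mass_le]
    by (smt (verit) field_sum_of_halves)
qed

lemma row_ge:
  assumes "0 < b" "k < N"
  shows "partial_mass (real (Suc k) / b) + partial_mass (real (N - k) / b) - 2 / b \<le> (\<Sum>l<N. band_profile b k l)"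
proof -
  have *: "partial_mass (real (Suc K) / b) - 1 / b \<le> (\<Sum>m<K. \<psi> (real (Suc m) / b) / b)" for K
  proof -
    have "partial_mass (real (Suc K) / b) \<le> \<psi> 0 / b + (\<Sum>m<K. \<psi> (real (Suc m) / b) / b)"
      using riemann_sum_bounds(2)[OF assms(1), of "Suc K"] by (simp add: sum.lessThan_Suc_shift del: sum.lessThan_Suc)
    moreover have "\<psi> 0 / b \<le> 1 / b" using range[of 0] assms by (simp add: divide_right_mono)
    ultimately show ?thesis by simp
  qed
  have "0 \<le> \<psi> 0 / b" using range[of 0] assms by simp
  moreover have "Suc (N - Suc k) = N - k" using assms by simp
  ultimately show ?thesis
    unfolding row_split[OF assms(2)] using *[of k] *[of "N - Suc k"] by (simp del: of_nat_Suc)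
qed

text \<open>A row sum is close to 1 as soon as the row is farther than \<open>L b\<close> from both ends, where \<open>L\<close> is chosen such
that at most the mass \<open>\<epsilon>\<close> of the profile lies outside \<open>{-L..L}\<close>. The at most \<open>L b\<close> rows near each end contribute
at most \<open>1/2\<close> each, and the discretization error is \<open>4/b\<close>.\<close>

theorem average_row_defect:
  assumes "0 < \<epsilon>"
  obtains L where "0 < L"
    "\<And>b N. 0 < b \<Longrightarrow> 0 < N \<Longrightarrow>
       (\<Sum>k<N. \<bar>1 - (\<Sum>l<N. band_profile b k l)\<bar>) / real N \<le> \<epsilon> + L * b / real N + 4 / b"
proof -
  have "eventually (\<lambda>n. 1 / 2 - \<epsilon> / 2 < partial_mass (real n)) sequentially"
    using order_tendstoD(1)[OF partial_mass_tendsto, of "1 / 2 - \<epsilon> / 2"] assms by simp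
  then obtain L0 where L0: "1 / 2 - \<epsilon> / 2 < partial_mass (real L0)" by (auto simp: eventually_sequentially)
  define L where "L = real (Suc L0)"
  have PL: "1 / 2 - \<epsilon> / 2 \<le> partial_mass y" if "L \<le> y" for y
    using L0 partial_mass_mono[of "real L0" y] that by (simp add: L_def)
  show ?thesis
  proof (rule that[of L])
    show "0 < L" by (simp add: L_def)
    fix b :: real and N :: nat assume b: "0 < b" and N: "0 < N"
    \<comment> \<open>beyond \<open>L\<close> the partial mass is almost its limit \<open>1/2\<close>; before, it is at least 0\<close>
    have lower: "1 / 2 - \<epsilon> / 2 - (if real q < L * b then 1 / 2 else 0) \<le> partial_mass (real q / b)" for q :: nat
    proof (cases "real q < L * b")
      case True
      then show ?thesis using partial_mass_nonneg[of "real q / b"] assms by simp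
    next
      case False
      then show ?thesis using PL[of "real q / b"] b by (simp add: field_simps)
    qed
    have few: "(\<Sum>q<N. if real (Suc q) < L * b then 1 / 2 else (0::real)) \<le> L * b / 2"
    proof -
      have sub: "{q. q < N \<and> real (Suc q) < L * b} \<subseteq> {..<nat \<lfloor>L * b\<rfloor>}"
        using le_nat_floor by (force simp: less_eq_Suc_le)
      have "(\<Sum>q<N. if real (Suc q) < L * b then 1 / 2 else (0::real)) = real (card {q. q < N \<and> real (Suc q) < L * b}) / 2"
        by (simp add: sum.If_cases Int_def)
      also have "\<dots> \<le> real (card {..<nat \<lfloor>L * b\<rfloor>}) / 2"
        using card_mono[OF _ sub] by simp
      also have "\<dots> \<le> L * b / 2" using b by (simp add: L_def)
      finally show ?thesis .
    qed
    have half: "real N / 2 - \<epsilon> * real N / 2 - L * b / 2 \<le> (\<Sum>q<N. partial_mass (real (Suc q) / b))"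
    proof -
      have "(\<Sum>q<N. 1 / 2 - \<epsilon> / 2 - (if real (Suc q) < L * b then 1 / 2 else 0)) \<le> (\<Sum>q<N. partial_mass (real (Suc q) / b))"
        by (intro sum_mono lower)
      moreover have "(\<Sum>q<N. 1 / 2 - \<epsilon> / 2 - (if real (Suc q) < L * b then 1 / 2 else 0))
          = real N * (1 / 2 - \<epsilon> / 2) - (\<Sum>q<N. if real (Suc q) < L * b then 1 / 2 else 0)"
        by (simp only: sum_subtractf sum_constant card_lessThan)
          (simp add: right_diff_distrib)
      ultimately have "real N * (1 / 2 - \<epsilon> / 2) - L * b / 2 \<le> (\<Sum>q<N. partial_mass (real (Suc q) / b))"
        using few by linarith
      then show ?thesis by (simp add: right_diff_distrib mult.commute)
    qed
    have refl: "(\<Sum>k<N. partial_mass (real (N - k) / b)) = (\<Sum>q<N. partial_mass (real (Suc q) / b))"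
      by (rule sum.reindex_bij_witness[of _ "\<lambda>q. N - Suc q" "\<lambda>k. N - Suc k"]) (auto simp: Suc_diff_Suc)
    have "(\<Sum>k<N. \<bar>1 - (\<Sum>l<N. band_profile b k l)\<bar>)
        \<le> (\<Sum>k<N. 1 + 4 / b - partial_mass (real (Suc k) / b) - partial_mass (real (N - k) / b))"
    proof (rule sum_mono)
      fix k assume "k \<in> {..<N}"
      then have k: "k < N" by simp
      show "\<bar>1 - (\<Sum>l<N. band_profile b k l)\<bar> \<le> 1 + 4 / b - partial_mass (real (Suc k) / b) - partial_mass (real (N - k) / b)"
        using row_le[OF b k] row_ge[OF b k] partial_mass_le[of "real (Suc k) / b"] partial_mass_le[of "real (N - k) / b"] b
        by (simp add: abs_le_iff) (smt (verit) add_divide_distrib divide_nonneg_pos)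
    qed
    also have "\<dots> = real N * (1 + 4 / b) - 2 * (\<Sum>q<N. partial_mass (real (Suc q) / b))"
      by (simp only: sum_subtractf refl sum_constant card_lessThan)
    also have "\<dots> \<le> real N * (1 + 4 / b) - 2 * (real N / 2 - \<epsilon> * real N / 2 - L * b / 2)"
      using half by simp
    also have "\<dots> = real N * (\<epsilon> + L * b / real N + 4 / b)"
      using N by (simp add: field_simps)
    finally show "(\<Sum>k<N. \<bar>1 - (\<Sum>l<N. band_profile b k l)\<bar>) / real N \<le> \<epsilon> + L * b / real N + 4 / b"
      using N by (simp add: pos_divide_le_eq mult.commute)
  qed
qed

end

section \<open>The semicircle law and its Stieltjes transform\<close>

lemma sqrt_one_minus_ratio: "sqrt (1 - (x / a)\<^sup>2) = sqrt (a\<^sup>2 - x\<^sup>2) / a" if "0 < a" for a x :: real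
proof -
  have "1 - (x / a)\<^sup>2 = (a\<^sup>2 - x\<^sup>2) / a\<^sup>2" using that by (simp add: power_divide diff_divide_distrib)
  then show ?thesis using that by (simp add: real_sqrt_divide)
qed

lemma has_integral_semicircle:
  fixes a :: real assumes a: "0 < a"
  shows "((\<lambda>x. sqrt (a\<^sup>2 - x\<^sup>2)) has_integral pi * a\<^sup>2 / 2) {-a..a}"
proof -
  let ?F = "\<lambda>x. (x * sqrt (a\<^sup>2 - x\<^sup>2) + a\<^sup>2 * arcsin (x / a)) / 2"
  have "((\<lambda>x. sqrt (a\<^sup>2 - x\<^sup>2)) has_integral ?F a - ?F (-a)) {-a..a}"
  proof (rule fundamental_theorem_of_calculus_interior)
    show "continuous_on {-a..a} ?F"
      using a by (intro continuous_intros) (auto simp: field_simps)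
    fix x assume x: "x \<in> {-a<..<a}"
    then have pos: "0 < a\<^sup>2 - x\<^sup>2" using power_strict_mono[of "\<bar>x\<bar>" a 2] by auto
    have ratio: "sqrt (1 - (x / a)\<^sup>2) = sqrt (a\<^sup>2 - x\<^sup>2) / a"
      by (rule sqrt_one_minus_ratio[OF a])
    have "(?F has_real_derivative (sqrt (a\<^sup>2 - x\<^sup>2) + x * (- x / sqrt (a\<^sup>2 - x\<^sup>2))
        + a\<^sup>2 * ((1 / a) / sqrt (1 - (x / a)\<^sup>2))) / 2) (at x)"
      using x a pos by (auto intro!: derivative_eq_intros simp: field_simps)
    also have "(sqrt (a\<^sup>2 - x\<^sup>2) + x * (- x / sqrt (a\<^sup>2 - x\<^sup>2)) + a\<^sup>2 * ((1 / a) / sqrt (1 - (x / a)\<^sup>2))) / 2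
        = sqrt (a\<^sup>2 - x\<^sup>2)"
    proof -
      define q where "q = sqrt (a\<^sup>2 - x\<^sup>2)"
      have q: "0 < q" "q * q = a\<^sup>2 - x\<^sup>2" using pos by (auto simp: q_def)
      have "(q + x * (- x / q) + a\<^sup>2 * ((1 / a) / (q / a))) / 2 = (q + (a\<^sup>2 - x\<^sup>2) / q) / 2"
        using a q(1) by (simp add: field_simps power2_eq_square)
      also have "\<dots> = q" using q by (simp add: field_simps flip: q(2))
      finally show ?thesis unfolding ratio q_def .
    qed
    finally show "(?F has_vector_derivative sqrt (a\<^sup>2 - x\<^sup>2)) (at x)"
      by (simp add: has_real_derivative_iff_has_vector_derivative)
  qed (use a in auto)
  then show ?thesis using a by (simp add: field_simps)
qed

text \<open>The antiderivative is \<open>r/\<eta> arcsin (r x / (a sqrt (x\<^sup>2 + \<eta>\<^sup>2))) - arcsin (x / a)\<close> with \<open>r = sqrt (a\<^sup>2 + \<eta>\<^sup>2)\<close>. The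
first term is an arctangent of \<open>r x / (\<eta> sqrt (a\<^sup>2 - x\<^sup>2))\<close>, written with the arcsine so that it is
continuous up to the end points.\<close>

lemma has_integral_semicircle_poisson:
  fixes a \<eta> :: real assumes a: "0 < a" and \<eta>: "0 < \<eta>"
  shows "((\<lambda>x. sqrt (a\<^sup>2 - x\<^sup>2) / (x\<^sup>2 + \<eta>\<^sup>2)) has_integral pi * (sqrt (a\<^sup>2 + \<eta>\<^sup>2) / \<eta> - 1)) {-a..a}"
proof -
  define r where "r = sqrt (a\<^sup>2 + \<eta>\<^sup>2)"
  have r: "0 < r" "r\<^sup>2 = a\<^sup>2 + \<eta>\<^sup>2" using a by (auto simp: r_def add_pos_nonneg)
  let ?g = "\<lambda>x. r * x / (a * sqrt (x\<^sup>2 + \<eta>\<^sup>2))"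
  let ?F = "\<lambda>x. r / \<eta> * arcsin (?g x) - arcsin (x / a)"
  have root: "0 < sqrt (x\<^sup>2 + \<eta>\<^sup>2)" for x using \<eta> by (simp add: add_nonneg_pos)
  have g2: "1 - (?g x)\<^sup>2 = \<eta>\<^sup>2 * (a\<^sup>2 - x\<^sup>2) / (a\<^sup>2 * (x\<^sup>2 + \<eta>\<^sup>2))" for x
  proof -
    define D where "D = x\<^sup>2 + \<eta>\<^sup>2"
    have D: "0 < D" using root[of x] by (simp add: D_def)
    have "(?g x)\<^sup>2 = r\<^sup>2 * x\<^sup>2 / (a\<^sup>2 * D)"
      using D by (simp add: power_divide power_mult_distrib D_def[symmetric])
    then have "1 - (?g x)\<^sup>2 = (a\<^sup>2 * D - r\<^sup>2 * x\<^sup>2) / (a\<^sup>2 * D)"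
      using a D by (simp add: diff_divide_distrib)
    also have "a\<^sup>2 * D - r\<^sup>2 * x\<^sup>2 = \<eta>\<^sup>2 * (a\<^sup>2 - x\<^sup>2)"
      unfolding r(2) D_def by (simp add: algebra_simps)
    finally show ?thesis by (simp add: D_def)
  qed
  have g_le: "- 1 \<le> ?g x \<and> ?g x \<le> 1" if "x \<in> {-a..a}" for x
  proof -
    have "x\<^sup>2 \<le> a\<^sup>2" using that by (auto simp: abs_le_square_iff[symmetric])
    then have "0 \<le> 1 - (?g x)\<^sup>2" unfolding g2 by (intro divide_nonneg_nonneg) auto
    then have "(?g x)\<^sup>2 \<le> 1" by simp
    then have "\<bar>?g x\<bar> \<le> 1" by (simp only: abs_square_le_1)
    then show ?thesis using abs_le_iff[of "?g x" 1] by simp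
  qed
  have "((\<lambda>x. sqrt (a\<^sup>2 - x\<^sup>2) / (x\<^sup>2 + \<eta>\<^sup>2)) has_integral ?F a - ?F (-a)) {-a..a}"
  proof (rule fundamental_theorem_of_calculus_interior)
    have "continuous_on {-a..a} ?g"
      using a root by (intro continuous_intros) (auto simp: less_imp_neq)
    then have 1: "continuous_on {-a..a} (\<lambda>x. arcsin (?g x))"
      by (rule continuous_on_arcsin) (use g_le in blast)
    have 2: "continuous_on {-a..a} (\<lambda>x. arcsin (x / a))"
      using a by (intro continuous_on_arcsin continuous_intros) (auto simp: field_simps)
    show "continuous_on {-a..a} ?F"
      by (rule continuous_on_diff[OF continuous_on_mult[OF continuous_on_const 1] 2])
    fix x assume x: "x \<in> {-a<..<a}"
    define p q where "p = sqrt (x\<^sup>2 + \<eta>\<^sup>2)" and "q = sqrt (a\<^sup>2 - x\<^sup>2)"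
    have pos: "0 < a\<^sup>2 - x\<^sup>2" using x power_strict_mono[of "\<bar>x\<bar>" a 2] by auto
    then have q: "0 < q" "q\<^sup>2 = a\<^sup>2 - x\<^sup>2" by (auto simp: q_def)
    have p: "0 < p" "p\<^sup>2 = x\<^sup>2 + \<eta>\<^sup>2" using root[of x] by (auto simp: p_def)
    have ratio: "sqrt (1 - (x / a)\<^sup>2) = q / a"
      unfolding q_def by (rule sqrt_one_minus_ratio[OF a])
    have g_ratio: "sqrt (1 - (?g x)\<^sup>2) = \<eta> * q / (a * p)"
      unfolding g2 p_def q_def using a \<eta> by (simp add: real_sqrt_divide real_sqrt_mult)
    have g_lt: "- 1 < ?g x" "?g x < 1"
    proof -
      have "0 < sqrt (1 - (?g x)\<^sup>2)" unfolding g_ratio using a \<eta> p q by simp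
      then have "(?g x)\<^sup>2 < 1" by simp
      then have "\<bar>?g x\<bar> < 1" by (simp only: abs_square_less_1)
      then show "- 1 < ?g x" "?g x < 1" unfolding abs_less_iff by simp_all
    qed
    have "(?g has_real_derivative r / a * (\<eta>\<^sup>2 / (p\<^sup>2 * p))) (at x)"
    proof -
      have "((\<lambda>x. sqrt (x\<^sup>2 + \<eta>\<^sup>2)) has_real_derivative x / p) (at x)"
        using root[of x] by (auto intro!: derivative_eq_intros simp: p_def field_simps)
      moreover have "a * sqrt (x\<^sup>2 + \<eta>\<^sup>2) \<noteq> 0" using a \<eta> by simp
      ultimately have "(?g has_real_derivative ((r * 1) * (a * sqrt (x\<^sup>2 + \<eta>\<^sup>2)) - (r * x) * (a * (x / p)))
          / ((a * sqrt (x\<^sup>2 + \<eta>\<^sup>2)) * (a * sqrt (x\<^sup>2 + \<eta>\<^sup>2)))) (at x)"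
        by (intro DERIV_divide DERIV_cmult DERIV_ident)
      then
      have "(?g has_real_derivative ((r * (a * p) - (r * x) * (a * (x / p))) / (a * p)\<^sup>2)) (at x)"
        by (simp add: p_def power2_eq_square)
      also have "(r * (a * p) - (r * x) * (a * (x / p))) / (a * p)\<^sup>2 = r / a * ((p\<^sup>2 - x\<^sup>2) / (p\<^sup>2 * p))"
        using a p(1) by (simp add: field_simps power2_eq_square)
      finally show ?thesis by (simp add: p(2))
    qed
    then have dg: "((\<lambda>x. arcsin (?g x)) has_real_derivative (1 / sqrt (1 - (?g x)\<^sup>2)) * (r / a * (\<eta>\<^sup>2 / (p\<^sup>2 * p)))) (at x)"
      using DERIV_chain2[where f=arcsin and g="?g", OF DERIV_arcsin[OF g_lt]] by (simp add: divide_inverse)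
    have da: "((\<lambda>x. arcsin (x / a)) has_real_derivative 1 / q) (at x)"
    proof -
      have "((\<lambda>x. arcsin (x / a)) has_real_derivative inverse (sqrt (1 - (x / a)\<^sup>2)) * (1 / a)) (at x)"
        using x a by (intro DERIV_chain2[OF DERIV_arcsin]) (auto intro!: derivative_eq_intros simp: field_simps)
      then show ?thesis unfolding ratio using a by simp
    qed
    have "(?F has_real_derivative r / \<eta> * ((1 / sqrt (1 - (?g x)\<^sup>2)) * (r / a * (\<eta>\<^sup>2 / (p\<^sup>2 * p)))) - 1 / q) (at x)"
      by (intro DERIV_diff DERIV_cmult dg da)
    also have "r / \<eta> * ((1 / sqrt (1 - (?g x)\<^sup>2)) * (r / a * (\<eta>\<^sup>2 / (p\<^sup>2 * p)))) - 1 / q = r\<^sup>2 / (p\<^sup>2 * q) - 1 / q"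
      unfolding g_ratio using a \<eta> p(1) q(1) by (simp add: field_simps power2_eq_square)
    also have "\<dots> = (r\<^sup>2 - p\<^sup>2) / (p\<^sup>2 * q)" using p(1) q(1) by (simp add: field_simps)
    also have "r\<^sup>2 - p\<^sup>2 = q * q" using r p q by (simp add: power2_eq_square)
    also have "q * q / (p\<^sup>2 * q) = q / p\<^sup>2" using q(1) by simp
    finally show "(?F has_vector_derivative sqrt (a\<^sup>2 - x\<^sup>2) / (x\<^sup>2 + \<eta>\<^sup>2)) (at x)"
      by (simp add: has_real_derivative_iff_has_vector_derivative p(2) q_def)
  qed (use a in auto)
  moreover have "?F a - ?F (-a) = pi * (sqrt (a\<^sup>2 + \<eta>\<^sup>2) / \<eta> - 1)"
  proof -
    have "?g a = 1" "?g (-a) = -1" using a r by (auto simp: r_def[symmetric])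
    then show ?thesis using a \<eta> by (simp add: r_def[symmetric] field_simps)
  qed
  ultimately show ?thesis by simp
qed

lemma semicircle_density_nonneg: "0 \<le> semicircle_density v x"
proof (cases "\<bar>x\<bar> \<le> 2 * v")
  case True
  then have "x\<^sup>2 \<le> (2 * v)\<^sup>2" by (metis abs_ge_zero power2_abs power_mono)
  then show ?thesis by (simp add: semicircle_density_def power_mult_distrib)
qed (simp add: semicircle_density_def)

text \<open>Passage from the gauge integral, for which the fundamental theorem of calculus holds on open intervals, to
the Lebesgue integral.\<close>

lemma semicircle_has_integral:
  assumes v: "0 < v" and f: "continuous_on UNIV f"
    and I: "((\<lambda>x. sqrt ((2 * v)\<^sup>2 - x\<^sup>2) * f x) has_integral c) {- (2 * v)..2 * v}"
  shows "has_bochner_integral lborel (\<lambda>x. semicircle_density v x * f x) (c / (2 * pi * v\<^sup>2))"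
proof -
  let ?g = "\<lambda>x. sqrt ((2 * v)\<^sup>2 - x\<^sup>2) * f x"
  have "set_integrable lborel {- (2 * v)..2 * v} ?g"
    by (rule borel_integrable_atLeastAtMost', intro continuous_intros continuous_on_subset[OF f]) auto
  then have int: "integrable lborel (\<lambda>x. indicator {- (2 * v)..2 * v} x * ?g x)"
    and val: "(\<integral>x. indicator {- (2 * v)..2 * v} x * ?g x \<partial>lborel) = c"
    using set_borel_integral_eq_integral(2)[of "{- (2 * v)..2 * v}" ?g] I
    by (auto simp: set_integrable_def set_lebesgue_integral_def integral_unique)
  have eq: "semicircle_density v x * f x = (indicator {- (2 * v)..2 * v} x * ?g x) / (2 * pi * v\<^sup>2)" for x
    by (auto simp: semicircle_density_def indicator_def abs_le_iff power_mult_distrib)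
  show ?thesis
    unfolding eq has_bochner_integral_iff using int val by simp
qed

lemma semicircle_total:
  assumes "0 < v"
  shows "has_bochner_integral lborel (semicircle_density v) 1"
  using semicircle_has_integral[OF assms continuous_on_const[of UNIV 1], of "pi * (2 * v)\<^sup>2 / 2"]
    has_integral_semicircle[of "2 * v"] assms by (simp add: power_mult_distrib field_simps)

text \<open>The value at \<open>i \<eta>\<close>; it is purely imaginary because the semicircle law is symmetric.\<close>

definition semicircle_stieltjes :: "real \<Rightarrow> real \<Rightarrow> complex" where
  "semicircle_stieltjes v \<eta> = \<i> * of_real ((sqrt (4 * v\<^sup>2 + \<eta>\<^sup>2) - \<eta>) / (2 * v\<^sup>2))"

lemma semicircle_stieltjes_quadratic:
  assumes "0 < v"
  shows "v\<^sup>2 * (semicircle_stieltjes v \<eta>)\<^sup>2 + \<i> * \<eta> * semicircle_stieltjes v \<eta> + 1 = 0"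
proof -
  define r where "r = sqrt (4 * v\<^sup>2 + \<eta>\<^sup>2)"
  have r: "r\<^sup>2 = 4 * v\<^sup>2 + \<eta>\<^sup>2" by (simp add: r_def)
  have "v\<^sup>2 * ((r - \<eta>) / (2 * v\<^sup>2))\<^sup>2 + \<eta> * ((r - \<eta>) / (2 * v\<^sup>2)) = (r\<^sup>2 - \<eta>\<^sup>2) / (4 * v\<^sup>2)"
    using assms by (simp add: field_simps power2_eq_square)
  also have "\<dots> = 1" using assms by (simp add: r)
  finally have "v\<^sup>2 * ((r - \<eta>) / (2 * v\<^sup>2))\<^sup>2 + \<eta> * ((r - \<eta>) / (2 * v\<^sup>2)) = 1" .
  moreover define y where "y = (r - \<eta>) / (2 * v\<^sup>2)"
  ultimately have y: "v\<^sup>2 * y\<^sup>2 + \<eta> * y = 1" by simp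
  have "v\<^sup>2 * (\<i> * complex_of_real y)\<^sup>2 + \<i> * \<eta> * (\<i> * complex_of_real y) + 1
      = 1 - complex_of_real (v\<^sup>2 * y\<^sup>2 + \<eta> * y)"
    by (simp add: complex_eq_iff power2_eq_square)
  also have "\<dots> = 0" unfolding y by simp
  finally show ?thesis unfolding semicircle_stieltjes_def y_def r_def by simp
qed

lemma semicircle_stieltjes_le:
  assumes "0 < v" "0 < \<eta>"
  shows "cmod (semicircle_stieltjes v \<eta>) \<le> 1 / \<eta>"
proof -
  define r where "r = sqrt (4 * v\<^sup>2 + \<eta>\<^sup>2)"
  have "\<eta> \<le> r" unfolding r_def by (intro real_le_rsqrt) auto
  have "r \<le> \<eta> + 2 * v\<^sup>2 / \<eta>"
    unfolding r_def
  proof (rule real_le_lsqrt)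
    show "4 * v\<^sup>2 + \<eta>\<^sup>2 \<le> (\<eta> + 2 * v\<^sup>2 / \<eta>)\<^sup>2"
      using assms by (simp add: power2_sum)
  qed (use assms in auto)
  then have "(r - \<eta>) / (2 * v\<^sup>2) \<le> (2 * v\<^sup>2 / \<eta>) / (2 * v\<^sup>2)"
    by (intro divide_right_mono) auto
  then have "(r - \<eta>) / (2 * v\<^sup>2) \<le> 1 / \<eta>" using assms by simp
  then show ?thesis
    using \<open>\<eta> \<le> r\<close> unfolding semicircle_stieltjes_def r_def[symmetric] norm_mult norm_of_real by simp
qed

text \<open>The real part \<open>x / (x\<^sup>2 + \<eta>\<^sup>2)\<close> of the integrand is odd, and the imaginary part is the Poisson integral.\<close>

lemma semicircle_integral_resolvent:
  assumes v: "0 < v" and \<eta>: "0 < \<eta>"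
  shows "(\<integral>x. semicircle_density v x *\<^sub>R (1 / (of_real x - \<i> * of_real \<eta>)) \<partial>lborel) = semicircle_stieltjes v \<eta>"
proof -
  let ?\<rho> = "semicircle_density v"
  have nz: "x\<^sup>2 + \<eta>\<^sup>2 \<noteq> 0" for x using \<eta> by (simp add: sum_power2_eq_zero_iff)
  have poisson: "has_bochner_integral lborel (\<lambda>x. ?\<rho> x * (1 / (x\<^sup>2 + \<eta>\<^sup>2)))
      (pi * (sqrt ((2 * v)\<^sup>2 + \<eta>\<^sup>2) / \<eta> - 1) / (2 * pi * v\<^sup>2))"
    using has_integral_semicircle_poisson[of "2 * v" \<eta>] v \<eta> nz
    by (intro semicircle_has_integral) (auto intro!: continuous_intros)
  have odd_int: "integrable lborel (\<lambda>x. ?\<rho> x * (x / (x\<^sup>2 + \<eta>\<^sup>2)))"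
  proof -
    have c: "continuous_on A (\<lambda>x. x / (x\<^sup>2 + \<eta>\<^sup>2))" for A using nz by (intro continuous_intros) auto
    have "(\<lambda>x. sqrt ((2 * v)\<^sup>2 - x\<^sup>2) * (x / (x\<^sup>2 + \<eta>\<^sup>2))) integrable_on {- (2 * v)..2 * v}"
      by (intro integrable_continuous_real continuous_on_mult c) (intro continuous_intros)
    from semicircle_has_integral[OF v c integrable_integral[OF this]]
    show ?thesis by (simp add: has_bochner_integral_iff)
  qed
  have even: "?\<rho> (- x) = ?\<rho> x" for x by (simp add: semicircle_density_def)
  have odd: "(\<integral>x. ?\<rho> x * (x / (x\<^sup>2 + \<eta>\<^sup>2)) \<partial>lborel) = 0"
  proof -
    have "(\<integral>x. ?\<rho> x * (x / (x\<^sup>2 + \<eta>\<^sup>2)) \<partial>lborel) = (\<integral>x. - (?\<rho> x * (x / (x\<^sup>2 + \<eta>\<^sup>2))) \<partial>lborel)"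
      by (subst lborel_integral_real_affine[where c="-1" and t=0]) (simp_all add: even)
    then show ?thesis by simp
  qed
  have split: "?\<rho> x *\<^sub>R (1 / (of_real x - \<i> * of_real \<eta>))
      = of_real (?\<rho> x * (x / (x\<^sup>2 + \<eta>\<^sup>2))) + \<i> * of_real (\<eta> * (?\<rho> x * (1 / (x\<^sup>2 + \<eta>\<^sup>2))))" for x
  proof -
    let ?a = "of_real x - \<i> * of_real \<eta>" and ?b = "of_real x + \<i> * of_real \<eta>"
    have "?b \<noteq> 0" using \<eta> by (auto simp: complex_eq_iff)
    then have "1 / ?a = ?b / (?a * ?b)" by simp
    also have "?a * ?b = of_real (x\<^sup>2 + \<eta>\<^sup>2)" by (simp add: complex_eq_iff power2_eq_square)
    finally show ?thesis by (simp add: scaleR_conv_of_real add_divide_distrib distrib_left mult_ac)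
  qed
  have "(\<integral>x. ?\<rho> x *\<^sub>R (1 / (of_real x - \<i> * of_real \<eta>)) \<partial>lborel)
      = complex_of_real (\<integral>x. ?\<rho> x * (x / (x\<^sup>2 + \<eta>\<^sup>2)) \<partial>lborel)
        + \<i> * complex_of_real (\<integral>x. \<eta> * (?\<rho> x * (1 / (x\<^sup>2 + \<eta>\<^sup>2))) \<partial>lborel)"
  proof -
    have 1: "integrable lborel (\<lambda>x. complex_of_real (?\<rho> x * (x / (x\<^sup>2 + \<eta>\<^sup>2))))"
      by (rule integrable_of_real[OF odd_int])
    have "integrable lborel (\<lambda>x. \<eta> * (?\<rho> x * (1 / (x\<^sup>2 + \<eta>\<^sup>2))))"
      using poisson by (intro integrable_mult_right) (auto simp: has_bochner_integral_iff)
    from integrable_mult_right[OF integrable_of_real[OF this]]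
    have 2: "integrable lborel (\<lambda>x. \<i> * complex_of_real (\<eta> * (?\<rho> x * (1 / (x\<^sup>2 + \<eta>\<^sup>2)))))" .
    show ?thesis
      unfolding split Bochner_Integration.integral_add[OF 1 2]
      by (simp only: integral_mult_right_zero integral_complex_of_real)
  qed
  also have "\<dots> = \<i> * complex_of_real (\<eta> * (pi * (sqrt ((2 * v)\<^sup>2 + \<eta>\<^sup>2) / \<eta> - 1) / (2 * pi * v\<^sup>2)))"
    using poisson unfolding odd by (simp only: has_bochner_integral_iff integral_mult_right_zero) simp
  also have "\<eta> * (pi * (sqrt ((2 * v)\<^sup>2 + \<eta>\<^sup>2) / \<eta> - 1) / (2 * pi * v\<^sup>2)) = (sqrt (4 * v\<^sup>2 + \<eta>\<^sup>2) - \<eta>) / (2 * v\<^sup>2)"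
    using v \<eta> by (simp add: power_mult_distrib field_simps)
  finally show ?thesis unfolding semicircle_stieltjes_def .
qed

section \<open>Test functions generated by resolvents\<close>

text \<open>The spectral parameters at which the trace of the resolvent is known to converge.\<close>

definition far_imaginary :: "real \<Rightarrow> complex set" where
  "far_imaginary c = {z. Re z = 0 \<and> c \<le> \<bar>Im z\<bar>}"

text \<open>The closed linear span of the constants and the resolvents, in the supremum norm. The inductive form lets
properties stable under sums, multiples and uniform limits be transferred by rule induction.\<close>

inductive resolvent_closure :: "real \<Rightarrow> (real \<Rightarrow> complex) \<Rightarrow> bool" for c where
  const: "resolvent_closure c (\<lambda>_. a)"
| res: "z \<in> far_imaginary c \<Longrightarrow> resolvent_closure c (\<lambda>x. 1 / (of_real x - z))"
| add: "resolvent_closure c f \<Longrightarrow> resolvent_closure c g \<Longrightarrow> resolvent_closure c (\<lambda>x. f x + g x)"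
| scale: "resolvent_closure c f \<Longrightarrow> resolvent_closure c (\<lambda>x. a * f x)"
| limit: "\<forall>e>0. \<exists>g. resolvent_closure c g \<and> (\<forall>x. cmod (f x - g x) \<le> e) \<Longrightarrow> resolvent_closure c f"

lemma far_imaginary_distance:
  assumes "z \<in> far_imaginary c"
  shows "c \<le> cmod (of_real x - z)"
  using assms abs_Im_le_cmod[of "of_real x - z"] by (auto simp: far_imaginary_def)

lemma inverse_resolvent_le:
  assumes "0 < c" "z \<in> far_imaginary c"
  shows "cmod (1 / (of_real x - z)) \<le> 1 / c" "of_real x - z \<noteq> 0"
proof -
  have "0 < cmod (of_real x - z)" using far_imaginary_distance[OF assms(2), of x] assms(1) by linarith
  then show "of_real x - z \<noteq> 0" using zero_less_norm_iff[of "of_real x - z"] by blast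
  have "1 / cmod (of_real x - z) \<le> 1 / c"
    by (rule divide_left_mono[OF far_imaginary_distance[OF assms(2)]]) (use assms(1) \<open>0 < cmod _\<close> in simp_all)
  then show "cmod (1 / (of_real x - z)) \<le> 1 / c" by (simp only: norm_divide norm_one)
qed

lemma resolvent_closure_bounded:
  assumes "resolvent_closure c f" "0 < c"
  shows "\<exists>B. \<forall>x. cmod (f x) \<le> B"
  using assms
proof induction
  case (res z)
  then show ?case using inverse_resolvent_le by blast
next
  case (add f g)
  then obtain A B where "\<forall>x. cmod (f x) \<le> A" "\<forall>x. cmod (g x) \<le> B" by blast
  then have "\<forall>x. cmod (f x + g x) \<le> A + B" by (meson add_mono norm_triangle_ineq order_trans)
  then show ?case by blast
next
  case (scale f a)
  then obtain B where "\<forall>x. cmod (f x) \<le> B" by blast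
  then have "\<forall>x. cmod (a * f x) \<le> cmod a * B" by (simp add: norm_mult mult_left_mono)
  then show ?case by blast
next
  case (limit f)
  from limit(1)[rule_format, of 1] limit(2) obtain g B
    where g: "\<forall>x. cmod (f x - g x) \<le> 1" "\<forall>x. cmod (g x) \<le> B" by auto
  have "cmod (f x) \<le> 1 + B" for x
    using norm_triangle_ineq[of "f x - g x" "g x"] g(1)[rule_format, of x] g(2)[rule_format, of x] by simp
  then show ?case by blast
qed auto

text \<open>For distinct poles this is a partial fraction decomposition. A double pole is the limit of pairs of distinct
poles, and multiplication by a resolvent is continuous in the supremum norm.\<close>

lemma resolvent_closure_mult_resolvent:
  assumes "resolvent_closure c f" "0 < c" and w: "w \<in> far_imaginary c"
  shows "resolvent_closure c (\<lambda>x. f x * (1 / (of_real x - w)))"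
  using assms
proof induction
  case (const a)
  then show ?case by (intro resolvent_closure.scale resolvent_closure.res)
next
  case (res z)
  have distinct: "resolvent_closure c (\<lambda>x. 1 / (of_real x - z') * (1 / (of_real x - w)))"
    if z': "z' \<in> far_imaginary c" "z' \<noteq> w" for z'
  proof -
    have "1 / (of_real x - z') * (1 / (of_real x - w))
        = (1 / (z' - w)) * (1 / (of_real x - z')) + (- 1 / (z' - w)) * (1 / (of_real x - w))" for x
      using inverse_resolvent_le(2)[OF \<open>0 < c\<close> z'(1), of x] inverse_resolvent_le(2)[OF \<open>0 < c\<close> w, of x] z'(2)
      by (simp add: divide_simps)
    then show ?thesis
      using resolvent_closure.add[OF resolvent_closure.scale[OF resolvent_closure.res[OF z'(1)]]
          resolvent_closure.scale[OF resolvent_closure.res[OF w]]] by presburger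
  qed
  show ?case
  proof (cases "z = w")
    case True
    \<comment> \<open>the square of a resolvent is the limit of products with a moving second pole\<close>
    show ?thesis
    proof (rule resolvent_closure.limit, intro allI impI)
      fix e :: real assume e: "0 < e"
      have w0: "0 < cmod w" using w \<open>0 < c\<close> by (auto simp: far_imaginary_def)
      \<comment> \<open>moving the pole by \<open>\<delta> w\<close> changes the product by at most \<open>\<delta> \<bar>w\<bar> / c\<^sup>3\<close>\<close>
      define \<delta> where "\<delta> = e * c ^ 3 / cmod w"
      have \<delta>: "0 < \<delta>" using e \<open>0 < c\<close> w0 by (simp add: \<delta>_def)
      define z' where "z' = (1 + of_real \<delta>) * w"
      have Im: "Im z' = (1 + \<delta>) * Im w" "Re z' = 0" using w by (auto simp: z'_def far_imaginary_def)
      have "\<bar>Im w\<bar> \<le> \<bar>Im z'\<bar>" unfolding Im using \<delta> by (simp add: abs_mult mult_le_cancel_right1)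
      then have z': "z' \<in> far_imaginary c" "z' \<noteq> w"
        using w Im \<delta> w0 by (auto simp: far_imaginary_def z'_def distrib_right)
      have "cmod (1 / (of_real x - z) * (1 / (of_real x - w)) - 1 / (of_real x - z') * (1 / (of_real x - w))) \<le> e" for x
      proof -
        have "1 / (of_real x - z) * (1 / (of_real x - w)) - 1 / (of_real x - z') * (1 / (of_real x - w))
            = (w - z') * (1 / (of_real x - w) * (1 / (of_real x - w)) * (1 / (of_real x - z')))"
          using inverse_resolvent_le(2)[OF \<open>0 < c\<close> z'(1), of x] inverse_resolvent_le(2)[OF \<open>0 < c\<close> w, of x]
          unfolding True by (simp add: divide_simps)
        also have "cmod \<dots> \<le> (\<delta> * cmod w) * (1 / c * (1 / c) * (1 / c))"
          unfolding norm_mult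
          using inverse_resolvent_le(1)[OF \<open>0 < c\<close> z'(1), of x] inverse_resolvent_le(1)[OF \<open>0 < c\<close> w, of x] \<open>0 < c\<close> \<delta>
          by (intro mult_mono) (auto simp: z'_def distrib_right norm_mult)
        also have "\<dots> = e" using w0 \<open>0 < c\<close> by (simp add: \<delta>_def power3_eq_cube)
        finally show ?thesis .
      qed
      then show "\<exists>g. resolvent_closure c g \<and> (\<forall>x. cmod (1 / (of_real x - z) * (1 / (of_real x - w)) - g x) \<le> e)"
        using distinct[OF z'] by blast
    qed
  qed (rule distinct[OF res(1)])
next
  case (add f g)
  have "(\<lambda>x. (f x + g x) * (1 / (of_real x - w)))
      = (\<lambda>x. f x * (1 / (of_real x - w)) + g x * (1 / (of_real x - w)))" by (simp only: distrib_right)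
  then show ?case using add by (simp only: resolvent_closure.add)
next
  case (scale f a)
  have "(\<lambda>x. a * f x * (1 / (of_real x - w))) = (\<lambda>x. a * (f x * (1 / (of_real x - w))))" by (simp only: mult.assoc)
  then show ?case using scale by (simp only: resolvent_closure.scale)
next
  case (limit f)
  show ?case
  proof (rule resolvent_closure.limit, intro allI impI)
    fix e :: real assume "0 < e"
    then have ec: "0 < e * c" using \<open>0 < c\<close> by simp
    with limit obtain g where g: "resolvent_closure c (\<lambda>x. g x * (1 / (of_real x - w)))" "\<forall>x. cmod (f x - g x) \<le> e * c"
      by blast
    have "cmod (f x * (1 / (of_real x - w)) - g x * (1 / (of_real x - w))) \<le> e" for x
    proof -
      have "cmod (f x * (1 / (of_real x - w)) - g x * (1 / (of_real x - w))) = cmod (f x - g x) * cmod (1 / (of_real x - w))"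
        by (simp only: left_diff_distrib[symmetric] norm_mult)
      also have "\<dots> \<le> (e * c) * (1 / c)"
        using g(2) inverse_resolvent_le(1)[OF \<open>0 < c\<close> w] ec by (intro mult_mono) auto
      finally show ?thesis using \<open>0 < c\<close> by simp
    qed
    with g(1) show "\<exists>h. resolvent_closure c h \<and> (\<forall>x. cmod (f x * (1 / (of_real x - w)) - h x) \<le> e)" by blast
  qed
qed

lemma resolvent_closure_mult:
  assumes "resolvent_closure c f" "resolvent_closure c g" "0 < c"
  shows "resolvent_closure c (\<lambda>x. f x * g x)"
  using assms
proof induction
  case (const a)
  then show ?case by (intro resolvent_closure.scale)
next
  case (res z)
  then show ?case using resolvent_closure_mult_resolvent[of c g z] by (simp only: mult.commute)
next
  case (add f1 f2)
  then show ?case by (simp only: distrib_right resolvent_closure.add)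
next
  case (scale f a)
  then show ?case by (simp only: mult.assoc resolvent_closure.scale)
next
  case (limit f)
  obtain B0 where B0: "\<forall>x. cmod (g x) \<le> B0" using resolvent_closure_bounded limit by blast
  define B where "B = max B0 1"
  have B: "\<forall>x. cmod (g x) \<le> B" "0 < B" using B0 by (auto simp: B_def le_max_iff_disj)
  show ?case
  proof (rule resolvent_closure.limit, intro allI impI)
    fix e :: real assume "0 < e"
    then have eB: "0 < e / B" using B by simp
    with limit obtain h where h: "resolvent_closure c (\<lambda>x. h x * g x)" "\<forall>x. cmod (f x - h x) \<le> e / B" by blast
    have "cmod (f x * g x - h x * g x) \<le> e" for x
    proof -
      have "cmod (f x * g x - h x * g x) = cmod (f x - h x) * cmod (g x)"
        by (simp only: left_diff_distrib[symmetric] norm_mult)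
      also have "\<dots> \<le> (e / B) * B" using h(2) B eB by (intro mult_mono) auto
      finally show ?thesis using B by simp
    qed
    with h(1) show "\<exists>k. resolvent_closure c k \<and> (\<forall>x. cmod (f x * g x - k x) \<le> e)" by blast
  qed
qed

text \<open>The conjugate of \<open>1/(x - i c)\<close> is the resolvent at \<open>- i c\<close>, so real and imaginary parts are combinations of
resolvents; products are covered by \<open>resolvent_closure_mult\<close>.\<close>

lemma resolvent_closure_polynomial:
  assumes "real_polynomial_function p" and c: "0 < c"
  shows "resolvent_closure c (\<lambda>x. of_real (p (1 / (of_real x - \<i> * of_real c))))"
  using assms(1)
proof induction
  case (linear f)
  interpret bounded_linear f by fact
  let ?u = "\<lambda>x::real. 1 / (complex_of_real x - \<i> * of_real c)"
  let ?u' = "\<lambda>x::real. 1 / (complex_of_real x - (- \<i> * of_real c))"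
  have cnj: "cnj (?u x) = ?u' x" for x by simp
  have eq: "of_real (f (?u x)) = of_real (f 1) * (1 / 2) * (?u x + ?u' x) + of_real (f \<i>) * (- \<i> / 2) * (?u x + (-1) * ?u' x)" for x
  proof -
    have "?u x = Re (?u x) *\<^sub>R 1 + Im (?u x) *\<^sub>R \<i>" by (simp add: complex_eq_iff)
    then have "f (?u x) = Re (?u x) * f 1 + Im (?u x) * f \<i>"
      by (metis add scale real_scaleR_def)
    moreover have "complex_of_real (Re U * p + Im U * q)
        = of_real p * (1 / 2) * (U + cnj U) + of_real q * (- \<i> / 2) * (U + (-1) * cnj U)" for U p q
      by (simp add: complex_eq_iff)
    ultimately show ?thesis unfolding cnj[symmetric] by metis
  qed
  have mem: "\<i> * complex_of_real c \<in> far_imaginary c" "- \<i> * complex_of_real c \<in> far_imaginary c"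
    using c by (auto simp: far_imaginary_def)
  show ?case unfolding eq by (intro resolvent_closure.add resolvent_closure.scale resolvent_closure.res mem)
next
  case (const a)
  show ?case by (rule resolvent_closure.const)
next
  case (add f g)
  then show ?case by (simp only: of_real_add resolvent_closure.add)
next
  case (mult f g)
  then show ?case using resolvent_closure_mult c by (simp only: of_real_mult)
qed

text \<open>The map \<open>x \<mapsto> 1/(x - i c)\<close> sends the line to a circle without the point 0, with \<open>0\<close> in the role of infinity. A
function of compact support becomes a continuous function on the whole circle, which polynomials in the
coordinates approximate uniformly.\<close>

theorem resolvent_closure_compact_support:
  fixes h :: "real \<Rightarrow> real"
  assumes c: "0 < c" and h: "continuous_on UNIV h" and supp: "\<And>x. K \<le> \<bar>x\<bar> \<Longrightarrow> h x = 0"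
  shows "resolvent_closure c (\<lambda>x. of_real (h x))"
proof (rule resolvent_closure.limit, intro allI impI)
  fix e :: real assume e: "0 < e"
  let ?u = "\<lambda>x::real. 1 / (complex_of_real x - \<i> * of_real c)"
  \<comment> \<open>the image of the real line under the resolvent, completed by the point 0\<close>
  define C where "C = sphere (\<i> / (2 * of_real c)) (1 / (2 * c))"
  define F where "F u = (if u = 0 then 0 else h (Re (1 / u)))" for u :: complex
  have u_nz: "complex_of_real x - \<i> * of_real c \<noteq> 0" for x using c by (auto simp: complex_eq_iff)
  have C_iff: "u \<in> C \<longleftrightarrow> c * (cmod u)\<^sup>2 = Im u" for u
  proof -
    have "u \<in> C \<longleftrightarrow> (cmod (u - \<i> / (2 * of_real c)))\<^sup>2 = (1 / (2 * c))\<^sup>2"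
      using c by (auto simp: C_def dist_norm norm_minus_commute power2_eq_iff_nonneg)
    also have "(cmod (u - \<i> / (2 * of_real c)))\<^sup>2 = (cmod u)\<^sup>2 - Im u / c + (1 / (2 * c))\<^sup>2"
      by (simp add: cmod_power2 power2_diff)
    also have "(\<dots> = (1 / (2 * c))\<^sup>2) \<longleftrightarrow> c * (cmod u)\<^sup>2 = Im u" using c by (auto simp: field_simps)
    finally show ?thesis .
  qed
  have u_in: "?u x \<in> C" for x
  proof -
    have D: "(cmod (complex_of_real x - \<i> * of_real c))\<^sup>2 = x\<^sup>2 + c\<^sup>2" by (simp add: cmod_power2)
    have "0 < x\<^sup>2 + c\<^sup>2" using c by (simp add: add_nonneg_pos)
    then show ?thesis unfolding C_iff norm_divide power_divide D
      by (simp add: Im_divide)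
  qed
  have "continuous_on C F"
    unfolding continuous_on_eq_continuous_within
  proof
    fix u assume u: "u \<in> C"
    show "continuous (at u within C) F"
    proof (cases "u = 0")
      case False
      have "continuous_on (- {0}) (\<lambda>u. h (Re (1 / u)))"
        by (rule continuous_on_compose2[OF h]) (auto intro!: continuous_intros)
      then have "continuous (at u) (\<lambda>u. h (Re (1 / u)))"
        using False by (simp add: continuous_on_eq_continuous_at open_Compl)
      moreover have "eventually (\<lambda>w. h (Re (1 / w)) = F w) (nhds u)"
        using False by (intro eventually_nhds_in_open[THEN eventually_mono, of "- {0}"]) (auto simp: F_def open_Compl)
      ultimately have "continuous (at u) F" by (simp add: isCont_cong)
      then show ?thesis by (rule continuous_at_imp_continuous_at_within)
    next
      case True
      \<comment> \<open>within distance \<open>r\<close> of 0 the circle is the image of points with \<open>\<bar>x\<bar> > \<bar>K\<bar>\<close>\<close>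
      define r where "r = 1 / sqrt (K\<^sup>2 + c\<^sup>2)"
      have r: "0 < r" using c by (simp add: r_def add_nonneg_pos)
      have "F w = 0" if w: "w \<in> C" "cmod w < r" for w
      proof (cases "w = 0")
        case False
        have "Im (1 / w) = - Im w / (cmod w)\<^sup>2" by (simp add: Im_divide cmod_power2)
        also have "\<dots> = - c" using w(1) False by (simp add: C_iff[symmetric] field_simps) (simp add: C_iff)
        finally have im: "Im (1 / w) = - c" .
        have "sqrt (K\<^sup>2 + c\<^sup>2) < cmod (1 / w)"
        proof -
          have "1 / r < 1 / cmod w" using w(2) False r by (intro divide_strict_left_mono) auto
          then show ?thesis by (simp add: r_def norm_divide)
        qed
        then have "K\<^sup>2 + c\<^sup>2 < (cmod (1 / w))\<^sup>2" by (metis real_sqrt_less_iff real_sqrt_abs abs_norm_cancel)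
        then have "K\<^sup>2 < (Re (1 / w))\<^sup>2" unfolding cmod_power2 im by simp
        then have "\<bar>K\<bar> < \<bar>Re (1 / w)\<bar>" by (metis abs_le_square_iff not_le)
        then have "h (Re (1 / w)) = 0" by (intro supp) simp
        then show ?thesis by (simp add: F_def)
      qed (simp add: F_def)
      then have "eventually (\<lambda>w. F w = 0) (at u within C)"
        unfolding eventually_at using r True by (auto simp: dist_norm)
      moreover have "F u = 0" using True by (simp add: F_def)
      ultimately show ?thesis unfolding continuous_within by (simp add: tendsto_eventually)
    qed
  qed
  moreover have "compact C" unfolding C_def by simp
  ultimately obtain p where p: "real_polynomial_function p" "\<And>u. u \<in> C \<Longrightarrow> \<bar>F u - p u\<bar> < e"
    using Stone_Weierstrass_real_polynomial_function[of C F e] e by blast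
  have "F (?u x) = h x" for x
  proof -
    have "?u x \<noteq> 0" "1 / ?u x = of_real x - \<i> * of_real c" using u_nz[of x] by simp_all
    then show ?thesis unfolding F_def by (simp only: if_False) simp
  qed
  then have "cmod (of_real (h x) - of_real (p (?u x))) \<le> e" for x
    using p(2)[OF u_in[of x]] by (simp flip: of_real_diff)
  with resolvent_closure_polynomial[OF p(1) c]
  show "\<exists>g. resolvent_closure c g \<and> (\<forall>x. cmod (of_real (h x) - g x) \<le> e)" by blast
qed

section \<open>From resolvents to eigenvalue counts\<close>

lemma length_filter_eq_sum_list_indicator:
  "real (length (filter (\<lambda>r. r \<in> A) xs)) = (\<Sum>r\<leftarrow>xs. indicator A r)"
  by (induction xs) auto

text \<open>Random lists of real numbers whose normalized Stieltjes transform converges in mean, at all points \<open>i \<eta>\<close> far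
from the real axis, to that of the probability density \<open>\<rho>\<close>.\<close>

locale spectral_sample = prob_space M for M :: "'w measure" +
  fixes spec :: "nat \<Rightarrow> 'w \<Rightarrow> real list" and N :: "nat \<Rightarrow> nat" and \<rho> :: "real \<Rightarrow> real" and c :: real
  assumes len: "\<And>n \<omega>. length (spec n \<omega>) = N n" and N_pos: "\<And>n. 0 < N n" and c_pos: "0 < c"
    and density_nonneg: "\<And>x. 0 \<le> \<rho> x" and density_total: "has_bochner_integral lborel \<rho> 1"
    and stieltjes_measurable: "\<And>n \<eta>. c \<le> \<eta> \<Longrightarrow>
      (\<lambda>\<omega>. \<Sum>r\<leftarrow>spec n \<omega>. 1 / (complex_of_real r - \<i> * of_real \<eta>)) \<in> borel_measurable M"
    and stieltjes_tendsto: "\<And>\<eta>. c \<le> \<eta> \<Longrightarrow>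
      (\<lambda>n. expectation (\<lambda>\<omega>. cmod ((\<Sum>r\<leftarrow>spec n \<omega>. 1 / (complex_of_real r - \<i> * of_real \<eta>)) / N n
         - (\<integral>x. \<rho> x *\<^sub>R (1 / (complex_of_real x - \<i> * of_real \<eta>)) \<partial>lborel)))) \<longlonglongrightarrow> 0"
begin

definition avg :: "nat \<Rightarrow> (real \<Rightarrow> complex) \<Rightarrow> 'w \<Rightarrow> complex" where
  "avg n f \<omega> = (\<Sum>r\<leftarrow>spec n \<omega>. f r) / of_nat (N n)"

definition target :: "(real \<Rightarrow> complex) \<Rightarrow> complex" where
  "target f = (\<integral>x. \<rho> x *\<^sub>R f x \<partial>lborel)"

text \<open>Measurability is included because measurability of the counting function is itself obtained by
approximation with functions of this class.\<close>

definition mean_convergent :: "(real \<Rightarrow> complex) \<Rightarrow> bool" where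
  "mean_convergent f \<longleftrightarrow> f \<in> borel_measurable borel \<and> (\<exists>B. \<forall>x. cmod (f x) \<le> B) \<and>
     (\<forall>n. avg n f \<in> borel_measurable M) \<and>
     (\<lambda>n. expectation (\<lambda>\<omega>. cmod (avg n f \<omega> - target f))) \<longlonglongrightarrow> 0"

lemma density_integrable: "integrable lborel \<rho>" "(\<integral>x. \<rho> x \<partial>lborel) = 1"
  using density_total by (auto simp: has_bochner_integral_iff)

lemma density_measurable: "\<rho> \<in> borel_measurable borel"
  using density_integrable(1) by auto

lemma target_integrable:
  assumes "f \<in> borel_measurable borel" "\<And>x. cmod (f x) \<le> B"
  shows "integrable lborel (\<lambda>x. \<rho> x *\<^sub>R f x)"
proof (rule Bochner_Integration.integrable_bound[where f="\<lambda>x. B * \<rho> x"])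
  show "integrable lborel (\<lambda>x. B * \<rho> x)" using density_integrable by simp
  show "(\<lambda>x. \<rho> x *\<^sub>R f x) \<in> borel_measurable lborel" using assms density_measurable by simp
  have "norm (\<rho> x *\<^sub>R f x) \<le> norm (B * \<rho> x)" for x
    using mult_right_mono[OF assms(2)[of x] density_nonneg[of x]] density_nonneg[of x]
      order_trans[OF norm_ge_zero assms(2)[of x]] by (simp add: abs_mult mult.commute)
  then show "AE x in lborel. norm (\<rho> x *\<^sub>R f x) \<le> norm (B * \<rho> x)" by simp
qed

lemma avg_le:
  assumes "\<And>x. cmod (f x) \<le> B"
  shows "cmod (avg n f \<omega>) \<le> B"
proof -
  have "cmod (\<Sum>r\<leftarrow>xs. f r) \<le> real (length xs) * B" for xs
    by (induction xs) (auto simp: distrib_right intro: norm_triangle_le add_mono assms)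
  then show ?thesis
    using N_pos[of n] len[of n \<omega>] by (metis avg_def norm_divide norm_of_nat of_nat_0_less_iff pos_divide_le_eq mult.commute)
qed

lemma target_le:
  assumes f: "f \<in> borel_measurable borel" "\<And>x. cmod (f x) \<le> B"
  shows "cmod (target f) \<le> B"
proof -
  have "cmod (target f) \<le> (\<integral>x. norm (\<rho> x *\<^sub>R f x) \<partial>lborel)"
    unfolding target_def by (rule integral_norm_bound)
  also have "\<dots> \<le> (\<integral>x. \<rho> x * B \<partial>lborel)"
  proof (rule integral_mono)
    show "integrable lborel (\<lambda>x. norm (\<rho> x *\<^sub>R f x))" by (rule integrable_norm[OF target_integrable[OF f]])
    show "integrable lborel (\<lambda>x. \<rho> x * B)" using density_integrable by simp
    show "norm (\<rho> x *\<^sub>R f x) \<le> \<rho> x * B" for x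
      using f(2)[of x] density_nonneg[of x] by (simp add: mult_left_mono)
  qed
  also have "\<dots> = B" using density_integrable by simp
  finally show ?thesis .
qed

lemma avg_add: "avg n (\<lambda>x. f x + g x) \<omega> = avg n f \<omega> + avg n g \<omega>"
  by (simp add: avg_def sum_list_addf add_divide_distrib)

lemma avg_scale: "avg n (\<lambda>x. a * f x) \<omega> = a * avg n f \<omega>"
  by (simp add: avg_def sum_list_const_mult)

lemma avg_diff: "avg n (\<lambda>x. f x - g x) \<omega> = avg n f \<omega> - avg n g \<omega>"
  by (simp add: avg_def sum_list_subtractf diff_divide_distrib)

lemma deviation_integrable:
  assumes "avg n f \<in> borel_measurable M" "\<And>x. cmod (f x) \<le> B"
  shows "integrable M (\<lambda>\<omega>. cmod (avg n f \<omega> - b))"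
proof (rule integrable_const_bound[where B="B + cmod b"])
  show "(\<lambda>\<omega>. cmod (avg n f \<omega> - b)) \<in> borel_measurable M" using assms(1) by simp
  have "norm (cmod (avg n f \<omega> - b)) \<le> B + cmod b" for \<omega>
    using norm_triangle_ineq4[of "avg n f \<omega>" b] avg_le[where f=f and n=n and \<omega>=\<omega>, OF assms(2)] by simp
  then show "AE \<omega> in M. norm (cmod (avg n f \<omega> - b)) \<le> B + cmod b" by simp
qed

lemma mean_convergent_resolvent:
  assumes "z \<in> far_imaginary c"
  shows "mean_convergent (\<lambda>x. 1 / (of_real x - z))"
proof -
  have meas: "(\<lambda>x::real. 1 / (of_real x - w)) \<in> borel_measurable borel" for w :: complex by measurable
  define \<eta> where "\<eta> = \<bar>Im z\<bar>"
  have \<eta>: "c \<le> \<eta>" using assms by (simp add: far_imaginary_def \<eta>_def)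
  let ?f = "\<lambda>x::real. 1 / (complex_of_real x - \<i> * of_real \<eta>)"
  have up: "avg n ?f \<in> borel_measurable M" for n
    unfolding avg_def[abs_def] using stieltjes_measurable[OF \<eta>] by (intro borel_measurable_divide) auto
  have conv: "(\<lambda>n. expectation (\<lambda>\<omega>. cmod (avg n ?f \<omega> - target ?f))) \<longlonglongrightarrow> 0"
    using stieltjes_tendsto[OF \<eta>] by (simp add: avg_def target_def)
  have bound: "\<exists>B. \<forall>x. cmod (1 / (complex_of_real x - z)) \<le> B"
    using inverse_resolvent_le(1)[OF c_pos assms] by blast
  consider "z = \<i> * of_real \<eta>" | "z = cnj (\<i> * of_real \<eta>)"
    using assms by (cases "0 \<le> Im z") (auto simp: far_imaginary_def \<eta>_def complex_eq_iff)
  then show ?thesis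
  proof cases
    case 1
    then show ?thesis using meas up conv bound unfolding mean_convergent_def by blast
  next
    case 2
    have f: "(\<lambda>x. 1 / (of_real x - z)) = (\<lambda>x. cnj (?f x))" unfolding 2 by simp
    have avg: "avg n (\<lambda>x. 1 / (of_real x - z)) = (\<lambda>\<omega>. cnj (avg n ?f \<omega>))" for n
    proof
      fix \<omega>
      have "(\<Sum>r\<leftarrow>xs. cnj (?f r)) = cnj (\<Sum>r\<leftarrow>xs. ?f r)" for xs
        by (induction xs) (simp_all del: complex_cnj_divide)
      then show "avg n (\<lambda>x. 1 / (of_real x - z)) \<omega> = cnj (avg n ?f \<omega>)"
        unfolding f avg_def by simp
    qed
    have "target (\<lambda>x. 1 / (of_real x - z)) = (\<integral>x. cnj (\<rho> x *\<^sub>R ?f x) \<partial>lborel)"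
      unfolding target_def f by (simp only: complex_cnj_scaleR)
    also have "\<dots> = cnj (target ?f)" unfolding target_def by (rule Bochner_Integration.integral_cnj)
    finally have target: "target (\<lambda>x. 1 / (of_real x - z)) = cnj (target ?f)" .
    have "(\<lambda>\<omega>. cnj (avg n ?f \<omega>)) \<in> borel_measurable M" for n
      by (rule borel_measurable_continuous_on[OF _ up]) (auto intro: continuous_intros)
    moreover have "cmod (cnj (avg n ?f \<omega>) - cnj (target ?f)) = cmod (avg n ?f \<omega> - target ?f)" for n \<omega>
      by (metis complex_cnj_diff complex_mod_cnj)
    ultimately show ?thesis using meas conv bound unfolding mean_convergent_def avg target by simp
  qed
qed

lemma mean_convergent_const: "mean_convergent (\<lambda>_. a)"
proof -
  have "(\<Sum>r\<leftarrow>xs. a) = of_nat (length xs) * a" for xs :: "real list" by (induction xs) (auto simp: distrib_right)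
  then have "avg n (\<lambda>_. a) \<omega> = a" for n \<omega> using N_pos[of n] len[of n \<omega>] by (simp add: avg_def)
  moreover have "target (\<lambda>_. a) = a" unfolding target_def using density_integrable by simp
  ultimately show ?thesis unfolding mean_convergent_def by (auto simp: measurable_const cong: measurable_cong)
qed

lemma mean_convergent_add:
  assumes "mean_convergent f" "mean_convergent g"
  shows "mean_convergent (\<lambda>x. f x + g x)"
proof -
  obtain A B where A: "\<And>x. cmod (f x) \<le> A" and B: "\<And>x. cmod (g x) \<le> B"
    using assms unfolding mean_convergent_def by blast
  have m: "f \<in> borel_measurable borel" "g \<in> borel_measurable borel"
    "\<And>n. avg n f \<in> borel_measurable M" "\<And>n. avg n g \<in> borel_measurable M"
    using assms unfolding mean_convergent_def by auto
  have target: "target (\<lambda>x. f x + g x) = target f + target g"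
    unfolding target_def scaleR_add_right
    by (rule Bochner_Integration.integral_add[OF target_integrable[OF m(1) A] target_integrable[OF m(2) B]])
  have am: "avg n (\<lambda>x. f x + g x) \<in> borel_measurable M" for n
    unfolding avg_add[abs_def] using m by simp
  have bd: "cmod (f x + g x) \<le> A + B" for x by (rule norm_triangle_mono[OF A B])
  have le: "expectation (\<lambda>\<omega>. cmod (avg n (\<lambda>x. f x + g x) \<omega> - target (\<lambda>x. f x + g x)))
      \<le> expectation (\<lambda>\<omega>. cmod (avg n f \<omega> - target f)) + expectation (\<lambda>\<omega>. cmod (avg n g \<omega> - target g))" for n
  proof -
    note i = deviation_integrable[OF am bd] deviation_integrable[OF m(3) A] deviation_integrable[OF m(4) B]
    show ?thesis
      unfolding Bochner_Integration.integral_add[OF i(2,3), symmetric]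
    proof (rule integral_mono[OF i(1) Bochner_Integration.integrable_add[OF i(2,3)]])
      show "cmod (avg n (\<lambda>x. f x + g x) \<omega> - target (\<lambda>x. f x + g x))
          \<le> cmod (avg n f \<omega> - target f) + cmod (avg n g \<omega> - target g)" for \<omega>
        unfolding avg_add target by (metis add_diff_add norm_triangle_ineq)
    qed
  qed
  have "(\<lambda>n. expectation (\<lambda>\<omega>. cmod (avg n (\<lambda>x. f x + g x) \<omega> - target (\<lambda>x. f x + g x)))) \<longlonglongrightarrow> 0"
  proof (rule tendsto_sandwich[OF _ _ tendsto_const])
    show "(\<lambda>n. expectation (\<lambda>\<omega>. cmod (avg n f \<omega> - target f)) + expectation (\<lambda>\<omega>. cmod (avg n g \<omega> - target g))) \<longlonglongrightarrow> 0"
      by (rule tendsto_add_zero) (use assms mean_convergent_def in auto)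
  qed (use le in simp_all)
  moreover have "(\<lambda>x. f x + g x) \<in> borel_measurable borel" using m by simp
  ultimately show ?thesis unfolding mean_convergent_def using am bd by blast
qed

lemma mean_convergent_scale:
  assumes "mean_convergent f"
  shows "mean_convergent (\<lambda>x. a * f x)"
proof -
  obtain B where B: "\<And>x. cmod (f x) \<le> B" using assms unfolding mean_convergent_def by blast
  have target: "target (\<lambda>x. a * f x) = a * target f"
    unfolding target_def mult_scaleR_right[symmetric] by (rule integral_mult_right_zero)
  have "cmod (avg n (\<lambda>x. a * f x) \<omega> - target (\<lambda>x. a * f x)) = cmod a * cmod (avg n f \<omega> - target f)" for n \<omega>
    unfolding avg_scale target by (simp only: right_diff_distrib[symmetric] norm_mult)
  then have "expectation (\<lambda>\<omega>. cmod (avg n (\<lambda>x. a * f x) \<omega> - target (\<lambda>x. a * f x)))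
      = cmod a * expectation (\<lambda>\<omega>. cmod (avg n f \<omega> - target f))" for n
    by simp
  moreover have "(\<lambda>n. cmod a * expectation (\<lambda>\<omega>. cmod (avg n f \<omega> - target f))) \<longlonglongrightarrow> 0"
    using assms unfolding mean_convergent_def by (intro tendsto_mult_right_zero) auto
  moreover have "cmod (a * f x) \<le> cmod a * B" for x using B[of x] by (simp add: norm_mult mult_left_mono)
  moreover have "avg n (\<lambda>x. a * f x) \<in> borel_measurable M" for n
  proof -
    have "avg n f \<in> borel_measurable M" using assms unfolding mean_convergent_def by blast
    then show ?thesis unfolding avg_scale[abs_def] by simp
  qed
  moreover have "(\<lambda>x. a * f x) \<in> borel_measurable borel"
  proof -
    have "f \<in> borel_measurable borel" using assms unfolding mean_convergent_def by blast
    then show ?thesis by simp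
  qed
  ultimately show ?thesis unfolding mean_convergent_def by (simp only:) blast
qed

text \<open>Averages over the sample and integrals against \<open>\<rho>\<close> are both contractions for the supremum norm, so an
approximation within \<open>1/(k + 1)\<close> changes the deviation by at most twice that amount.\<close>

lemma mean_convergent_limit:
  assumes "\<And>e. 0 < e \<Longrightarrow> \<exists>g. mean_convergent g \<and> (\<forall>x. cmod (f x - g x) \<le> e)"
  shows "mean_convergent f"
proof -
  have "\<forall>k. \<exists>g. mean_convergent g \<and> (\<forall>x. cmod (f x - g x) \<le> 1 / real (Suc k))" using assms by simp
  then obtain g where g: "\<And>k. mean_convergent (g k)" "\<And>k x. cmod (f x - g k x) \<le> 1 / real (Suc k)" by metis
  have lim: "(\<lambda>k. 1 / real (Suc k)) \<longlonglongrightarrow> 0"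
    using LIMSEQ_inverse_real_of_nat by (simp add: inverse_eq_divide)
  have tend: "(\<lambda>k. u k) \<longlonglongrightarrow> l" if "\<And>k. cmod (l - u k) \<le> 1 / real (Suc k)" for u :: "nat \<Rightarrow> complex" and l
  proof (rule LIM_zero_cancel, rule Lim_null_comparison[OF _ lim])
    show "eventually (\<lambda>k. norm (u k - l) \<le> 1 / real (Suc k)) sequentially"
      using that by (simp add: norm_minus_commute)
  qed
  have f: "f \<in> borel_measurable borel"
  proof (rule borel_measurable_LIMSEQ_metric)
    show "g k \<in> borel_measurable borel" for k using g(1)[of k] unfolding mean_convergent_def by blast
    show "(\<lambda>k. g k x) \<longlonglongrightarrow> f x" for x by (rule tend[OF g(2)])
  qed
  obtain B0 where "\<And>x. cmod (g 0 x) \<le> B0" using g(1)[of 0] unfolding mean_convergent_def by blast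
  then have B: "cmod (f x) \<le> 1 + B0" for x
    using norm_triangle_mono[OF g(2)[of x 0] \<open>cmod (g 0 x) \<le> B0\<close>] by simp
  have close: "cmod (avg n f \<omega> - avg n (g k) \<omega>) \<le> 1 / real (Suc k)" for n k \<omega>
    unfolding avg_diff[symmetric] by (rule avg_le[OF g(2)])
  have am: "avg n f \<in> borel_measurable M" for n
  proof (rule borel_measurable_LIMSEQ_metric)
    show "avg n (g k) \<in> borel_measurable M" for k using g(1)[of k] unfolding mean_convergent_def by blast
    show "(\<lambda>k. avg n (g k) \<omega>) \<longlonglongrightarrow> avg n f \<omega>" for \<omega> by (rule tend[OF close])
  qed
  have target_close: "cmod (target f - target (g k)) \<le> 1 / real (Suc k)" for k
  proof -
    obtain Bk where Bk: "\<And>x. cmod (g k x) \<le> Bk" using g(1)[of k] unfolding mean_convergent_def by blast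
    have gm: "g k \<in> borel_measurable borel" using g(1)[of k] unfolding mean_convergent_def by simp
    have "target f - target (g k) = target (\<lambda>x. f x - g k x)"
      unfolding target_def scaleR_diff_right
      by (rule Bochner_Integration.integral_diff[symmetric, OF target_integrable[OF f B] target_integrable[OF gm Bk]])
    then show ?thesis using target_le[of "\<lambda>x. f x - g k x"] f gm g(2) by simp
  qed
  have bound: "expectation (\<lambda>\<omega>. cmod (avg n f \<omega> - target f))
      \<le> 2 / real (Suc k) + expectation (\<lambda>\<omega>. cmod (avg n (g k) \<omega> - target (g k)))" for n k
  proof -
    obtain Bk where Bk: "\<And>x. cmod (g k x) \<le> Bk" using g(1)[of k] unfolding mean_convergent_def by blast
    have gm: "avg n (g k) \<in> borel_measurable M" using g(1)[of k] unfolding mean_convergent_def by simp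
    have i: "integrable M (\<lambda>\<omega>. cmod (avg n (g k) \<omega> - target (g k)))" by (rule deviation_integrable[OF gm Bk])
    have "expectation (\<lambda>\<omega>. cmod (avg n f \<omega> - target f))
        \<le> expectation (\<lambda>\<omega>. 2 / real (Suc k) + cmod (avg n (g k) \<omega> - target (g k)))"
    proof (rule integral_mono)
      show "integrable M (\<lambda>\<omega>. cmod (avg n f \<omega> - target f))" by (rule deviation_integrable[OF am B])
      show "integrable M (\<lambda>\<omega>. 2 / real (Suc k) + cmod (avg n (g k) \<omega> - target (g k)))"
        by (rule Bochner_Integration.integrable_add[OF integrable_const i])
      fix \<omega>
      have "avg n f \<omega> - target f
          = (avg n f \<omega> - avg n (g k) \<omega>) + (avg n (g k) \<omega> - target (g k)) - (target f - target (g k))" by simp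
      also have "cmod \<dots> \<le> 1 / real (Suc k) + cmod (avg n (g k) \<omega> - target (g k)) + 1 / real (Suc k)"
        by (intro norm_triangle_le_diff add_mono norm_triangle_le close target_close order_refl)
      finally show "cmod (avg n f \<omega> - target f) \<le> 2 / real (Suc k) + cmod (avg n (g k) \<omega> - target (g k))"
        by (simp add: add_divide_distrib[symmetric])
    qed
    also have "\<dots> = 2 / real (Suc k) + expectation (\<lambda>\<omega>. cmod (avg n (g k) \<omega> - target (g k)))"
      by (subst Bochner_Integration.integral_add[OF integrable_const i]) (simp add: prob_space)
    finally show ?thesis .
  qed
  have "(\<lambda>n. expectation (\<lambda>\<omega>. cmod (avg n f \<omega> - target f))) \<longlonglongrightarrow> 0"
  proof (rule LIMSEQ_I)
    fix e :: real assume e: "0 < e"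
    obtain k where k: "2 / real (Suc k) < e / 2"
    proof -
      obtain k where "1 / real (Suc k) < e / 4" using e nat_approx_posE[of "e / 4"] by auto
      then show ?thesis using that[of k] by (simp add: field_simps)
    qed
    have "(\<lambda>n. expectation (\<lambda>\<omega>. cmod (avg n (g k) \<omega> - target (g k)))) \<longlonglongrightarrow> 0"
      using g(1)[of k] unfolding mean_convergent_def by simp
    from order_tendstoD(2)[OF this, of "e / 2"] e
    have "eventually (\<lambda>n. expectation (\<lambda>\<omega>. cmod (avg n (g k) \<omega> - target (g k))) < e / 2) sequentially" by simp
    then obtain n0 where n0: "\<And>n. n0 \<le> n \<Longrightarrow> expectation (\<lambda>\<omega>. cmod (avg n (g k) \<omega> - target (g k))) < e / 2"
      by (auto simp: eventually_sequentially)
    have "norm (expectation (\<lambda>\<omega>. cmod (avg n f \<omega> - target f)) - 0) < e" if "n0 \<le> n" for n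
    proof -
      have "0 \<le> expectation (\<lambda>\<omega>. cmod (avg n f \<omega> - target f))" by (intro integral_nonneg_AE) auto
      then show ?thesis using bound[of n k] n0[OF that] k by simp
    qed
    then show "\<exists>no. \<forall>n\<ge>no. norm (expectation (\<lambda>\<omega>. cmod (avg n f \<omega> - target f)) - 0) < e" by blast
  qed
  then show ?thesis unfolding mean_convergent_def using f B am by blast
qed

lemma mean_convergent_resolvent_closure: "resolvent_closure c f \<Longrightarrow> mean_convergent f"
proof (induction rule: resolvent_closure.induct)
  case (limit f)
  then show ?case by (intro mean_convergent_limit) blast
qed (intro mean_convergent_const mean_convergent_resolvent mean_convergent_add mean_convergent_scale; assumption)+

end

text \<open>Continuous functions of compact support that increase to the indicator of the open set where \<open>g\<close> is positive.\<close>

definition ramp :: "(real \<Rightarrow> real) \<Rightarrow> nat \<Rightarrow> real \<Rightarrow> real" where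
  "ramp g m x = max 0 (min 1 (min (real m - \<bar>x\<bar>) (real m * g x)))"

lemma ramp_bounds: "0 \<le> ramp g m x" "ramp g m x \<le> 1"
  by (auto simp: ramp_def)

lemma ramp_le_indicator: "ramp g m x \<le> indicator {x. 0 < g x} x"
proof (cases "0 < g x")
  case False
  then have "real m * g x \<le> 0" by (simp add: mult_nonneg_nonpos)
  then show ?thesis using False by (simp add: ramp_def)
qed (simp add: ramp_bounds)

lemma ramp_continuous: "continuous_on UNIV g \<Longrightarrow> continuous_on UNIV (ramp g m)"
  unfolding ramp_def by (intro continuous_intros)

lemma ramp_support: "real m \<le> \<bar>x\<bar> \<Longrightarrow> ramp g m x = 0"
  by (simp add: ramp_def)

lemma ramp_tendsto: "(\<lambda>m. ramp g m x) \<longlonglongrightarrow> indicator {x. 0 < g x} x"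
proof (cases "0 < g x")
  case True
  obtain m1 :: nat where m1: "1 + \<bar>x\<bar> \<le> real m1" using real_arch_simple by blast
  obtain m2 :: nat where m2: "1 / g x \<le> real m2" using real_arch_simple by blast
  have "ramp g m x = 1" if m: "max m1 m2 \<le> m" for m
  proof -
    have "1 \<le> real m - \<bar>x\<bar>" using m1 m by simp
    moreover have "1 / g x \<le> real m" using m2 m by (meson max.bounded_iff of_nat_le_iff order_trans)
    then have "1 \<le> real m * g x" using True by (simp add: pos_divide_le_eq)
    ultimately show ?thesis by (simp add: ramp_def)
  qed
  then have "eventually (\<lambda>m. ramp g m x = 1) sequentially" unfolding eventually_sequentially by blast
  then show ?thesis using True by (simp add: tendsto_eventually)
next
  case False
  have "ramp g m x = 0" for m
    using ramp_le_indicator[of g m x] ramp_bounds(1)[of g m x] False by simp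
  then show ?thesis using False by simp
qed

context spectral_sample
begin

definition fraction :: "real set \<Rightarrow> nat \<Rightarrow> 'w \<Rightarrow> real" where
  "fraction A n \<omega> = (\<Sum>r\<leftarrow>spec n \<omega>. indicator A r) / real (N n)"

definition mass :: "real set \<Rightarrow> real" where
  "mass A = (\<integral>x. \<rho> x * indicator A x \<partial>lborel)"

lemma real_avg: "avg n (\<lambda>x. of_real (h x)) \<omega> = of_real ((\<Sum>r\<leftarrow>spec n \<omega>. h r) / real (N n))"
proof -
  have "(\<Sum>r\<leftarrow>xs. complex_of_real (h r)) = of_real (\<Sum>r\<leftarrow>xs. h r)" for xs by (induction xs) auto
  then show ?thesis by (simp add: avg_def)
qed

lemma ramp_mean_convergent:
  fixes g :: "real \<Rightarrow> real"
  assumes "continuous_on UNIV g"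
  shows "mean_convergent (\<lambda>x. of_real (ramp g m x))"
  by (rule mean_convergent_resolvent_closure[OF resolvent_closure_compact_support[OF c_pos ramp_continuous[OF assms] ramp_support]])

definition ramp_average :: "(real \<Rightarrow> real) \<Rightarrow> nat \<Rightarrow> nat \<Rightarrow> 'w \<Rightarrow> real" where
  "ramp_average g m n \<omega> = (\<Sum>r\<leftarrow>spec n \<omega>. ramp g m r) / real (N n)"

lemma ramp_average_measurable:
  fixes g :: "real \<Rightarrow> real"
  assumes "continuous_on UNIV g"
  shows "ramp_average g m n \<in> borel_measurable M"
proof -
  have "avg n (\<lambda>x. of_real (ramp g m x)) \<in> borel_measurable M"
    using ramp_mean_convergent[OF assms] unfolding mean_convergent_def by blast
  then have "(\<lambda>\<omega>. complex_of_real (ramp_average g m n \<omega>)) \<in> borel_measurable M"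
    unfolding real_avg[abs_def] ramp_average_def .
  from measurable_compose[OF this borel_measurable_Re] show ?thesis by simp
qed

lemma sum_list_tendsto:
  fixes f :: "nat \<Rightarrow> real \<Rightarrow> real"
  assumes "\<And>x. (\<lambda>m. f m x) \<longlonglongrightarrow> l x"
  shows "(\<lambda>m. \<Sum>r\<leftarrow>xs. f m r) \<longlonglongrightarrow> (\<Sum>r\<leftarrow>xs. l r)"
  by (induction xs) (auto intro!: tendsto_add assms)

lemma fraction_measurable:
  fixes g :: "real \<Rightarrow> real"
  assumes "continuous_on UNIV g"
  shows "fraction {x. 0 < g x} n \<in> borel_measurable M"
proof (rule borel_measurable_LIMSEQ_metric)
  show "ramp_average g m n \<in> borel_measurable M" for m by (rule ramp_average_measurable[OF assms])
  show "(\<lambda>m. ramp_average g m n \<omega>) \<longlonglongrightarrow> fraction {x. 0 < g x} n \<omega>" for \<omega>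
    unfolding ramp_average_def fraction_def
    by (intro tendsto_divide sum_list_tendsto ramp_tendsto tendsto_const) (use N_pos[of n] in simp)
qed

lemma mass_ramp_tendsto:
  fixes g :: "real \<Rightarrow> real"
  assumes "continuous_on UNIV g"
  shows "(\<lambda>m. \<integral>x. \<rho> x * ramp g m x \<partial>lborel) \<longlonglongrightarrow> mass {x. 0 < g x}"
  unfolding mass_def
proof (rule integral_dominated_convergence[where w=\<rho>])
  have "{x. 0 < g x} \<in> sets borel"
    using open_Collect_less[OF continuous_on_const assms] by simp
  then show "(\<lambda>x. \<rho> x * indicator {x. 0 < g x} x) \<in> borel_measurable lborel"
    using density_measurable by simp
  have "ramp g m \<in> borel_measurable borel" for m
    by (rule borel_measurable_continuous_onI[OF ramp_continuous[OF assms]])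
  then show "(\<lambda>x. \<rho> x * ramp g m x) \<in> borel_measurable lborel" for m using density_measurable by simp
  show "integrable lborel \<rho>" by (rule density_integrable)
  show "AE x in lborel. (\<lambda>m. \<rho> x * ramp g m x) \<longlonglongrightarrow> \<rho> x * indicator {x. 0 < g x} x"
    by (intro AE_I2 tendsto_mult tendsto_const ramp_tendsto)
  show "AE x in lborel. norm (\<rho> x * ramp g m x) \<le> \<rho> x" for m
    using density_nonneg ramp_bounds by (auto simp: abs_mult intro!: mult_left_le)
qed

text \<open>A ramp below the indicator whose integral is within \<open>\<epsilon>/2\<close> of the mass of the open set; by Markov's inequality
its average is close to its integral.\<close>

lemma fraction_lower_bound:
  fixes g :: "real \<Rightarrow> real"
  assumes g: "continuous_on UNIV g" and \<epsilon>: "0 < \<epsilon>"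
  shows "(\<lambda>n. prob {\<omega> \<in> space M. fraction {x. 0 < g x} n \<omega> \<le> mass {x. 0 < g x} - \<epsilon>}) \<longlonglongrightarrow> 0"
proof -
  let ?U = "{x. 0 < g x}"
  have "eventually (\<lambda>m. mass ?U - \<epsilon> / 2 < (\<integral>x. \<rho> x * ramp g m x \<partial>lborel)) sequentially"
    using order_tendstoD(1)[OF mass_ramp_tendsto[OF g], of "mass ?U - \<epsilon> / 2"] \<epsilon> by simp
  then obtain m where m: "mass ?U - \<epsilon> / 2 < (\<integral>x. \<rho> x * ramp g m x \<partial>lborel)"
    by (auto simp: eventually_sequentially)
  define c where "c = (\<integral>x. \<rho> x * ramp g m x \<partial>lborel)"
  let ?f = "\<lambda>x. complex_of_real (ramp g m x)"
  have mean_convergent: "mean_convergent ?f" by (rule ramp_mean_convergent[OF g])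
  have target: "target ?f = of_real c"
    unfolding target_def c_def scaleR_conv_of_real of_real_mult[symmetric] by (rule integral_complex_of_real)
  have dev: "cmod (avg n ?f \<omega> - target ?f) = \<bar>ramp_average g m n \<omega> - c\<bar>" for n \<omega>
    unfolding target real_avg ramp_average_def of_real_diff[symmetric] norm_of_real ..
  have conv: "(\<lambda>n. expectation (\<lambda>\<omega>. \<bar>ramp_average g m n \<omega> - c\<bar>)) \<longlonglongrightarrow> 0"
    using mean_convergent unfolding mean_convergent_def dev by blast
  have bound: "prob {\<omega> \<in> space M. fraction ?U n \<omega> \<le> mass ?U - \<epsilon>}
      \<le> expectation (\<lambda>\<omega>. \<bar>ramp_average g m n \<omega> - c\<bar>) / (\<epsilon> / 2)" for n
  proof -
    have avg_m: "avg n ?f \<in> borel_measurable M" using mean_convergent unfolding mean_convergent_def by blast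
    have int: "integrable M (\<lambda>\<omega>. \<bar>ramp_average g m n \<omega> - c\<bar>)"
      unfolding dev[symmetric] by (rule deviation_integrable[OF avg_m, of 1]) (use ramp_bounds in simp)
    have le: "ramp_average g m n \<omega> \<le> fraction ?U n \<omega>" for \<omega>
      unfolding ramp_average_def fraction_def
      by (intro divide_right_mono sum_list_mono ramp_le_indicator) simp
    have "{\<omega> \<in> space M. fraction ?U n \<omega> \<le> mass ?U - \<epsilon>} \<subseteq> {\<omega> \<in> space M. \<epsilon> / 2 \<le> \<bar>ramp_average g m n \<omega> - c\<bar>}"
    proof safe
      fix \<omega> assume "fraction ?U n \<omega> \<le> mass ?U - \<epsilon>"
      then have "ramp_average g m n \<omega> - c \<le> - (\<epsilon> / 2)" using le[of \<omega>] m unfolding c_def by linarith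
      then show "\<epsilon> / 2 \<le> \<bar>ramp_average g m n \<omega> - c\<bar>" using \<epsilon> by linarith
    qed
    moreover have "{\<omega> \<in> space M. \<epsilon> / 2 \<le> \<bar>ramp_average g m n \<omega> - c\<bar>} \<in> sets M"
      using ramp_average_measurable[OF g, of m n] by measurable
    ultimately have "prob {\<omega> \<in> space M. fraction ?U n \<omega> \<le> mass ?U - \<epsilon>}
        \<le> prob {\<omega> \<in> space M. \<epsilon> / 2 \<le> \<bar>ramp_average g m n \<omega> - c\<bar>}"
      by (rule finite_measure_mono)
    also have "\<dots> \<le> expectation (\<lambda>\<omega>. \<bar>ramp_average g m n \<omega> - c\<bar>) / (\<epsilon> / 2)"
      by (rule integral_Markov_inequality_measure[OF int sets.top]) (use \<epsilon> in auto)
    finally show ?thesis .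
  qed
  show ?thesis
  proof (rule tendsto_sandwich[OF _ _ tendsto_const])
    show "(\<lambda>n. expectation (\<lambda>\<omega>. \<bar>ramp_average g m n \<omega> - c\<bar>) / (\<epsilon> / 2)) \<longlonglongrightarrow> 0"
      by (rule tendsto_divide_zero[OF conv])
  qed (use bound in simp_all)
qed

lemma fraction_atMost:
  "fraction {..t} n \<omega> = 1 - fraction {x. 0 < x - t} n \<omega>"
proof -
  have "(\<Sum>r\<leftarrow>xs. indicator {..t} r) = real (length xs) - (\<Sum>r\<leftarrow>xs. indicator {x. 0 < x - t} r)" for xs
    by (induction xs) (auto simp: indicator_def)
  then show ?thesis using N_pos[of n] by (simp add: fraction_def len diff_divide_distrib)
qed

text \<open>Lebesgue measure has no atoms, so the point \<open>t\<close> may be moved between the two half-lines.\<close>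

lemma cdf_eq_mass:
  "cdf (density lborel (\<lambda>x. ennreal (\<rho> x))) t = mass {x. 0 < t - x}"
  "cdf (density lborel (\<lambda>x. ennreal (\<rho> x))) t = 1 - mass {x. 0 < x - t}"
proof -
  have int: "integrable lborel (\<lambda>x. \<rho> x * indicator A x)" if "A \<in> sets borel" for A
    using integrable_real_mult_indicator[OF _ density_integrable(1), of A] that by simp
  have "emeasure (density lborel (\<lambda>x. ennreal (\<rho> x))) {..t} = (\<integral>\<^sup>+x. ennreal (\<rho> x * indicator {..t} x) \<partial>lborel)"
    using density_measurable density_nonneg
    by (subst emeasure_density) (auto simp: indicator_def intro!: nn_integral_cong)
  also have "\<dots> = ennreal (\<integral>x. \<rho> x * indicator {..t} x \<partial>lborel)"
    using density_nonneg by (intro nn_integral_eq_integral int) (auto simp: indicator_def)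
  finally have cdf: "cdf (density lborel (\<lambda>x. ennreal (\<rho> x))) t = (\<integral>x. \<rho> x * indicator {..t} x \<partial>lborel)"
    using density_nonneg unfolding cdf_def measure_def
    by (simp add: integral_nonneg_AE)
  have "(\<integral>x. \<rho> x * indicator {..t} x \<partial>lborel) = (\<integral>x. \<rho> x * indicator {x. 0 < t - x} x \<partial>lborel)"
  proof (rule integral_cong_AE)
    show "AE x in lborel. \<rho> x * indicator {..t} x = \<rho> x * indicator {x. 0 < t - x} x"
      using AE_lborel_singleton[of t] by eventually_elim (auto simp: indicator_def)
  qed (use density_measurable in measurable)
  then show "cdf (density lborel (\<lambda>x. ennreal (\<rho> x))) t = mass {x. 0 < t - x}"
    unfolding cdf mass_def .
  have "(\<integral>x. \<rho> x * indicator {..t} x \<partial>lborel) + (\<integral>x. \<rho> x * indicator {x. 0 < x - t} x \<partial>lborel)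
      = (\<integral>x. \<rho> x * indicator {..t} x + \<rho> x * indicator {x. 0 < x - t} x \<partial>lborel)"
    by (rule Bochner_Integration.integral_add[symmetric]) (intro int; measurable)+
  also have "(\<lambda>x. \<rho> x * indicator {..t} x + \<rho> x * indicator {x. 0 < x - t} x) = \<rho>"
    by (auto simp: indicator_def fun_eq_iff)
  finally show "cdf (density lborel (\<lambda>x. ennreal (\<rho> x))) t = 1 - mass {x. 0 < x - t}"
    unfolding cdf mass_def using density_integrable(2) by simp
qed

text \<open>The lower bound for the left half-line bounds the distribution function from below, and the one for the right
half-line, taken to the complement, bounds it from above.\<close>

theorem fraction_tendsto_in_probability:
  "tendsto_in_probability M (fraction {..t}) (cdf (density lborel (\<lambda>x. ennreal (\<rho> x))) t)"
proof -
  let ?c = "cdf (density lborel (\<lambda>x. ennreal (\<rho> x))) t"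
  have cont: "continuous_on UNIV (\<lambda>x::real. t - x)" "continuous_on UNIV (\<lambda>x::real. x - t)"
    by (intro continuous_intros)+
  note lower = fraction_measurable[OF cont(1)] and upper = fraction_measurable[OF cont(2)]
  have meas: "fraction {..t} n \<in> borel_measurable M" for n
    unfolding fraction_atMost[abs_def] using upper[of n] by simp
  have "(\<lambda>n. prob {\<omega> \<in> space M. \<bar>fraction {..t} n \<omega> - ?c\<bar> > \<epsilon>}) \<longlonglongrightarrow> 0" if \<epsilon>: "0 < \<epsilon>" for \<epsilon>
  proof -
    let ?A = "\<lambda>n. {\<omega> \<in> space M. fraction {x. 0 < t - x} n \<omega> \<le> mass {x. 0 < t - x} - \<epsilon>}"
    let ?B = "\<lambda>n. {\<omega> \<in> space M. fraction {x. 0 < x - t} n \<omega> \<le> mass {x. 0 < x - t} - \<epsilon>}"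
    have sets: "?A n \<in> sets M" "?B n \<in> sets M" for n using lower[of n] upper[of n] by measurable
    have le: "fraction {x. 0 < t - x} n \<omega> \<le> fraction {..t} n \<omega>" for n \<omega>
      unfolding fraction_def by (intro divide_right_mono sum_list_mono) (auto simp: indicator_def)
    have union: "prob {\<omega> \<in> space M. \<bar>fraction {..t} n \<omega> - ?c\<bar> > \<epsilon>} \<le> prob (?A n) + prob (?B n)" for n
    proof -
      have "{\<omega> \<in> space M. \<bar>fraction {..t} n \<omega> - ?c\<bar> > \<epsilon>} \<subseteq> ?A n \<union> ?B n"
      proof
        fix \<omega> assume \<omega>: "\<omega> \<in> {\<omega> \<in> space M. \<bar>fraction {..t} n \<omega> - ?c\<bar> > \<epsilon>}"
        show "\<omega> \<in> ?A n \<union> ?B n"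
        proof (cases "fraction {..t} n \<omega> \<le> ?c")
          case True
          then have "fraction {x. 0 < t - x} n \<omega> \<le> mass {x. 0 < t - x} - \<epsilon>"
            using \<omega> le[of n \<omega>] cdf_eq_mass(1)[of t] by auto
          then show ?thesis using \<omega> by simp
        next
          case False
          then have "fraction {x. 0 < x - t} n \<omega> \<le> mass {x. 0 < x - t} - \<epsilon>"
            using \<omega> fraction_atMost[of t n \<omega>] cdf_eq_mass(2)[of t] by auto
          then show ?thesis using \<omega> by simp
        qed
      qed
      then have "prob {\<omega> \<in> space M. \<bar>fraction {..t} n \<omega> - ?c\<bar> > \<epsilon>} \<le> prob (?A n \<union> ?B n)"
        using sets by (intro finite_measure_mono) auto
      also have "\<dots> \<le> prob (?A n) + prob (?B n)" by (rule measure_Un_le[OF sets])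
      finally show ?thesis .
    qed
    have "(\<lambda>n. prob (?A n) + prob (?B n)) \<longlonglongrightarrow> 0"
      by (rule tendsto_add_zero[OF fraction_lower_bound[OF cont(1) \<epsilon>] fraction_lower_bound[OF cont(2) \<epsilon>]])
    then show ?thesis
    proof (rule Lim_null_comparison[rotated])
      show "eventually (\<lambda>n. norm (prob {\<omega> \<in> space M. \<bar>fraction {..t} n \<omega> - ?c\<bar> > \<epsilon>}) \<le> prob (?A n) + prob (?B n)) sequentially"
        using union by simp
    qed
  qed
  then show ?thesis unfolding tendsto_in_probability_def using meas by blast
qed

end

section \<open>Independence and moments of diluted entries\<close>

lemma (in prob_space) prob_finite_product:
  assumes ind: "indep_vars M' X I" and K: "K \<subseteq> I" "finite K" and B: "\<And>i. i \<in> K \<Longrightarrow> B i \<in> sets (M' i)"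
  shows "prob {\<omega> \<in> space M. \<forall>i\<in>K. X i \<omega> \<in> B i} = (\<Prod>i\<in>K. prob (X i -` B i \<inter> space M))"
proof (cases "K = {}")
  case True
  then show ?thesis by (simp add: prob_space)
next
  case False
  then have "{\<omega> \<in> space M. \<forall>i\<in>K. X i \<omega> \<in> B i} = (\<Inter>i\<in>K. X i -` B i \<inter> space M)" by auto
  then show ?thesis using indep_varsD[OF ind False K(2,1)] B by simp
qed

text \<open>A finite intersection of events of both families factors first between the families, by the independence of
the two random vectors, and then within each of them.\<close>

lemma (in prob_space) indep_vars_joint:
  fixes A D :: "'i \<Rightarrow> 'a \<Rightarrow> real"
  assumes A: "indep_vars (\<lambda>_. borel) A I" and D: "indep_vars (\<lambda>_. borel) D J" and JI: "J \<subseteq> I"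
    and AD: "indep_var (PiM I (\<lambda>_. borel)) (\<lambda>\<omega>. \<lambda>i\<in>I. A i \<omega>) (PiM J (\<lambda>_. borel)) (\<lambda>\<omega>. \<lambda>i\<in>J. D i \<omega>)"
  shows "indep_vars (\<lambda>_. borel) (case_sum A D) (J <+> J)"
  unfolding indep_vars_def2
proof
  have rvA: "random_variable borel (A i)" if "i \<in> J" for i using A JI that by (auto simp: indep_vars_def)
  have rvD: "random_variable borel (D i)" if "i \<in> J" for i using D that by (auto simp: indep_vars_def)
  show rv: "\<forall>i\<in>J <+> J. random_variable borel (case_sum A D i)" using rvA rvD by auto
  show "indep_sets (\<lambda>i. {case_sum A D i -` B \<inter> space M |B. B \<in> sets borel}) (J <+> J)"
  proof (rule indep_setsI)
    show "{case_sum A D i -` B \<inter> space M |B. B \<in> sets borel} \<subseteq> events" if "i \<in> J <+> J" for i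
      using rv that by (auto intro: measurable_sets)
  next
    fix E K assume K: "K \<noteq> {}" "K \<subseteq> J <+> J" "finite K"
      and E: "\<forall>j\<in>K. E j \<in> {case_sum A D j -` B \<inter> space M |B. B \<in> sets borel}"
    then have "\<forall>j\<in>K. \<exists>B. E j = case_sum A D j -` B \<inter> space M \<and> B \<in> sets borel" by blast
    then obtain B where B: "\<And>j. j \<in> K \<Longrightarrow> E j = case_sum A D j -` B j \<inter> space M"
      "\<And>j. j \<in> K \<Longrightarrow> B j \<in> sets borel" by metis
    \<comment> \<open>the finite index set, split into its two families\<close>
    define K1 K2 where "K1 = Inl -` K" and "K2 = Inr -` K"
    have K12: "K1 \<subseteq> J" "K2 \<subseteq> J" "finite K1" "finite K2" "K = Inl ` K1 \<union> Inr ` K2"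
      using K by (auto simp: K1_def K2_def finite_vimageI inj_def)
    define S1 where "S1 = {x \<in> space (PiM I (\<lambda>_. borel :: real measure)). \<forall>i\<in>K1. x i \<in> B (Inl i)}"
    define S2 where "S2 = {x \<in> space (PiM J (\<lambda>_. borel :: real measure)). \<forall>i\<in>K2. x i \<in> B (Inr i)}"
    have S: "S1 \<in> sets (PiM I (\<lambda>_. borel))" "S2 \<in> sets (PiM J (\<lambda>_. borel))"
    proof -
      have BK: "B (Inl i) \<in> sets borel" if "i \<in> K1" for i using that B(2) by (simp add: K1_def)
      have BK': "B (Inr i) \<in> sets borel" if "i \<in> K2" for i using that B(2) by (simp add: K2_def)
      show "S1 \<in> sets (PiM I (\<lambda>_. borel))" unfolding S1_def
        using K12 JI by (intro sets.sets_Collect_finite_All' sets.sets_Collect_finite_All measurable_sets_Collect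
            [OF measurable_component_singleton] ) (auto intro: BK)
      show "S2 \<in> sets (PiM J (\<lambda>_. borel))" unfolding S2_def
        using K12 JI by (intro sets.sets_Collect_finite_All measurable_sets_Collect
            [OF measurable_component_singleton] ) (auto intro: BK')
    qed
    have pre1: "(\<lambda>\<omega>. \<lambda>i\<in>I. A i \<omega>) -` S1 \<inter> space M = {\<omega> \<in> space M. \<forall>i\<in>K1. A i \<omega> \<in> B (Inl i)}"
      using K12 JI by (auto simp: S1_def space_PiM)
    have pre2: "(\<lambda>\<omega>. \<lambda>i\<in>J. D i \<omega>) -` S2 \<inter> space M = {\<omega> \<in> space M. \<forall>i\<in>K2. D i \<omega> \<in> B (Inr i)}"
      using K12 by (auto simp: S2_def space_PiM)
    have EA: "E (Inl i) = {\<omega> \<in> space M. A i \<omega> \<in> B (Inl i)}" if "i \<in> K1" for i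
    proof -
      have "Inl i \<in> K" using that by (simp add: K1_def)
      from B(1)[OF this] show ?thesis by (simp add: vimage_def Int_def conj_commute)
    qed
    have EB: "E (Inr i) = {\<omega> \<in> space M. D i \<omega> \<in> B (Inr i)}" if "i \<in> K2" for i
    proof -
      have "Inr i \<in> K" using that by (simp add: K2_def)
      from B(1)[OF this] show ?thesis by (simp add: vimage_def Int_def conj_commute)
    qed
    have "(\<Inter>j\<in>K. E j) = (\<Inter>i\<in>K1. E (Inl i)) \<inter> (\<Inter>i\<in>K2. E (Inr i))"
      unfolding K12(5) INT_Un by simp
    also have "\<dots> = {\<omega> \<in> space M. \<forall>i\<in>K1. A i \<omega> \<in> B (Inl i)} \<inter> {\<omega> \<in> space M. \<forall>i\<in>K2. D i \<omega> \<in> B (Inr i)}"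
    proof -
      have "K1 \<noteq> {} \<or> K2 \<noteq> {}" using K(1) K12(5) by blast
      moreover have "(\<Inter>i\<in>K1. E (Inl i)) = (\<Inter>i\<in>K1. {\<omega> \<in> space M. A i \<omega> \<in> B (Inl i)})"
        "(\<Inter>i\<in>K2. E (Inr i)) = (\<Inter>i\<in>K2. {\<omega> \<in> space M. D i \<omega> \<in> B (Inr i)})"
        using EA EB by (simp_all cong: INF_cong)
      ultimately show ?thesis by (simp only:) blast
    qed
    finally have split: "(\<Inter>j\<in>K. E j) = {\<omega> \<in> space M. \<forall>i\<in>K1. A i \<omega> \<in> B (Inl i)}
        \<inter> {\<omega> \<in> space M. \<forall>i\<in>K2. D i \<omega> \<in> B (Inr i)}" .
    have "prob (\<Inter>j\<in>K. E j) = prob ((\<lambda>\<omega>. \<lambda>i\<in>I. A i \<omega>) -` S1 \<inter> space M) * prob ((\<lambda>\<omega>. \<lambda>i\<in>J. D i \<omega>) -` S2 \<inter> space M)"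
    proof -
      have "(\<Inter>j\<in>K. E j) = (\<lambda>\<omega>. (\<lambda>i\<in>I. A i \<omega>, \<lambda>i\<in>J. D i \<omega>)) -` (S1 \<times> S2) \<inter> space M"
        unfolding split pre1[symmetric] pre2[symmetric] by auto
      then show ?thesis using indep_varD[OF AD S] by simp
    qed
    also have "\<dots> = prob {\<omega> \<in> space M. \<forall>i\<in>K1. A i \<omega> \<in> B (Inl i)} * prob {\<omega> \<in> space M. \<forall>i\<in>K2. D i \<omega> \<in> B (Inr i)}"
      unfolding pre1 pre2 ..
    also have "\<dots> = (\<Prod>i\<in>K1. prob (A i -` B (Inl i) \<inter> space M)) * (\<Prod>i\<in>K2. prob (D i -` B (Inr i) \<inter> space M))"
    proof -
      have "B (Inl i) \<in> sets borel" if "i \<in> K1" for i using that B(2) by (simp add: K1_def)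
      moreover have "B (Inr i) \<in> sets borel" if "i \<in> K2" for i using that B(2) by (simp add: K2_def)
      moreover have "K1 \<subseteq> I" using K12(1) JI by blast
      ultimately show ?thesis
        using prob_finite_product[OF A _ K12(3), of "\<lambda>i. B (Inl i)"]
          prob_finite_product[OF D K12(2,4), of "\<lambda>i. B (Inr i)"] by simp
    qed
    also have "\<dots> = (\<Prod>i\<in>K1. prob (E (Inl i))) * (\<Prod>i\<in>K2. prob (E (Inr i)))"
    proof -
      have "A i -` B (Inl i) \<inter> space M = E (Inl i)" if "i \<in> K1" for i using EA[OF that] by auto
      moreover have "D i -` B (Inr i) \<inter> space M = E (Inr i)" if "i \<in> K2" for i using EB[OF that] by auto
      ultimately show ?thesis by simp
    qed
    also have "\<dots> = (\<Prod>j\<in>K. prob (E j))"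
      unfolding K12(5) using K12(3,4)
      by (subst prod.union_disjoint) (auto simp: prod.reindex)
    finally show "prob (\<Inter>j\<in>K. E j) = (\<Prod>j\<in>K. prob (E j))" .
  qed
qed

lemma (in prob_space) indep_vars_times:
  fixes A D :: "'i \<Rightarrow> 'a \<Rightarrow> real"
  assumes "indep_vars (\<lambda>_. borel) A I" "indep_vars (\<lambda>_. borel) D J" "J \<subseteq> I"
    "indep_var (PiM I (\<lambda>_. borel)) (\<lambda>\<omega>. \<lambda>i\<in>I. A i \<omega>) (PiM J (\<lambda>_. borel)) (\<lambda>\<omega>. \<lambda>i\<in>J. D i \<omega>)"
  shows "indep_vars (\<lambda>_. borel) (\<lambda>i \<omega>. A i \<omega> * D i \<omega> / c) J"
proof -
  have "indep_vars (\<lambda>j. PiM {Inl j, Inr j} (\<lambda>_. borel)) (\<lambda>j \<omega>. restrict (\<lambda>i. case_sum A D i \<omega>) {Inl j, Inr j}) J"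
    by (rule indep_vars_restrict[OF indep_vars_joint[OF assms]]) (auto simp: disjoint_family_on_def)
  from indep_vars_compose2[OF this, of "\<lambda>j x. x (Inl j) * x (Inr j) / c" "\<lambda>_. borel"]
  have "indep_vars (\<lambda>_. borel) (\<lambda>j \<omega>. (restrict (\<lambda>i. case_sum A D i \<omega>) {Inl j, Inr j}) (Inl j)
      * (restrict (\<lambda>i. case_sum A D i \<omega>) {Inl j, Inr j}) (Inr j) / c) J"
    by (auto intro!: borel_measurable_divide borel_measurable_times measurable_component_singleton)
  then show ?thesis by simp
qed

lemma (in prob_space) indep_vars_inj_reindex:
  fixes X :: "'i \<Rightarrow> 'a \<Rightarrow> real"
  assumes X: "indep_vars (\<lambda>_. borel) X I" and t: "inj_on t P" "t ` P \<subseteq> I"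
  shows "indep_vars (\<lambda>_. borel) (\<lambda>p. X (t p)) P"
proof -
  have "indep_vars (\<lambda>p. PiM {t p} (\<lambda>_. borel)) (\<lambda>p \<omega>. restrict (\<lambda>i. X i \<omega>) {t p}) P"
    using t by (intro indep_vars_restrict[OF X]) (auto simp: disjoint_family_on_def inj_on_def)
  from indep_vars_compose2[OF this, of "\<lambda>p x. x (t p)" "\<lambda>_. borel"]
  have "indep_vars (\<lambda>_. borel) (\<lambda>p \<omega>. (restrict (\<lambda>i. X i \<omega>) {t p}) (t p)) P"
    by (auto intro!: measurable_component_singleton)
  then show ?thesis by simp
qed

lemma (in prob_space) indep_var_components:
  fixes A D :: "'i \<Rightarrow> 'a \<Rightarrow> real"
  assumes AD: "indep_var (PiM I (\<lambda>_. borel)) (\<lambda>\<omega>. \<lambda>i\<in>I. A i \<omega>) (PiM J (\<lambda>_. borel)) (\<lambda>\<omega>. \<lambda>i\<in>J. D i \<omega>)"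
    and i: "i \<in> I" "i \<in> J" and f: "f \<in> borel_measurable borel" and g: "g \<in> borel_measurable borel"
  shows "indep_var borel (\<lambda>\<omega>. f (A i \<omega>) :: real) borel (\<lambda>\<omega>. g (D i \<omega>) :: real)"
proof -
  have mf: "(\<lambda>x. f (x i)) \<in> borel_measurable (PiM I (\<lambda>_. borel))"
    using measurable_compose[OF measurable_component_singleton[OF i(1)] f] .
  have mg: "(\<lambda>x. g (x i)) \<in> borel_measurable (PiM J (\<lambda>_. borel))"
    using measurable_compose[OF measurable_component_singleton[OF i(2)] g] .
  from indep_var_compose[OF AD mf mg] i show ?thesis by (simp add: o_def)
qed

text \<open>Almost surely the variable takes only the values 0 and 1, so \<open>g\<close> of it agrees with the indicator of the
value 1. This treats the mean and the higher moments alike.\<close>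

lemma (in prob_space) bernoulli_expectation:
  fixes D :: "'a \<Rightarrow> real" and g :: "real \<Rightarrow> real"
  assumes D: "random_variable borel D" and g: "g \<in> borel_measurable borel"
    and one: "prob {\<omega> \<in> space M. D \<omega> = 1} = p" and zero: "prob {\<omega> \<in> space M. D \<omega> = 0} = 1 - p"
    and g01: "g 0 = 0" "g 1 = 1"
  shows "has_bochner_integral M (\<lambda>\<omega>. g (D \<omega>)) p"
proof -
  let ?E = "{\<omega> \<in> space M. D \<omega> = 1}" and ?Z = "{\<omega> \<in> space M. D \<omega> = 0}"
  have sets: "?E \<in> events" "?Z \<in> events" using D by measurable
  have "prob (?E \<union> ?Z) = prob ?E + prob ?Z" by (rule finite_measure_Union[OF sets]) auto
  then have "prob (?E \<union> ?Z) = 1" using one zero by simp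
  then have "AE \<omega> in M. \<omega> \<in> ?E \<union> ?Z" using sets by (subst AE_in_set_eq_1) auto
  then have ae: "AE \<omega> in M. g (D \<omega>) = indicator ?E \<omega>" by eventually_elim (auto simp: g01)
  have ind: "has_bochner_integral M (indicator ?E :: 'a \<Rightarrow> real) p"
  proof -
    have "emeasure M ?E < \<infinity>" by (simp add: emeasure_eq_measure)
    then show ?thesis using has_bochner_integral_real_indicator[OF sets(1)] one by simp
  qed
  show ?thesis
    by (rule has_bochner_integralI_AE[OF ind]) (use ae measurable_compose[OF D g] in \<open>auto elim: eventually_mono\<close>)
qed

lemma (in prob_space) dilution_integral:
  fixes A D :: "'i \<Rightarrow> 'a \<Rightarrow> real"
  assumes AD: "indep_var (PiM I (\<lambda>_. borel)) (\<lambda>\<omega>. \<lambda>i\<in>I. A i \<omega>) (PiM J (\<lambda>_. borel)) (\<lambda>\<omega>. \<lambda>i\<in>J. D i \<omega>)"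
    and i: "i \<in> I" "i \<in> J" and D: "random_variable borel (D i)"
    and one: "prob {\<omega> \<in> space M. D i \<omega> = 1} = p" and zero: "prob {\<omega> \<in> space M. D i \<omega> = 0} = 1 - p"
    and f: "f \<in> borel_measurable borel" "has_bochner_integral M (\<lambda>\<omega>. f (A i \<omega>)) m"
    and g: "g \<in> borel_measurable borel" "g 0 = 0" "g 1 = 1"
  shows "has_bochner_integral M (\<lambda>\<omega>. f (A i \<omega>) * g (D i \<omega>)) (m * p)"
proof -
  note ind = indep_var_components[OF AD i f(1) g(1)]
  note d = bernoulli_expectation[OF D g(1) one zero g(2,3)]
  show ?thesis
    using indep_var_lebesgue_integral[OF ind] indep_var_integrable[OF ind] f(2) d
    by (simp add: has_bochner_integral_iff)
qed

section \<open>The semicircle law for diluted band matrices\<close>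

lemma sorted_eigenvalues_symmetric:
  obtains rs where "length rs = N"
    "char_poly (map_mat complex_of_real (symmetric_matrix N x)) = (\<Prod>r\<leftarrow>map of_real rs. [:- r, 1:])"
    "rs = sorted_eigenvalues (symmetric_matrix N x)"
proof -
  obtain rs where rs: "length rs = N"
    "char_poly (map_mat complex_of_real (symmetric_matrix N x)) = (\<Prod>r\<leftarrow>map of_real rs. [:- r, 1:])"
    "proots (char_poly (symmetric_matrix N x)) = mset rs"
    by (rule char_poly_symmetric_splits)
  have sort: "sorted_eigenvalues (symmetric_matrix N x) = sort rs"
    unfolding sorted_eigenvalues_def rs(3) by simp
  have "(\<Prod>r\<leftarrow>map complex_of_real (sort rs). [:- r, 1:]) = prod_mset (image_mset (\<lambda>r. [:- complex_of_real r, 1:]) (mset (sort rs)))"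
    by (simp only: prod_mset_prod_list[symmetric] mset_map image_mset.compositionality o_def)
  also have "\<dots> = (\<Prod>r\<leftarrow>map of_real rs. [:- r, 1:])"
    by (simp only: prod_mset_prod_list[symmetric] mset_map image_mset.compositionality o_def mset_sort)
  finally have "char_poly (map_mat complex_of_real (symmetric_matrix N x)) = (\<Prod>r\<leftarrow>map of_real (sort rs). [:- r, 1:])"
    unfolding rs(2) by (rule sym)
  from that[OF _ this sort[symmetric]] rs(1) show ?thesis by (simp only: length_sort)
qed

lemma length_sorted_eigenvalues: "length (sorted_eigenvalues (symmetric_matrix N x)) = N"
  by (rule sorted_eigenvalues_symmetric[of N x]) (simp only:)

lemma trace_resolvent_eigenvalues:
  assumes "Im z \<noteq> 0"
  shows "(\<Sum>r\<leftarrow>sorted_eigenvalues (symmetric_matrix N x). 1 / (of_real r - z)) = (\<Sum>i<N. resolvent N z x i i)"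
proof -
  obtain rs where rs: "length rs = N"
    "char_poly (map_mat complex_of_real (symmetric_matrix N x)) = (\<Prod>r\<leftarrow>map of_real rs. [:- r, 1:])"
    "rs = sorted_eigenvalues (symmetric_matrix N x)"
    by (rule sorted_eigenvalues_symmetric)
  show ?thesis unfolding rs(3)[symmetric] by (rule resolvent_trace[OF assms rs(1,2), symmetric])
qed

lemma eigenvalue_counting_eq:
  "eigenvalue_counting (symmetric_matrix N x) t
     = (\<Sum>r\<leftarrow>sorted_eigenvalues (symmetric_matrix N x). indicator {..t} r) / real N"
proof -
  let ?xs = "sorted_eigenvalues (symmetric_matrix N x)"
  have "real (card {k. k < length ?xs \<and> ?xs ! k \<le> t}) = (\<Sum>r\<leftarrow>?xs. indicator {..t} r)"
    unfolding length_filter_eq_sum_list_indicator[symmetric] length_filter_conv_card by simp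
  then show ?thesis by (simp add: eigenvalue_counting_def symmetric_matrix_def)
qed

text \<open>The parameters of the percolation matrix, indexed by positions instead of labels.\<close>

definition diluted_entry ::
  "(int \<Rightarrow> int \<Rightarrow> 'w \<Rightarrow> real) \<Rightarrow> (nat \<Rightarrow> int \<Rightarrow> int \<Rightarrow> 'w \<Rightarrow> real) \<Rightarrow> (nat \<Rightarrow> int) \<Rightarrow> nat \<Rightarrow> nat \<times> nat \<Rightarrow> 'w \<Rightarrow> real" where
  "diluted_entry a d b n p \<omega> =
     (let i = int (fst p) - int n; j = int (snd p) - int n
      in a i j \<omega> * d n i j \<omega> / sqrt (real_of_int (b n)))"

lemma percolation_matrix_eq:
  "percolation_matrix a d b n \<omega> = symmetric_matrix (2 * n + 1) (\<lambda>p. diluted_entry a d b n p \<omega>)"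
  unfolding percolation_matrix_def symmetric_matrix_def
  by (rule eq_matI) (auto simp: sym_index_def diluted_entry_def)

theorem theorem2p1:
  fixes M :: "'w measure"
    and v :: real
    and a :: "int \<Rightarrow> int \<Rightarrow> 'w \<Rightarrow> real"
    and \<psi> :: "real \<Rightarrow> real"
    and b :: "nat \<Rightarrow> int"
    and d :: "nat \<Rightarrow> int \<Rightarrow> int \<Rightarrow> 'w \<Rightarrow> real"
    and I :: "(int \<times> int) set"
    and J :: "nat \<Rightarrow> (int \<times> int) set"
  defines "I \<equiv> {(i, j). i \<le> j}"
    and "J \<equiv> (\<lambda>n. {(i, j). - int n \<le> i \<and> i \<le> j \<and> j \<le> int n})"
  assumes prob: "prob_space M"
    and v_pos: "v > 0"
    and a_indep: "prob_space.indep_vars M (\<lambda>_. borel) (\<lambda>(i, j). a i j) I"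
    and a_mean: "\<And>i j. i \<le> j \<Longrightarrow> has_bochner_integral M (a i j) 0"
    and a_var: "\<And>i j. i \<le> j \<Longrightarrow> has_bochner_integral M (\<lambda>\<omega>. (a i j \<omega>)\<^sup>2) (v\<^sup>2)"
    and psi_range: "\<And>t. \<psi> t \<in> {0..1}"
    and psi_cont: "continuous_on UNIV \<psi>"
    and psi_even: "\<And>t. \<psi> (- t) = \<psi> t"
    and psi_decreasing: "antimono_on {0..} \<psi>"
    and psi_vanishes: "(\<psi> \<longlongrightarrow> 0) at_infinity"
    and psi_integral: "has_bochner_integral lborel \<psi> 1"
    and b_bounds: "\<And>n. 0 < b n \<and> b n \<le> 2 * int n + 1"
    and b_infinity: "filterlim b at_top sequentially"
    and b_over_n: "(\<lambda>n. real_of_int (b n) / real n) \<longlonglongrightarrow> 0"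
    and d_indep: "\<And>n. prob_space.indep_vars M (\<lambda>_. borel) (\<lambda>(i, j). d n i j) (J n)"
    and d_one: "\<And>n i j. (i, j) \<in> J n \<Longrightarrow>
        measure M {\<omega> \<in> space M. d n i j \<omega> = 1} = \<psi> (real_of_int (i - j) / real_of_int (b n))"
    and d_zero: "\<And>n i j. (i, j) \<in> J n \<Longrightarrow>
        measure M {\<omega> \<in> space M. d n i j \<omega> = 0} = 1 - \<psi> (real_of_int (i - j) / real_of_int (b n))"
    and d_indep_a: "\<And>n. prob_space.indep_var M
        (PiM I (\<lambda>_. borel)) (\<lambda>\<omega>. \<lambda>(i, j)\<in>I. a i j \<omega>)
        (PiM (J n) (\<lambda>_. borel)) (\<lambda>\<omega>. \<lambda>(i, j)\<in>J n. d n i j \<omega>)"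
    and third_moment: "(SUP (i, j)\<in>I. \<integral>\<^sup>+ \<omega>. ennreal (\<bar>a i j \<omega>\<bar> ^ 3) \<partial>M) < \<infinity>"
  shows "\<forall>t. tendsto_in_probability M
           (\<lambda>n \<omega>. eigenvalue_counting (percolation_matrix a d b n \<omega>) t) (semicircle_cdf v t)"
proof
  fix t
  interpret prob_space M by (rule prob)
  interpret profile \<psi>
    using psi_range psi_cont psi_even psi_decreasing psi_integral by unfold_locales
  let ?A = "\<lambda>(i, j). a i j" and ?D = "\<lambda>n (i, j). d n i j"
  have AD: "indep_var (PiM I (\<lambda>_. borel)) (\<lambda>\<omega>. \<lambda>e\<in>I. ?A e \<omega>) (PiM (J n) (\<lambda>_. borel)) (\<lambda>\<omega>. \<lambda>e\<in>J n. ?D n e \<omega>)" for n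
  proof -
    have "(\<lambda>\<omega>. \<lambda>e\<in>I. ?A e \<omega>) = (\<lambda>\<omega>. \<lambda>(i, j)\<in>I. a i j \<omega>)"
      "(\<lambda>\<omega>. \<lambda>e\<in>J n. ?D n e \<omega>) = (\<lambda>\<omega>. \<lambda>(i, j)\<in>J n. d n i j \<omega>)"
      by (auto simp: fun_eq_iff restrict_def)
    then show ?thesis using d_indep_a[of n] by simp
  qed
  have JI: "J n \<subseteq> I" for n by (auto simp: I_def J_def)
  have a_meas: "random_variable borel (a i j)" if "i \<le> j" for i j
    using a_mean[OF that] by (auto simp: has_bochner_integral_iff)

  obtain C where C: "0 \<le> C" "\<And>i j. i \<le> j \<Longrightarrow> integrable M (\<lambda>\<omega>. \<bar>a i j \<omega>\<bar> ^ 3)"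
    "\<And>i j. i \<le> j \<Longrightarrow> expectation (\<lambda>\<omega>. \<bar>a i j \<omega>\<bar> ^ 3) \<le> C"
  proof -
    define s where "s = (SUP (i, j)\<in>I. \<integral>\<^sup>+ \<omega>. ennreal (\<bar>a i j \<omega>\<bar> ^ 3) \<partial>M)"
    have s: "s < \<infinity>" using third_moment by (simp add: s_def)
    have le: "(\<integral>\<^sup>+ \<omega>. ennreal (\<bar>a i j \<omega>\<bar> ^ 3) \<partial>M) \<le> s" if "i \<le> j" for i j
      unfolding s_def using that by (intro SUP_upper2[of "(i, j)"]) (auto simp: I_def)
    have int: "integrable M (\<lambda>\<omega>. \<bar>a i j \<omega>\<bar> ^ 3)" if "i \<le> j" for i j
    proof (rule integrableI_nonneg)
      show "(\<integral>\<^sup>+ \<omega>. ennreal (\<bar>a i j \<omega>\<bar> ^ 3) \<partial>M) < \<infinity>" using le[OF that] s by (rule le_less_trans)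
    qed (use a_meas[OF that] in auto)
    have "expectation (\<lambda>\<omega>. \<bar>a i j \<omega>\<bar> ^ 3) \<le> enn2real s" if "i \<le> j" for i j
    proof -
      have "ennreal (expectation (\<lambda>\<omega>. \<bar>a i j \<omega>\<bar> ^ 3)) \<le> s"
        using le[OF that] nn_integral_eq_integral[OF int[OF that]] by simp
      then have "ennreal (expectation (\<lambda>\<omega>. \<bar>a i j \<omega>\<bar> ^ 3)) \<le> ennreal (enn2real s)" using s by (simp add: less_top)
      then show ?thesis by (subst (asm) ennreal_le_iff) auto
    qed
    then show ?thesis using that[of "enn2real s"] int by simp
  qed

  let ?N = "\<lambda>n. 2 * n + 1"
  let ?X = "diluted_entry a d b"
  let ?B = "\<lambda>n. real_of_int (b n)"
  have B: "1 \<le> ?B n" for n using b_bounds[of n] by simp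
  have B0: "0 < ?B n" for n using B[of n] by simp
  define S where "S n = band_profile (?B n)" for n
  \<comment> \<open>for \<open>\<eta> \<ge> c\<close> all resolvent entries are at most 1 and the fixed point argument contracts\<close>
  define c where "c = max 1 (2 * v)"

  have ensemble: "band_semicircle M (?N n) (?X n) (S n) v \<eta> (C / sqrt (?B n)) (1 / ?B n) (semicircle_stieltjes v \<eta>)"
    if \<eta>: "c \<le> \<eta>" for n \<eta>
  proof -
    let ?P = "{(i, j). i \<le> j \<and> j < ?N n}"
    \<comment> \<open>from positions in the matrix to labels\<close>
    let ?\<tau> = "\<lambda>p. (int (fst p) - int n, int (snd p) - int n)"
    have tau_J: "?\<tau> (i, j) \<in> J n" if "i \<le> j" "j < ?N n" for i j
      using that by (auto simp: J_def)
    have entry: "?X n (i, j) = (\<lambda>\<omega>. ?A (?\<tau> (i, j)) \<omega> * ?D n (?\<tau> (i, j)) \<omega> / sqrt (?B n))" for i j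
      by (simp add: diluted_entry_def Let_def fun_eq_iff)
    have indep: "indep_vars (\<lambda>_. borel) (?X n) ?P"
    proof -
      have "indep_vars (\<lambda>_. borel) (\<lambda>e \<omega>. ?A e \<omega> * ?D n e \<omega> / sqrt (?B n)) (J n)"
        by (rule indep_vars_times[OF a_indep d_indep JI AD])
      then have "indep_vars (\<lambda>_. borel) (\<lambda>p \<omega>. ?A (?\<tau> p) \<omega> * ?D n (?\<tau> p) \<omega> / sqrt (?B n)) ?P"
        by (rule indep_vars_inj_reindex[of _ _ ?\<tau>]) (auto simp: inj_on_def J_def)
      then show ?thesis by (rule indep_vars_cong[THEN iffD1, rotated -1]) (auto simp: diluted_entry_def Let_def fun_eq_iff)
    qed
    have moment: "has_bochner_integral M (\<lambda>\<omega>. f (?A (?\<tau> (i, j)) \<omega>) * g (?D n (?\<tau> (i, j)) \<omega>)) (m * (?B n * S n i j))"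
      if ij: "i \<le> j" "j < ?N n" and f: "f \<in> borel_measurable borel" "has_bochner_integral M (\<lambda>\<omega>. f (?A (?\<tau> (i, j)) \<omega>)) m"
        and g: "g \<in> borel_measurable borel" "g 0 = 0" "g 1 = 1" for i j f g m
    proof -
      \<comment> \<open>the dilution probability is \<open>b\<close> times the profile, and the factor \<open>b\<close> cancels against the scaling\<close>
      have prof: "\<psi> (real_of_int (fst (?\<tau> (i, j)) - snd (?\<tau> (i, j))) / ?B n) = ?B n * S n i j"
        using B0[of n] by (simp add: S_def band_profile_def)
      have d: "random_variable borel (?D n (?\<tau> (i, j)))"
        using d_indep[of n] tau_J[OF ij] by (auto simp: indep_vars_def)
      show ?thesis
        unfolding prof[symmetric]
        using dilution_integral[OF AD _ tau_J[OF ij] d _ _ f g] JI tau_J[OF ij] d_one d_zero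
        by (auto simp: subset_iff)
    qed
    show ?thesis
    proof unfold_locales
      show "0 < ?N n" by simp
      show "indep_vars (\<lambda>_. borel) (?X n) ?P" by (rule indep)
      fix i j assume ij: "i \<le> j" "j < ?N n"
      have le: "int i - int n \<le> int j - int n" using ij by simp
      have "has_bochner_integral M (\<lambda>\<omega>. ?A (?\<tau> (i, j)) \<omega> * ?D n (?\<tau> (i, j)) \<omega>) (0 * (?B n * S n i j))"
        by (rule moment[OF ij, of "\<lambda>x. x" 0 "\<lambda>x. x"]) (use a_mean[OF le] in simp_all)
      from has_bochner_integral_divide[OF this, of "sqrt (?B n)"]
      show "has_bochner_integral M (?X n (i, j)) 0" unfolding entry by simp
      have "has_bochner_integral M (\<lambda>\<omega>. (?A (?\<tau> (i, j)) \<omega>)\<^sup>2 * (?D n (?\<tau> (i, j)) \<omega>)\<^sup>2) (v\<^sup>2 * (?B n * S n i j))"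
        by (rule moment[OF ij, of "\<lambda>x. x\<^sup>2" "v\<^sup>2" "\<lambda>x. x\<^sup>2"]) (use a_var[OF le] in simp_all)
      from has_bochner_integral_divide[OF this, of "?B n"]
      show "has_bochner_integral M (\<lambda>\<omega>. (?X n (i, j) \<omega>)\<^sup>2) (v\<^sup>2 * S n i j)"
        using B0[of n] unfolding entry by (simp add: power_mult_distrib power_divide)
      let ?m = "expectation (\<lambda>\<omega>. \<bar>?A (?\<tau> (i, j)) \<omega>\<bar> ^ 3)"
      have "has_bochner_integral M (\<lambda>\<omega>. \<bar>?A (?\<tau> (i, j)) \<omega>\<bar> ^ 3 * \<bar>?D n (?\<tau> (i, j)) \<omega>\<bar> ^ 3) (?m * (?B n * S n i j))"
        by (rule moment[OF ij, of "\<lambda>x. \<bar>x\<bar> ^ 3" ?m "\<lambda>x. \<bar>x\<bar> ^ 3"])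
          (use C(2)[OF le] in \<open>simp_all add: has_bochner_integral_iff\<close>)
      from has_bochner_integral_divide[OF this, of "sqrt (?B n) ^ 3"]
      have third: "has_bochner_integral M (\<lambda>\<omega>. \<bar>?X n (i, j) \<omega>\<bar> ^ 3) (?m * (?B n * S n i j) / sqrt (?B n) ^ 3)"
        using B0[of n] unfolding entry by (simp add: abs_mult power_mult_distrib power_divide)
      then show "integrable M (\<lambda>\<omega>. \<bar>?X n (i, j) \<omega>\<bar> ^ 3)" by (simp add: has_bochner_integral_iff)
      have S0: "0 \<le> S n i j" using psi_range B0[of n] by (simp add: S_def band_profile_def)
      have "expectation (\<lambda>\<omega>. \<bar>?X n (i, j) \<omega>\<bar> ^ 3)
          = expectation (\<lambda>\<omega>. \<bar>?A (?\<tau> (i, j)) \<omega>\<bar> ^ 3) * (S n i j / sqrt (?B n))"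
      proof -
        have "?B n / sqrt (?B n) ^ 3 = 1 / sqrt (?B n)"
          using B0[of n] by (simp add: power3_eq_cube field_simps)
        moreover have "x * (y * z) / w = x * z * (y / w)" for x y z w :: real by simp
        ultimately have "?m * (?B n * S n i j) / sqrt (?B n) ^ 3 = ?m * (S n i j / sqrt (?B n))"
          by (simp only:) simp
        moreover have "expectation (\<lambda>\<omega>. \<bar>?X n (i, j) \<omega>\<bar> ^ 3) = ?m * (?B n * S n i j) / sqrt (?B n) ^ 3"
          using third unfolding has_bochner_integral_iff by (rule conjunct2)
        ultimately show ?thesis by (simp only:)
      qed
      also have "\<dots> \<le> C * (S n i j / sqrt (?B n))"
        using C(3)[OF le] S0 B0[of n] by (intro mult_right_mono) auto
      finally show "expectation (\<lambda>\<omega>. \<bar>?X n (i, j) \<omega>\<bar> ^ 3) \<le> C / sqrt (?B n) * S n i j" by simp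
    next
      fix i j
      show "S n i j = S n j i"
        using psi_even[of "(real i - real j) / ?B n"] by (simp add: S_def band_profile_def minus_divide_left)
      show "0 \<le> S n i j" using psi_range B0[of n] by (simp add: S_def band_profile_def)
      show "S n i j \<le> 1 / ?B n" using psi_range B0[of n] by (simp add: S_def band_profile_def divide_right_mono)
    next
      fix i assume "i < ?N n"
      from row_le[OF B0 this] B[of n] show "(\<Sum>j<?N n. S n i j) \<le> 2"
        unfolding S_def by (smt (verit) divide_le_eq_1)
    next
      show "0 < v" by (rule v_pos)
      show "1 \<le> \<eta>" using \<eta> by (simp add: c_def)
      show "4 * v\<^sup>2 \<le> \<eta>\<^sup>2" using \<eta> power_mono[of "2 * v" \<eta> 2] v_pos by (simp add: c_def power_mult_distrib)
      show "0 \<le> C / sqrt (?B n)" using C(1) B0[of n] by simp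
      show "(complex_of_real v)\<^sup>2 * (semicircle_stieltjes v \<eta>)\<^sup>2 + \<i> * \<eta> * semicircle_stieltjes v \<eta> + 1 = 0"
        by (rule semicircle_stieltjes_quadratic[OF v_pos])
      show "cmod (semicircle_stieltjes v \<eta>) \<le> 1 / \<eta>"
        using \<eta> v_pos by (intro semicircle_stieltjes_le) (auto simp: c_def)
    qed
  qed

  define defect where "defect n = (\<Sum>k<?N n. \<bar>1 - (\<Sum>l<?N n. S n k l)\<bar>) / real (?N n)" for n
  define err where "err n = 7 * v\<^sup>2 * (1 / ?B n) + 168 * (C / sqrt (?B n))" for n
  have B_top: "filterlim ?B at_top sequentially"
    using filterlim_compose[OF filterlim_real_of_int_at_top b_infinity] .
  have inv_B: "(\<lambda>n. 1 / ?B n) \<longlonglongrightarrow> 0" "(\<lambda>n. 1 / sqrt (?B n)) \<longlonglongrightarrow> 0"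
    using tendsto_inverse_0_at_top[OF B_top] tendsto_inverse_0_at_top[OF filterlim_compose[OF sqrt_at_top B_top]]
    by (simp_all add: inverse_eq_divide)
  have err: "err \<longlonglongrightarrow> 0"
    using tendsto_add[OF tendsto_mult_left[OF inv_B(1), of "7 * v\<^sup>2"] tendsto_mult_left[OF inv_B(2), of "168 * C"]]
    by (simp add: err_def[abs_def])
  have B_N: "(\<lambda>n. ?B n / real (?N n)) \<longlonglongrightarrow> 0"
  proof (rule Lim_null_comparison[OF _ b_over_n])
    have "norm (?B n / real (?N n)) \<le> ?B n / real n" if "1 \<le> n" for n
      using that B0[of n] by (simp add: divide_left_mono)
    then show "eventually (\<lambda>n. norm (?B n / real (?N n)) \<le> ?B n / real n) sequentially"
      unfolding eventually_sequentially by blast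
  qed
  have defect: "defect \<longlonglongrightarrow> 0"
  proof (rule LIMSEQ_I)
    fix e :: real assume e: "0 < e"
    then have "0 < e / 2" by simp
    then obtain L where L: "0 < L" "\<And>b N. 0 < b \<Longrightarrow> 0 < N \<Longrightarrow>
       (\<Sum>k<N. \<bar>1 - (\<Sum>l<N. band_profile b k l)\<bar>) / real N \<le> e / 2 + L * b / real N + 4 / b"
      by (rule average_row_defect) (rule that)
    have "(\<lambda>n. L * (?B n / real (?N n)) + 4 * (1 / ?B n)) \<longlonglongrightarrow> L * 0 + 4 * 0"
      by (intro tendsto_add tendsto_mult_left B_N inv_B)
    then have "eventually (\<lambda>n. L * (?B n / real (?N n)) + 4 * (1 / ?B n) < e / 2) sequentially"
      by (rule order_tendstoD(2)) (use e in simp)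
    then obtain n0 where n0: "\<And>n. n0 \<le> n \<Longrightarrow> L * (?B n / real (?N n)) + 4 * (1 / ?B n) < e / 2"
      unfolding eventually_sequentially by blast
    have "norm (defect n - 0) < e" if "n0 \<le> n" for n
    proof -
      have "defect n \<le> e / 2 + L * ?B n / real (?N n) + 4 / ?B n"
        unfolding defect_def S_def by (rule L(2)[OF B0]) simp
      moreover have "0 \<le> defect n" unfolding defect_def by (intro divide_nonneg_nonneg sum_nonneg) auto
      moreover have "L * ?B n / real (?N n) + 4 / ?B n = L * (?B n / real (?N n)) + 4 * (1 / ?B n)" by simp
      ultimately show ?thesis using n0[OF that] unfolding real_norm_def by linarith
    qed
    then show "\<exists>no. \<forall>n\<ge>no. norm (defect n - 0) < e" by blast
  qed

  let ?spec = "\<lambda>n \<omega>. sorted_eigenvalues (percolation_matrix a d b n \<omega>)"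
  have trace: "(\<Sum>r\<leftarrow>?spec n \<omega>. 1 / (complex_of_real r - \<i> * of_real \<eta>))
      = (\<Sum>i<?N n. resolvent (?N n) (\<i> * of_real \<eta>) (\<lambda>p. ?X n p \<omega>) i i)" if "c \<le> \<eta>" for n \<omega> \<eta>
    unfolding percolation_matrix_eq
    by (rule trace_resolvent_eigenvalues) (use that in \<open>simp add: c_def\<close>)
  interpret spectral_sample M ?spec ?N "semicircle_density v" c
  proof unfold_locales
    show "length (?spec n \<omega>) = ?N n" for n \<omega> unfolding percolation_matrix_eq by (rule length_sorted_eigenvalues)
    show "0 < ?N n" for n :: nat by simp
    show "0 < c" by (simp add: c_def)
    show "0 \<le> semicircle_density v x" for x by (rule semicircle_density_nonneg)
    show "has_bochner_integral lborel (semicircle_density v) 1" by (rule semicircle_total[OF v_pos])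
    fix \<eta> assume \<eta>: "c \<le> \<eta>"
    then have \<eta>0: "0 < \<eta>" by (simp add: c_def)
    show "(\<lambda>\<omega>. \<Sum>r\<leftarrow>?spec n \<omega>. 1 / (complex_of_real r - \<i> * of_real \<eta>)) \<in> borel_measurable M" for n
    proof -
      interpret band_semicircle M "?N n" "?X n" "S n" v \<eta> "C / sqrt (?B n)" "1 / ?B n" "semicircle_stieltjes v \<eta>"
        by (rule ensemble[OF \<eta>])
      show ?thesis unfolding trace[OF \<eta>] using G_measurable unfolding G_def by (intro borel_measurable_sum) auto
    qed
    let ?E = "\<lambda>n. expectation (\<lambda>\<omega>. cmod ((\<Sum>r\<leftarrow>?spec n \<omega>. 1 / (complex_of_real r - \<i> * of_real \<eta>)) / ?N n
         - (\<integral>x. semicircle_density v x *\<^sub>R (1 / (complex_of_real x - \<i> * of_real \<eta>)) \<partial>lborel)))"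
    have bound: "?E n \<le> u + (4 * err n + 6 * defect n) / u + defect n" if u: "0 < u" for n u
    proof -
      interpret BS: band_semicircle M "?N n" "?X n" "S n" v \<eta> "C / sqrt (?B n)" "1 / ?B n" "semicircle_stieltjes v \<eta>"
        by (rule ensemble[OF \<eta>])
      have "?E n = expectation (\<lambda>\<omega>. cmod ((\<Sum>i<?N n. BS.G \<omega> i i) / real (?N n) - semicircle_stieltjes v \<eta>))"
        unfolding trace[OF \<eta>] semicircle_integral_resolvent[OF v_pos \<eta>0] BS.G_def
        by (simp only: of_real_of_nat_eq)
      also have "\<dots> \<le> u + (4 * err n + 6 * defect n) / u + defect n"
        using BS.normalized_trace_close[OF u] unfolding BS.defect_def defect_def err_def .
      finally show ?thesis .
    qed
    show "?E \<longlonglongrightarrow> 0"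
    proof (rule LIMSEQ_I)
      fix e :: real assume e: "0 < e"
      \<comment> \<open>the fixed part \<open>u\<close> of the bound takes half of \<open>e\<close>; the rest tends to 0 with \<open>u\<close> fixed\<close>
      define u where "u = e / 2"
      have u: "0 < u" using e by (simp add: u_def)
      have "(\<lambda>n. (4 * err n + 6 * defect n) / u + defect n) \<longlonglongrightarrow> (4 * 0 + 6 * 0) / u + 0"
        using u by (intro tendsto_intros err defect) auto
      then have "eventually (\<lambda>n. (4 * err n + 6 * defect n) / u + defect n < e / 2) sequentially"
        by (rule order_tendstoD(2)) (use e in simp)
      then obtain n0 where n0: "\<And>n. n0 \<le> n \<Longrightarrow> (4 * err n + 6 * defect n) / u + defect n < e / 2"
        unfolding eventually_sequentially by blast
      have "norm (?E n - 0) < e" if "n0 \<le> n" for n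
      proof -
        have "0 \<le> ?E n" by (intro integral_nonneg_AE AE_I2 norm_ge_zero)
        moreover have "?E n < e" using bound[OF u, of n] n0[OF that] u_def by linarith
        ultimately show ?thesis unfolding real_norm_def diff_zero by (simp only: abs_of_nonneg)
      qed
      then show "\<exists>no. \<forall>n\<ge>no. norm (?E n - 0) < e" by blast
    qed
  qed
  have counting: "(\<lambda>n \<omega>. eigenvalue_counting (percolation_matrix a d b n \<omega>) t) = fraction {..t}"
  proof (intro ext)
    show "eigenvalue_counting (percolation_matrix a d b n \<omega>) t = fraction {..t} n \<omega>" for n \<omega>
      unfolding fraction_def unfolding percolation_matrix_eq by (rule eigenvalue_counting_eq)
  qed
  show "tendsto_in_probability M
      (\<lambda>n \<omega>. eigenvalue_counting (percolation_matrix a d b n \<omega>) t) (semicircle_cdf v t)"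
    unfolding counting semicircle_cdf_def by (rule fraction_tendsto_in_probability)
qed

end
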